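(* Let the Hawkes process $\mathbf N$ and the coupled compound Poisson process $\mathbf L$ be as in the context, and let assumptions (A1)–(A4) there hold. Let $\mathbf k\in\mathbb Z_+^d\setminus\{\mathbf 0\}$ and suppose that $$\int_{x/\log x}^\infty f_{p\leftarrow q}(t)\,dt=o\big(\breve\lambda_{\mathbf k}(x)/x\big)\quad\text{as }x\to\infty,\qquad\forall(p,q)\in[d]^2.$$ Then for any $\Delta>0$, $$\lim_{n\to\infty}\mathbf P\Big(d_{\mathcal P}^{[0,\infty)}\big(\bar{\mathbf N}_n^{[0,\infty)},\bar{\mathbf L}_n^{[0,\infty)}\big)>\Delta\Big)\Big/\breve\lambda_{\mathbf k}(n)=0.$$
   Context: **Notation.** $\mathbb Z_+=\{0,1,\dots\}$, $[d]=\{1,\dots,d\}$. $\phi\in\mathcal{RV}_\beta$ means $\phi(tx)/\phi(x)\to t^\beta$ as $x\to\infty$ for all $t>0$. **Hawkes process.** Let $c_i>0$ ($i\in[d]$), $f_{i\leftarrow j}:[0,\infty)\to[0,\infty)$ deterministic integrable, $\mu_{i\leftarrow j}=\int_0^\infty f_{i\leftarrow j}(t)dt\in(0,\infty)$, and $\tilde B_{i\leftarrow j}$ non-negative random variables. $\mathbf N(t)=(N_1(t),\dots,N_d(t))^\top$ is the Hawkes process with $\mathbf N(0)=\mathbf 0$ and conditional intensities $h_i(t)=c_i+\sum_{j\in[d]}\int_0^t\tilde B_{i\leftarrow j}(s)f_{i\leftarrow j}(t-s)dN_j(s)$, where $(\tilde B_{i\leftarrow j}(s))_{s>0}$ are independent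 copies of $\tilde B_{i\leftarrow j}$, mutually independent across $i,j$. It is realized by its cluster construction: for each $i\in[d]$, type-$i$ immigrants arrive at the points $0<T^{\mathcal C}_{i;1}<T^{\mathcal C}_{i;2}<\dots$ of independent Poisson processes of rates $c_i$; each individual (immigrant or descendant) of type $l$ born at time $t$, independently over individuals and over $i\in[d]$, draws a copy $b$ of $\tilde B_{i\leftarrow l}$ and has Poisson$(b\mu_{i\leftarrow l})$ type-$i$ children, with birth times $t$ plus i.i.d. variables of density $f_{i\leftarrow l}/\mu_{i\leftarrow l}$; $N_i(t)$ counts all type-$i$ individuals born by time $t$. The cluster of an immigrant consists of itself and all its descendants. **Coupled process.** $\mathbf S_j^{(k)}\in\mathbb Z_+^d$ is the vector of the numbers of individuals of each type in the cluster of the $k$-th type-$j$ immigrant (including the immigrant), and $\mathbf S_j=(S_{1\leftarrow j},\dots,S_{d\leftarrow j})^\top$ denotes a generic copy of $\mathbf S^{(k)}_j$. Set $\mathbf L(t)=\sum_{i\in[d]}\sum_{k\ge1}\mathbf S_i^{(k)}\mathbf 1\{T^{\mathcal C}_{i;k}\le t\}$. Let $\bar{\mathbf N}_n^{[0,\infty)}=\{\mathbf N(nt)/n:t\ge0\}$ and $\bar{\mathbf L}_n^{[0,\infty)}=\{\mathbf L(nt)/n:t\ge0\}$. **Assumptions.** (A1) The matrix $(\mathbf E[\tilde B_{i\leftarrow j}]\mu_{i\leftarrow j})_{i,j\in[d]}$ has spectral radius $<1$. (A2) For all $(i,j)$ there is $\alpha_{j\leftarrow i}\in(1,\infty)$ with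 $\mathbf P(\tilde B_{j\leftarrow i}>x)\in\mathcal{RV}_{-\alpha_{j\leftarrow i}}$. (A3) $\mathbf E S_{j\leftarrow i}>0$ for all $(i,j)$. (A4) The $\alpha_{j\leftarrow i}$, $(i,j)\in[d]^2$, are pairwise distinct. **Rates.** $B_{i\leftarrow j}\overset d=\mathrm{Poisson}(\tilde B_{i\leftarrow j}\mu_{i\leftarrow j})$ (mixed Poisson), $l^*(j)=\arg\min_{l\in[d]}\alpha_{j\leftarrow l}$, $\lambda_{\{i\}}(n)=\mathbf P(B_{i\leftarrow l^*(i)}>n)$, and $\breve\lambda_{\mathbf k}(n)=\prod_{i\in[d]}(n\lambda_{\{i\}}(n))^{k_i}$. **Product $M_1$ metric.** For $\xi\in\mathbb D([0,T],\mathbb R)$ (càdlàg functions) let $\Gamma_\xi=\{(z,t)\in\mathbb R\times[0,T]:z\in[\xi(t-)\wedge\xi(t),\xi(t-)\vee\xi(t)]\}$ with $\xi(0-)=\xi(0)$, ordered by $(z_1,t_1)\le(z_2,t_2)$ if $t_1<t_2$, or $t_1=t_2$ and $|z_1-\xi(t_1-)|\le|z_2-\xi(t_1-)|$. A parametric representation of $\xi$ is a continuous non-decreasing map $(u,s)$ from $[0,1]$ onto $\Gamma_\xi$. $d_{M_1}^{[0,T]}(\xi^{(1)},\xi^{(2)})=\inf\sup_{t\in[0,1]}|u_1(t)-u_2(t)|\vee|s_1(t)-s_2(t)|$ over parametric representations $(u_i,s_i)$ of $\xi^{(i)}$. For $\mathbb R^d$-valued càdlàg paths, $d_{\mathcal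 P}^{[0,T]}(\xi^{(1)},\xi^{(2)})=\max_{j\in[d]}d_{M_1}^{[0,T]}(\xi^{(1)}_j,\xi^{(2)}_j)$ and, for paths on $[0,\infty)$, $d_{\mathcal P}^{[0,\infty)}(\xi^{(1)},\xi^{(2)})=\int_0^\infty e^{-t}[d_{\mathcal P}^{[0,t]}(\xi^{(1)}|_{[0,t]},\xi^{(2)}|_{[0,t]})\wedge1]dt$. *)

theory Defs
  imports
    "HOL-Probability.Probability"
    "HOL-Library.Landau_Symbols"
    "Jordan_Normal_Form.Spectral_Radius"
begin

section \<open>Regular variation, mixed Poisson laws and outer probability\<close>

definition regularly_varying :: "real \<Rightarrow> (real \<Rightarrow> real) \<Rightarrow> bool" where
  "regularly_varying \<beta> \<phi> \<longleftrightarrow> (\<forall>t>0. ((\<lambda>x. \<phi> (t * x) / \<phi> x) \<longlongrightarrow> t powr \<beta>) at_top)"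

text \<open>The library's \<open>poisson_pmf\<close> is specified for positive rates only, while a mark may vanish;
  since \<open>0 ^ 0 = 1\<close>, the formula below gives the point mass at 0 for rate 0.\<close>

definition poisson_prob :: "real \<Rightarrow> nat \<Rightarrow> real" where
  "poisson_prob r n = r ^ n / fact n * exp (- r)"

text \<open>The law of \<open>Poisson(B * m)\<close>, where \<open>B\<close> has law \<open>\<beta>\<close>.\<close>

definition mixed_poisson :: "real measure \<Rightarrow> real \<Rightarrow> nat measure" where
  "mixed_poisson \<beta> m = density (count_space UNIV) (\<lambda>n. \<integral>\<^sup>+b. ennreal (poisson_prob (b * m) n) \<partial>\<beta>)"

text \<open>Outer probability. It coincides with \<open>measure M E\<close> for every event \<open>E\<close> (lemma below) and
  bounds it from above in general, whereas \<open>measure M E\<close> is 0 by convention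
  if \<open>E\<close> is not measurable. It is used because the distances below are infima over
  uncountable families.\<close>

definition outer_prob :: "'a measure \<Rightarrow> 'a set \<Rightarrow> real" where
  "outer_prob M E = Inf {measure M A | A. A \<in> sets M \<and> E \<subseteq> A}"

lemma (in prob_space) outer_prob_event:
  assumes "E \<in> events"
  shows "outer_prob M E = prob E"
  unfolding outer_prob_def
proof (rule cInf_eq_minimum)
  show "prob E \<in> {prob A | A. A \<in> events \<and> E \<subseteq> A}"
    using assms by blast
  show "\<And>x. x \<in> {prob A | A. A \<in> events \<and> E \<subseteq> A} \<Longrightarrow> prob E \<le> x"
    using finite_measure_mono by blast
qed

section \<open>The product \<open>M\<^sub>1\<close> metric\<close>

definition left_limit :: "(real \<Rightarrow> real) \<Rightarrow> real \<Rightarrow> real" where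
  "left_limit \<xi> t = (if t = 0 then \<xi> 0 else Lim (at_left t) \<xi>)"

text \<open>All notions on \<open>[0,T]\<close> only look at the values of \<open>\<xi>\<close> on \<open>[0,T]\<close>, so a path on
  \<open>[0,\<infinity>)\<close> need not be restricted explicitly.\<close>

definition completed_graph :: "real \<Rightarrow> (real \<Rightarrow> real) \<Rightarrow> (real \<times> real) set" where
  "completed_graph T \<xi> = {(z, t). 0 \<le> t \<and> t \<le> T \<and>
     min (left_limit \<xi> t) (\<xi> t) \<le> z \<and> z \<le> max (left_limit \<xi> t) (\<xi> t)}"

definition graph_le :: "(real \<Rightarrow> real) \<Rightarrow> real \<times> real \<Rightarrow> real \<times> real \<Rightarrow> bool" where
  "graph_le \<xi> a b \<longleftrightarrow> snd a < snd b \<or>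
     snd a = snd b \<and> \<bar>fst a - left_limit \<xi> (snd a)\<bar> \<le> \<bar>fst b - left_limit \<xi> (snd a)\<bar>"

definition parametric_representation :: "real \<Rightarrow> (real \<Rightarrow> real) \<Rightarrow> (real \<Rightarrow> real \<times> real) \<Rightarrow> bool" where
  "parametric_representation T \<xi> g \<longleftrightarrow>
     continuous_on {0..1} g \<and> g ` {0..1} = completed_graph T \<xi> \<and>
     (\<forall>r\<in>{0..1}. \<forall>r'\<in>{0..1}. r \<le> r' \<longrightarrow> graph_le \<xi> (g r) (g r'))"

definition dist_M1 :: "real \<Rightarrow> (real \<Rightarrow> real) \<Rightarrow> (real \<Rightarrow> real) \<Rightarrow> real" where
  "dist_M1 T \<xi> \<eta> = Inf {SUP r\<in>{0..1}. max \<bar>fst (g r) - fst (h r)\<bar> \<bar>snd (g r) - snd (h r)\<bar> | g h.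
     parametric_representation T \<xi> g \<and> parametric_representation T \<eta> h}"

definition dist_P :: "real \<Rightarrow> (real \<Rightarrow> real^'d) \<Rightarrow> (real \<Rightarrow> real^'d) \<Rightarrow> real" where
  "dist_P T \<xi> \<eta> = (MAX j. dist_M1 T (\<lambda>t. vec_nth (\<xi> t) j) (\<lambda>t. vec_nth (\<eta> t) j))"

definition dist_P_infinity :: "(real \<Rightarrow> real^'d) \<Rightarrow> (real \<Rightarrow> real^'d) \<Rightarrow> real" where
  "dist_P_infinity \<xi> \<eta> =
     enn2real (\<integral>\<^sup>+t\<in>{0..}. ennreal (exp (- t) * min (dist_P t \<xi> \<eta>) 1) \<partial>lborel)"

section \<open>Cluster construction of the Hawkes process\<close>

text \<open>The types \<open>[d]\<close> are the elements of a finite type \<open>'d\<close>. An index \<open>i j\<close> of a family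
  stands for \<open>i \<leftarrow> j\<close>, that is, \<open>j\<close> is the type of the parent.

  Potential individuals carry Ulam-Harris labels: \<open>(j, k, [])\<close> is the \<open>k\<close>-th immigrant of type
  \<open>j\<close> (counted from 0), and \<open>(j, k, (i, m) # p)\<close> is the \<open>m\<close>-th child of type \<open>i\<close> (counted
  from 0) of \<open>(j, k, p)\<close>. The path to the ancestor is thus listed with the youngest generation
  first. Every label has noise variables attached to it, but only those of
  individuals that are actually born enter the processes.\<close>

type_synonym 'd label = "'d \<times> nat \<times> ('d \<times> nat) list"

fun label_type :: "'d label \<Rightarrow> 'd" where
  "label_type (j, k, []) = j"
| "label_type (j, k, (i, m) # p) = i"

fun is_born :: "('d label \<Rightarrow> 'd \<Rightarrow> 'a \<Rightarrow> nat) \<Rightarrow> 'a \<Rightarrow> 'd label \<Rightarrow> bool" where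
  "is_born nchild \<omega> (j, k, []) \<longleftrightarrow> True"
| "is_born nchild \<omega> (j, k, (i, m) # p) \<longleftrightarrow>
     is_born nchild \<omega> (j, k, p) \<and> m < nchild (j, k, p) i \<omega>"

definition arrival_time :: "('d \<Rightarrow> nat \<Rightarrow> 'a \<Rightarrow> real) \<Rightarrow> 'd \<Rightarrow> nat \<Rightarrow> 'a \<Rightarrow> real" where
  "arrival_time gap j k \<omega> = (\<Sum>l\<le>k. gap j l \<omega>)"

fun birth_time :: "('d \<Rightarrow> nat \<Rightarrow> 'a \<Rightarrow> real) \<Rightarrow> ('d label \<Rightarrow> 'd \<Rightarrow> nat \<Rightarrow> 'a \<Rightarrow> real) \<Rightarrow>
    'a \<Rightarrow> 'd label \<Rightarrow> real" where
  "birth_time gap delay \<omega> (j, k, []) = arrival_time gap j k \<omega>"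
| "birth_time gap delay \<omega> (j, k, (i, m) # p) =
     birth_time gap delay \<omega> (j, k, p) + delay (j, k, p) i m \<omega>"

text \<open>Under the assumptions of the theorem the sets counted and summed over below are
  almost surely finite.\<close>

definition hawkes :: "('d::finite \<Rightarrow> nat \<Rightarrow> 'a \<Rightarrow> real) \<Rightarrow> ('d label \<Rightarrow> 'd \<Rightarrow> 'a \<Rightarrow> nat) \<Rightarrow>
    ('d label \<Rightarrow> 'd \<Rightarrow> nat \<Rightarrow> 'a \<Rightarrow> real) \<Rightarrow> 'a \<Rightarrow> real \<Rightarrow> real^'d" where
  "hawkes gap nchild delay \<omega> t = (\<chi> i. real (card {u. is_born nchild \<omega> u \<and>
     label_type u = i \<and> birth_time gap delay \<omega> u \<le> t}))"

definition cluster_size :: "('d::finite label \<Rightarrow> 'd \<Rightarrow> 'a \<Rightarrow> nat) \<Rightarrow> 'd \<Rightarrow> nat \<Rightarrow> 'a \<Rightarrow> real^'d" where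
  "cluster_size nchild j k \<omega> =
     (\<chi> i. real (card {p. is_born nchild \<omega> (j, k, p) \<and> label_type (j, k, p) = i}))"

definition coupled_process :: "('d::finite \<Rightarrow> nat \<Rightarrow> 'a \<Rightarrow> real) \<Rightarrow> ('d label \<Rightarrow> 'd \<Rightarrow> 'a \<Rightarrow> nat) \<Rightarrow>
    'a \<Rightarrow> real \<Rightarrow> real^'d" where
  "coupled_process gap nchild \<omega> t =
     (\<Sum>i\<in>UNIV. \<Sum>k\<in>{k. arrival_time gap i k \<omega> \<le> t}. cluster_size nchild i k \<omega>)"

definition rescaled :: "nat \<Rightarrow> (real \<Rightarrow> real^'d) \<Rightarrow> real \<Rightarrow> real^'d" where
  "rescaled n \<xi> t = (1 / real n) *\<^sub>R \<xi> (real n * t)"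

definition mass :: "(real \<Rightarrow> real) \<Rightarrow> real" where
  "mass f = (LBINT t:{0..}. f t)"

datatype 'd noise_index = Gap 'd nat | Offspring "'d label" 'd | Delay "'d label" 'd nat

primrec noise_events :: "'a measure \<Rightarrow> ('d \<Rightarrow> nat \<Rightarrow> 'a \<Rightarrow> real) \<Rightarrow> ('d label \<Rightarrow> 'd \<Rightarrow> 'a \<Rightarrow> real) \<Rightarrow>
    ('d label \<Rightarrow> 'd \<Rightarrow> 'a \<Rightarrow> nat) \<Rightarrow> ('d label \<Rightarrow> 'd \<Rightarrow> nat \<Rightarrow> 'a \<Rightarrow> real) \<Rightarrow>
    'd noise_index \<Rightarrow> 'a set set" where
  "noise_events M gap mark nchild delay (Gap j k) =
     sets (vimage_algebra (space M) (gap j k) borel)"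
| "noise_events M gap mark nchild delay (Offspring u i) =
     sets (vimage_algebra (space M) (\<lambda>\<omega>. (mark u i \<omega>, nchild u i \<omega>)) (borel \<Otimes>\<^sub>M count_space UNIV))"
| "noise_events M gap mark nchild delay (Delay u i m) =
     sets (vimage_algebra (space M) (delay u i m) borel)"

text \<open>The marks \<open>B~\<close> of the model enter through their laws \<open>\<beta> i j\<close> only. The immigrants form
  Poisson processes, given by independent exponential interarrival times \<open>gap\<close>. The number
  \<open>nchild u i\<close> of type-\<open>i\<close> children of \<open>u\<close> is \<open>Poisson(b * \<mu>)\<close> given the mark \<open>mark u i = b\<close>.\<close>

locale hawkes_clusters = prob_space M
  for M :: "'a measure" +
  fixes c :: "'d::finite \<Rightarrow> real"
    and f :: "'d \<Rightarrow> 'd \<Rightarrow> real \<Rightarrow> real"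
    and \<beta> :: "'d \<Rightarrow> 'd \<Rightarrow> real measure"
    and gap :: "'d \<Rightarrow> nat \<Rightarrow> 'a \<Rightarrow> real"
    and mark :: "'d label \<Rightarrow> 'd \<Rightarrow> 'a \<Rightarrow> real"
    and nchild :: "'d label \<Rightarrow> 'd \<Rightarrow> 'a \<Rightarrow> nat"
    and delay :: "'d label \<Rightarrow> 'd \<Rightarrow> nat \<Rightarrow> 'a \<Rightarrow> real"
  assumes c_pos: "c i > 0"
    and f_nonneg: "t \<ge> 0 \<Longrightarrow> f i j t \<ge> 0"
    and f_integrable: "set_integrable lborel {0..} (f i j)"
    and f_mass_pos: "mass (f i j) > 0"
    and mark_law_prob: "prob_space (\<beta> i j)"
    and mark_law_sets: "sets (\<beta> i j) = sets borel"
    and mark_law_nonneg: "AE b in \<beta> i j. b \<ge> 0"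
    and gap_law: "distributed M lborel (gap i k) (exponential_density (c i))"
    and mark_measurable: "mark u i \<in> borel_measurable M"
    and nchild_measurable: "nchild u i \<in> measurable M (count_space UNIV)"
    and offspring_law: "A \<in> sets borel \<Longrightarrow>
          emeasure M {\<omega> \<in> space M. mark u i \<omega> \<in> A \<and> nchild u i \<omega> = n} =
          (\<integral>\<^sup>+b\<in>A. ennreal (poisson_prob (b * mass (f i (label_type u))) n) \<partial>\<beta> i (label_type u))"
    and delay_law: "distributed M lborel (delay u i m)
          (\<lambda>t. ennreal (indicator {0..} t * f i (label_type u) t / mass (f i (label_type u))))"
    and independent: "indep_sets (noise_events M gap mark nchild delay) UNIV"

section \<open>Branching matrix and rates\<close>

text \<open>The library's spectral radius lives on matrices indexed by numbers, hence the
  enumeration \<open>from_nat_into UNIV\<close> of \<open>'d\<close>, a bijection from \<open>{..<CARD('d)}\<close>.\<close>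

definition mean_offspring_matrix ::
    "('d::finite \<Rightarrow> 'd \<Rightarrow> real \<Rightarrow> real) \<Rightarrow> ('d \<Rightarrow> 'd \<Rightarrow> real measure) \<Rightarrow> complex Matrix.mat" where
  "mean_offspring_matrix f \<beta> = Matrix.mat CARD('d) CARD('d) (\<lambda>(a, b).
     let i = from_nat_into UNIV a; j = from_nat_into UNIV b
     in complex_of_real ((\<integral>x. x \<partial>\<beta> i j) * mass (f i j)))"

definition l_star :: "('d::finite \<Rightarrow> 'd \<Rightarrow> real) \<Rightarrow> 'd \<Rightarrow> 'd" where
  "l_star \<alpha> j = (ARG_MIN (\<alpha> j) l. l \<in> UNIV)"

definition rate :: "('d::finite \<Rightarrow> 'd \<Rightarrow> real \<Rightarrow> real) \<Rightarrow> ('d \<Rightarrow> 'd \<Rightarrow> real measure) \<Rightarrow>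
    ('d \<Rightarrow> 'd \<Rightarrow> real) \<Rightarrow> 'd \<Rightarrow> real \<Rightarrow> real" where
  "rate f \<beta> \<alpha> i x =
     measure (mixed_poisson (\<beta> i (l_star \<alpha> i)) (mass (f i (l_star \<alpha> i)))) {n. real n > x}"

definition breve_rate :: "('d::finite \<Rightarrow> 'd \<Rightarrow> real \<Rightarrow> real) \<Rightarrow> ('d \<Rightarrow> 'd \<Rightarrow> real measure) \<Rightarrow>
    ('d \<Rightarrow> 'd \<Rightarrow> real) \<Rightarrow> ('d \<Rightarrow> nat) \<Rightarrow> real \<Rightarrow> real" where
  "breve_rate f \<beta> \<alpha> k x = (\<Prod>i\<in>UNIV. (x * rate f \<beta> \<alpha> i x) ^ k i)"

end

theory Submission
  imports Defs "HOL-Real_Asymp.Real_Asymp"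
begin

text \<open>
  Rescaled, \<open>N \<le> L\<close>, and if every individual of a cluster is born within time \<open>\<epsilon> * n\<close> of its immigrant, then
  \<open>L (t - \<epsilon>) \<le> N t\<close>. For monotone paths this bounds the \<open>M\<^sub>1\<close> distance on \<open>[0,T]\<close> by \<open>\<epsilon>\<close>, except for those
  \<open>T\<close> that closely follow an atypically large increase of \<open>L\<close>; the exponentially weighted integral over
  \<open>T\<close> only requires that these have small measure.

  Take \<open>\<epsilon> = H / ln n\<close> with a large constant \<open>H\<close>. The rate is bounded below by a power of \<open>n\<close>, so it is
  enough that each bad event has a probability that is either superpolynomially small, or a power of \<open>n\<close> of
  sufficiently negative degree, or controlled by the tail hypothesis.
  A delay longer than \<open>n / ln n\<close> occurs among \<open>O(n)\<close> clusters with negligible probability by hypothesis. With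
  all delays below \<open>n / ln n\<close>, an exponential moment of order \<open>(ln n)\<^sup>2 / (4 n)\<close> of a delay is close to 1;
  since the branching matrix is strictly subcritical, the sum over all individuals of a cluster of these
  moments along their ancestral lines stays bounded, and the expected number of late individuals is at
  most of order \<open>n powr (- H / 4)\<close>.
  Finally group the immigrants of each type into blocks of order \<open>\<epsilon> * n\<close> members. The block sums of the
  cluster sizes are independent and large with probability \<open>O(1 / ln n)\<close> by Markov's inequality, so that
  a positive fraction of the order of \<open>ln n\<close> blocks is large with probability at most
  \<open>(C / ln n) powr (\<phi> * ln n)\<close>, which is superpolynomially small. First moments of the cluster sizes
  therefore suffice.
\<close>

section \<open>The \<open>M\<^sub>1\<close> distance of monotone paths\<close>

text \<open>The obstacle sits at the right end of \<open>[0,T]\<close>: a large cluster whose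
  immigrant has arrived before \<open>T\<close>, but whose members are not all born by then, makes
  the coupled path exceed the Hawkes path at \<open>T\<close>, and no time change repairs this.
  Heavy-tailed marks make such clusters only polynomially rare, as is the rate itself, so they
  cannot be put into a negligible event. But each large block spoils only an interval of horizons of
  length \<open>18 * \<epsilon>\<close>, which is of order 1 / ln n, so the integral over the
  horizon notices them only when there are order ln n of them. The exponent \<theta> = (ln n)^2 / (4
  n) balances two demands. On the other hand \<theta> * \<epsilon> * n is H / 4 times ln n, so a
  constant H buys any power of n.\<close>

locale monotone_path =
  fixes T :: real and x :: "real \<Rightarrow> real"
  assumes T: "0 \<le> T"
    and mono: "0 \<le> s \<Longrightarrow> s \<le> t \<Longrightarrow> t \<le> T \<Longrightarrow> x s \<le> x t"
    and right_cont: "0 \<le> t \<Longrightarrow> t < T \<Longrightarrow> (x \<longlongrightarrow> x t) (at_right t)"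
begin

text \<open>A \<open>Lim\<close> says nothing until convergence is shown: by monotonicity the left
  limit at t > 0 exists and is the supremum of the earlier values. At 0 it is \<open>x 0\<close> by
  convention.\<close>

lemma left_limit_bounds:
  assumes t: "0 \<le> t" "t \<le> T"
  shows left_limit_ge: "0 \<le> s \<Longrightarrow> s < t \<Longrightarrow> x s \<le> left_limit x t"
    and left_limit_le: "left_limit x t \<le> x t"
    and left_limit_least: "0 < t \<Longrightarrow> (\<And>s. 0 \<le> s \<Longrightarrow> s < t \<Longrightarrow> x s \<le> v) \<Longrightarrow> left_limit x t \<le> v"
proof -
  define S where "S = Sup (x ` {0..<t})"
  have bdd: "bdd_above (x ` {0..<t})"
    by (rule bdd_aboveI[of _ "x t"]) (use mono t in auto)
  have lim: "left_limit x t = S" if t0: "0 < t"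
  proof -
    have "(x \<longlongrightarrow> S) (at_left t)"
    proof (rule order_tendstoI)
      fix a assume "a < S"
      then obtain s where s: "s \<in> {0..<t}" "a < x s"
        unfolding S_def using less_cSup_iff[OF _ bdd, of a] t0 by auto
      have "a < x u" if "s < u" "u < t" for u
        using mono[of s u] s t that by force
      then show "\<forall>\<^sub>F u in at_left t. a < x u"
        using s by (intro eventually_at_leftI[of s]) auto
    next
      fix a assume "S < a"
      have "x u < a" if "0 < u" "u < t" for u
        using cSup_upper[OF _ bdd, of "x u"] that \<open>S < a\<close> by (force simp: S_def)
      then show "\<forall>\<^sub>F u in at_left t. x u < a"
        using t0 by (intro eventually_at_leftI[of 0]) auto
    qed
    then show ?thesis
      using t0 by (simp add: left_limit_def tendsto_Lim)
  qed
  show "x s \<le> left_limit x t" if "0 \<le> s" "s < t"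
    using lim cSup_upper[OF _ bdd, of "x s"] that by (auto simp: S_def)
  show *: "left_limit x t \<le> v" if "0 < t" "\<And>s. 0 \<le> s \<Longrightarrow> s < t \<Longrightarrow> x s \<le> v" for v
    unfolding lim[OF that(1)] S_def using that by (intro cSup_least) auto
  show "left_limit x t \<le> x t"
    using *[of "x t"] mono t by (cases "t = 0") (auto simp: left_limit_def)
qed

lemma completed_graph_iff:
  "(z, t) \<in> completed_graph T x \<longleftrightarrow> 0 \<le> t \<and> t \<le> T \<and> left_limit x t \<le> z \<and> z \<le> x t"
  using left_limit_le[of t] by (auto simp: completed_graph_def)

lemma graph_chain:
  assumes "(z, t) \<in> completed_graph T x" "(z', t') \<in> completed_graph T x" "t < t'"
  shows "z \<le> z'"
  using assms left_limit_ge[of t' t] by (auto simp: completed_graph_iff)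

text \<open>The generalised inverse of the strictly increasing map t \<mapsto> x t + t. It stays
  constant while w runs through the vertical segment above a jump.\<close>

definition graph_time :: "real \<Rightarrow> real" where
  "graph_time w = Sup {t. 0 \<le> t \<and> t \<le> T \<and> x t + t \<le> w}"

definition graph_point :: "real \<Rightarrow> real \<times> real" where
  "graph_point w = (w - graph_time w, graph_time w)"

text \<open>Times before the supremum satisfy x s + s \<le> w by monotonicity, and later times
  violate it. Limits from the left and from the right turn this into the two bounds for w - t; the
  range of w settles the end cases t = 0 and t = T.\<close>

lemma graph_point_in_graph:
  assumes w: "x 0 \<le> w" "w \<le> x T + T"
  shows "graph_point w \<in> completed_graph T x"
proof -
  let ?A = "{t. 0 \<le> t \<and> t \<le> T \<and> x t + t \<le> w}"
  have bdd: "bdd_above ?A" by (auto intro: bdd_aboveI)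
  have A0: "0 \<in> ?A" using w T by auto
  define t where "t = graph_time w"
  have "0 \<le> t"
    using cSup_upper[OF A0 bdd] by (simp add: t_def graph_time_def)
  moreover have "t \<le> T"
    unfolding t_def graph_time_def by (rule cSup_least) (use A0 in blast)+
  ultimately have t: "0 \<le> t" "t \<le> T" .
  have below: "x s + s \<le> w" if s: "0 \<le> s" "s < t" for s
  proof -
    have "?A \<noteq> {}" using A0 by blast
    then obtain u where u: "u \<in> ?A" "s < u"
      using s less_cSup_iff[OF _ bdd, of s] unfolding t_def graph_time_def by blast
    then have "x s \<le> x u" using mono[of s u] s by simp
    then show ?thesis using u by simp
  qed
  have above: "w < x s + s" if s: "t < s" "s \<le> T" for s
    using cSup_upper[of s ?A, OF _ bdd] s t by (force simp: t_def graph_time_def)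
  have "w - t \<le> x t"
  proof (cases "t = T")
    case False
    have "w - t \<le> x t + 0"
    proof (rule tendsto_lowerbound)
      show "((\<lambda>s. x s + (s - t)) \<longlongrightarrow> x t + 0) (at_right t)"
        using False t by (intro tendsto_add right_cont) (auto intro!: tendsto_eq_intros)
      show "\<forall>\<^sub>F s in at_right t. w - t \<le> x s + (s - t)"
        using False t above by (intro eventually_at_rightI[of t T]) force+
    qed auto
    then show ?thesis by simp
  qed (use w in auto)
  moreover have "left_limit x t \<le> w - t"
  proof (cases "t = 0")
    case False
    show ?thesis
    proof (rule left_limit_least)
      fix s assume s: "0 \<le> s" "s < t"
      show "x s \<le> w - t"
      proof (rule tendsto_lowerbound)
        show "((\<lambda>u. w - u) \<longlongrightarrow> w - t) (at_left t)" by (auto intro!: tendsto_intros)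
        have "x s \<le> w - u" if "s < u" "u < t" for u
          using below[of u] mono[of s u] that s t by simp
        then show "\<forall>\<^sub>F u in at_left t. x s \<le> w - u"
          using s by (intro eventually_at_leftI[of s]) auto
      qed auto
    qed (use t False in auto)
  qed (use w in \<open>auto simp: left_limit_def\<close>)
  ultimately show ?thesis
    using t by (simp add: graph_point_def completed_graph_iff flip: t_def)
qed

text \<open>The graph meets an antidiagonal only once: by \<open>graph_chain\<close> a later point
  is not lower, so its coordinate sum is strictly larger.\<close>

lemma graph_point_unique:
  assumes zt: "(z, t) \<in> completed_graph T x"
  shows "graph_point (z + t) = (z, t)" "x 0 \<le> z + t" "z + t \<le> x T + T"
proof -
  have t: "0 \<le> t" "t \<le> T" "left_limit x t \<le> z" "z \<le> x t"
    using zt by (auto simp: completed_graph_iff)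
  have "x 0 \<le> left_limit x t"
    using t left_limit_ge[of t 0] by (cases "t = 0") (auto simp: left_limit_def)
  then show b: "x 0 \<le> z + t" "z + t \<le> x T + T"
    using t mono[of t T] by auto
  have "(z + t - graph_time (z + t), graph_time (z + t)) \<in> completed_graph T x"
    using graph_point_in_graph[OF b] by (simp add: graph_point_def)
  from graph_chain[OF zt this] graph_chain[OF this zt] have "graph_time (z + t) = t"
    by linarith
  then show "graph_point (z + t) = (z, t)"
    by (simp add: graph_point_def)
qed

lemma graph_point_mono:
  assumes w: "x 0 \<le> w" "w \<le> w'" "w' \<le> x T + T"
  shows "graph_time w \<le> graph_time w'" "w - graph_time w \<le> w' - graph_time w'"
proof -
  have *: "(w - graph_time w, graph_time w) \<in> completed_graph T x"
    "(w' - graph_time w', graph_time w') \<in> completed_graph T x"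
    using graph_point_in_graph[OF w(1) order_trans[OF w(2,3)]] graph_point_in_graph[OF order_trans[OF w(1,2)] w(3)]
    by (simp_all add: graph_point_def)
  show "graph_time w \<le> graph_time w'"
    using graph_chain[OF *(2,1)] w by linarith
  then show "w - graph_time w \<le> w' - graph_time w'"
    using graph_chain[OF *] w by linarith
qed

text \<open>Both coordinates are nondecreasing in w and add up to w, so each is 1-Lipschitz, across
  jumps as well.\<close>

lemma continuous_on_graph_point: "continuous_on {x 0..x T + T} graph_point"
proof -
  have le: "\<bar>graph_time w - graph_time w'\<bar> \<le> \<bar>w - w'\<bar>" if "x 0 \<le> w" "w \<le> w'" "w' \<le> x T + T" for w w'
    using graph_point_mono[OF that] that by linarith
  have *: "\<bar>graph_time w - graph_time w'\<bar> \<le> \<bar>w - w'\<bar>" if "w \<in> {x 0..x T + T}" "w' \<in> {x 0..x T + T}" for w w'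
    using le[of w w'] le[of w' w] that by (metis abs_minus_commute atLeastAtMost_iff linear)
  have "1-lipschitz_on {x 0..x T + T} graph_time"
    using * by (auto simp: lipschitz_on_def dist_real_def)
  from lipschitz_on_continuous_on[OF this] show ?thesis
    unfolding graph_point_def by (intro continuous_intros)
qed

text \<open>\<open>h\<close> may be constant on intervals; this lets the path whose graph ends first
  wait at its endpoint.\<close>

lemma parametric_representation_graph_point:
  assumes h: "continuous_on {0..1} h" "h ` {0..1} = {x 0..x T + T}"
    "\<And>r r'. r \<in> {0..1} \<Longrightarrow> r' \<in> {0..1} \<Longrightarrow> r \<le> r' \<Longrightarrow> h r \<le> h r'"
  shows "parametric_representation T x (\<lambda>r. graph_point (h r))"
  unfolding parametric_representation_def
proof (intro conjI ballI impI)
  show "continuous_on {0..1} (\<lambda>r. graph_point (h r))"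
    using h by (intro continuous_on_compose2[OF continuous_on_graph_point]) auto
  have "graph_point ` {x 0..x T + T} = completed_graph T x"
  proof (intro equalityI subsetI)
    fix p assume "p \<in> completed_graph T x"
    then show "p \<in> graph_point ` {x 0..x T + T}"
      using graph_point_unique[of "fst p" "snd p"] by (intro image_eqI[of _ _ "fst p + snd p"]) auto
  qed (use graph_point_in_graph in auto)
  then show "(\<lambda>r. graph_point (h r)) ` {0..1} = completed_graph T x"
    by (simp add: h(2) flip: image_image)
next
  fix r r' :: real assume r: "r \<in> {0..1}" "r' \<in> {0..1}" "r \<le> r'"
  have img: "h r \<in> {x 0..x T + T}" "h r' \<in> {x 0..x T + T}"
    using h(2) r by blast+
  have hr: "x 0 \<le> h r" "h r \<le> h r'" "h r' \<le> x T + T" "x 0 \<le> h r'" "h r \<le> x T + T"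
    using img h(3)[OF r] by auto
  show "graph_le x (graph_point (h r)) (graph_point (h r'))"
    using graph_point_mono[OF hr(1-3)] graph_point_in_graph[OF hr(1,5)] graph_point_in_graph[OF hr(4,3)]
    by (auto simp: graph_le_def graph_point_def completed_graph_iff)
qed

end

text \<open>Parametrising both completed graphs by \<open>w = z + t\<close> turns the time shift by \<open>\<epsilon>\<close> into a bound for
  both coordinates: points of the two graphs on the same antidiagonal are at distance at most \<open>\<epsilon>\<close>.
  Only beyond \<open>w = x T + T\<close>, where the graph of \<open>x\<close> has ended, does \<open>y T - x T\<close> enter.\<close>

lemma dist_M1_le_time_shift:
  assumes x: "monotone_path T x" and y: "monotone_path T y"
    and xy0: "x 0 = y 0"
    and le: "\<And>t. 0 \<le> t \<Longrightarrow> t \<le> T \<Longrightarrow> x t \<le> y t"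
    and shift: "\<And>s t. 0 \<le> s \<Longrightarrow> s + \<epsilon> \<le> t \<Longrightarrow> t \<le> T \<Longrightarrow> y s \<le> x t"
    and eps: "0 \<le> \<epsilon>"
  shows "dist_M1 T x y \<le> max \<epsilon> (y T - x T)"
proof -
  interpret x: monotone_path T x by fact
  interpret y: monotone_path T y by fact
  define W where "W = x T + T"
  define a where "a = x 0"
  define h where "h r = a + r * (y T + T - a)" for r
  define g where "g r = x.graph_point (min W (h r))" for r
  define g' where "g' r = y.graph_point (h r)" for r
  note T = x.T
  have aW: "a \<le> W" using x.mono[of 0 T] T by (simp add: a_def W_def)
  have Wy: "W \<le> y T + T" using le[of T] T by (simp add: W_def)
  have hr: "h r \<in> {a..y T + T}" if "r \<in> {0..1}" for r
  proof -
    have "r * (y T + T - a) \<le> y T + T - a" "0 \<le> r * (y T + T - a)"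
      using that aW Wy by (auto intro!: mult_left_le_one_le)
    then show ?thesis by (simp add: h_def)
  qed
  have himg: "h ` {0..1} = {a..y T + T}"
  proof (intro equalityI subsetI)
    fix w assume w: "w \<in> {a..y T + T}"
    show "w \<in> h ` {0..1}"
    proof (cases "y T + T = a")
      case True
      then show ?thesis using w by (auto simp: h_def intro!: image_eqI[of _ _ 0])
    next
      case False
      then show ?thesis using w 
        by (intro image_eqI[of _ _ "(w - a) / (y T + T - a)"]) (auto simp: h_def field_simps)
    qed
  qed (use hr in auto)
  have hmono: "h r \<le> h r'" if "r \<le> r'" for r r'
    using that aW Wy by (auto simp: h_def intro!: mult_right_mono)
  have hcont: "continuous_on {0..1} h" unfolding h_def by (intro continuous_intros)
  have pr_x: "parametric_representation T x g"
    unfolding g_def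
  proof (rule x.parametric_representation_graph_point)
    show "continuous_on {0..1} (\<lambda>r. min W (h r))" using hcont by (intro continuous_intros)
    have "(\<lambda>r. min W (h r)) ` {0..1} = min W ` {a..y T + T}"
      by (simp flip: himg add: image_image)
    also have "\<dots> = {a..W}"
    proof (intro equalityI subsetI)
      fix w assume "w \<in> {a..W}"
      then show "w \<in> min W ` {a..y T + T}" using Wy by (intro image_eqI[of _ _ w]) auto
    qed (use aW in auto)
    also have "\<dots> = {x 0..x T + T}" by (simp add: W_def a_def)
    finally show "(\<lambda>r. min W (h r)) ` {0..1} = {x 0..x T + T}" .
  qed (use hmono in \<open>auto simp: min_def intro: order_trans\<close>)
  have pr_y: "parametric_representation T y g'"
    unfolding g'_def
    by (rule y.parametric_representation_graph_point) (use hcont himg hmono in \<open>auto simp: a_def xy0\<close>)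
  have close: "\<bar>x.graph_time w - y.graph_time w\<bar> \<le> \<epsilon>" if w: "a \<le> w" "w \<le> W" for w
  proof -
    define t where "t = x.graph_time w"
    define t' where "t' = y.graph_time w"
    have gx: "(w - t, t) \<in> completed_graph T x" 
      using x.graph_point_in_graph[of w] w by (simp add: t_def x.graph_point_def a_def W_def)
    have gy: "(w - t', t') \<in> completed_graph T y"
      using y.graph_point_in_graph[of w] w Wy by (simp add: t'_def y.graph_point_def a_def xy0)
    \<comment> \<open>The higher path meets every antidiagonal no later than the lower one.\<close>
    have "t' \<le> t"
    proof (rule ccontr)
      assume "\<not> t' \<le> t"
      then have "y t \<le> w - t'" 
        using gx gy y.left_limit_ge[of t' t] 
        by (auto simp: x.completed_graph_iff y.completed_graph_iff)
      then show False
        using \<open>\<not> t' \<le> t\<close> gx le[of t] by (auto simp: x.completed_graph_iff)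
    qed
    \<comment> \<open>By \<open>shift\<close>, x has caught up with y t' at time t' + \<epsilon>, so
      it meets the antidiagonal at most \<epsilon> later.\<close>
    moreover have "t \<le> t' + \<epsilon>"
    proof (rule ccontr)
      assume *: "\<not> t \<le> t' + \<epsilon>"
      have "x (t' + \<epsilon>) \<le> w - t" 
        using * gx gy eps x.left_limit_ge[of t "t' + \<epsilon>"] 
        by (auto simp: x.completed_graph_iff y.completed_graph_iff)
      moreover have "y t' \<le> x (t' + \<epsilon>)"
        using * gx gy by (intro shift) (auto simp: x.completed_graph_iff y.completed_graph_iff)
      ultimately show False
        using gy * eps by (auto simp: y.completed_graph_iff)
    qed
    ultimately show ?thesis by (simp add: t_def t'_def)
  qed
  have bound: "max \<bar>fst (g r) - fst (g' r)\<bar> \<bar>snd (g r) - snd (g' r)\<bar> \<le> max \<epsilon> (y T - x T)"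
    if r: "r \<in> {0..1}" for r
  proof (cases "h r \<le> W")
    case True
    then show ?thesis using close[of "h r"] hr[OF r]
      by (auto simp: g_def g'_def x.graph_point_def y.graph_point_def min_def abs_minus_commute)
  next
    \<comment> \<open>Beyond W the point of x is (x T, T). The point of y has passed time T -
      \<epsilon> already at W, and its value lies between x T and y T.\<close>
    case False
    define t' where "t' = y.graph_time (h r)"
    have tx: "x.graph_time W = T"
      using x.graph_point_unique(1)[of "x T" T] x.completed_graph_iff[of "x T" T] T
        x.left_limit_le[of T]
      by (auto simp: W_def x.graph_point_def)
    have gy: "(h r - t', t') \<in> completed_graph T y"
      using y.graph_point_in_graph[of "h r"] hr[OF r] by (simp add: t'_def y.graph_point_def a_def xy0)
    have "T - \<epsilon> \<le> y.graph_time W"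
      using close[of W] aW tx by auto
    moreover have "y.graph_time W \<le> t'" "W - y.graph_time W \<le> h r - t'"
      using y.graph_point_mono[of W "h r"] aW False hr[OF r] by (auto simp: t'_def a_def xy0)
    moreover have "y.graph_time W \<le> T"
      using y.graph_point_in_graph[of W] aW Wy by (auto simp: y.graph_point_def y.completed_graph_iff a_def xy0)
    moreover have "t' \<le> T" "h r - t' \<le> y T"
      using gy y.mono[of t' T] by (auto simp: y.completed_graph_iff)
    moreover have "g r = (x T, T)" "g' r = (h r - t', t')"
      using False tx by (auto simp: g_def g'_def x.graph_point_def y.graph_point_def t'_def W_def)
    ultimately show ?thesis using False by (auto simp: W_def abs_le_iff)
  qed
  have ub: "(SUP r\<in>{0..1}. max \<bar>fst (g r) - fst (g' r)\<bar> \<bar>snd (g r) - snd (g' r)\<bar>) \<le> max \<epsilon> (y T - x T)"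
    by (intro cSUP_least bound) auto
  \<comment> \<open>\<open>Inf\<close> bounds from below only if the set is bounded below;
    compactness of {0..1} makes every \<open>SUP\<close> a genuine supremum, hence
    nonnegative.\<close>
  have bdd: "bdd_below {SUP r\<in>{0..1}. max \<bar>fst (g r) - fst (h r)\<bar> \<bar>snd (g r) - snd (h r)\<bar> | g h.
     parametric_representation T x g \<and> parametric_representation T y h}"
  proof (rule bdd_belowI[of _ 0], safe)
    fix g h assume gh: "parametric_representation T x g" "parametric_representation T y h"
    have "compact ((\<lambda>r. max \<bar>fst (g r) - fst (h r)\<bar> \<bar>snd (g r) - snd (h r)\<bar>) ` {0..1})"
      using gh unfolding parametric_representation_def
      by (intro compact_continuous_image continuous_intros) auto
    then have "bdd_above ((\<lambda>r. max \<bar>fst (g r) - fst (h r)\<bar> \<bar>snd (g r) - snd (h r)\<bar>) ` {0..1})"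
      by (intro bounded_imp_bdd_above compact_imp_bounded)
    then have "max \<bar>fst (g 0) - fst (h 0)\<bar> \<bar>snd (g 0) - snd (h 0)\<bar>
        \<le> (SUP r\<in>{0..1}. max \<bar>fst (g r) - fst (h r)\<bar> \<bar>snd (g r) - snd (h r)\<bar>)"
      by (intro cSUP_upper) auto
    then show "0 \<le> (SUP r\<in>{0..1}. max \<bar>fst (g r) - fst (h r)\<bar> \<bar>snd (g r) - snd (h r)\<bar>)"
      by linarith
  qed
  have "dist_M1 T x y \<le> (SUP r\<in>{0..1}. max \<bar>fst (g r) - fst (g' r)\<bar> \<bar>snd (g r) - snd (g' r)\<bar>)"
    unfolding dist_M1_def using pr_x pr_y
    by (intro cInf_lower bdd) blast
  with ub show ?thesis by linarith
qed

section \<open>Paths that count finitely many points\<close>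

lemma monotone_path_count:
  fixes \<tau> :: "'u \<Rightarrow> real"
  assumes V: "finite V" and n: "0 < n" and T: "0 \<le> T"
    and x: "\<And>t. 0 \<le> t \<Longrightarrow> t \<le> T \<Longrightarrow> x t = real (card {u\<in>V. \<tau> u \<le> n * t}) / n"
  shows "monotone_path T x"
proof
  show "0 \<le> T" by fact
  fix s t :: real assume st: "0 \<le> s" "s \<le> t" "t \<le> T"
  have "card {u\<in>V. \<tau> u \<le> n * s} \<le> card {u\<in>V. \<tau> u \<le> n * t}"
    using V n st by (intro card_mono) (auto intro: order_trans[OF _ mult_left_mono[of s t n]])
  then show "x s \<le> x t" using st n by (simp add: x divide_right_mono)
next
  fix t assume t: "0 \<le> t" "t < T"
  have "\<forall>\<^sub>F s in at_right t. \<forall>u\<in>V. n * t < \<tau> u \<longrightarrow> n * s < \<tau> u"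
  proof (rule eventually_ball_finite[OF V], intro ballI)
    fix u
    have "\<forall>\<^sub>F s in at_right t. n * s < \<tau> u" if "n * t < \<tau> u"
      by (rule order_tendstoD(2)[OF _ that]) (auto intro!: tendsto_intros)
    then show "\<forall>\<^sub>F s in at_right t. n * t < \<tau> u \<longrightarrow> n * s < \<tau> u"
      by (cases "n * t < \<tau> u") auto
  qed
  moreover have "\<forall>\<^sub>F s in at_right t. t < s \<and> s < T"
    using t by (intro eventually_at_rightI[of t T]) auto
  ultimately have "\<forall>\<^sub>F s in at_right t. x s = x t"
  proof eventually_elim
    case (elim s)
    then have "n * t \<le> n * s" using n by simp
    with elim have "{u\<in>V. \<tau> u \<le> n * s} = {u\<in>V. \<tau> u \<le> n * t}"
      by (force simp: not_less)
    then show ?case using elim t by (simp add: x)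
  qed
  then show "(x \<longlongrightarrow> x t) (at_right t)"
    by (rule tendsto_eventually)
qed

text \<open>In the application \<tau> is the birth time of an individual and \<sigma> the arrival
  time of the immigrant of its cluster. A point counted by y but not yet by x at time T has \<tau> >
  n T, hence \<sigma> > n (T - \<epsilon>); this is where the window on the right comes
  from.\<close>

lemma dist_M1_count_le:
  fixes \<sigma> \<tau> :: "'u \<Rightarrow> real"
  assumes V: "finite V" and n: "0 < n" and T: "0 \<le> T" and eps: "0 \<le> \<epsilon>"
    and x: "\<And>t. 0 \<le> t \<Longrightarrow> t \<le> T \<Longrightarrow> x t = real (card {u\<in>V. \<tau> u \<le> n * t}) / n"
    and y: "\<And>t. 0 \<le> t \<Longrightarrow> t \<le> T \<Longrightarrow> y t = real (card {u\<in>V. \<sigma> u \<le> n * t}) / n"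
    and st: "\<And>u. u \<in> V \<Longrightarrow> 0 < \<sigma> u \<and> \<sigma> u \<le> \<tau> u \<and> \<tau> u \<le> \<sigma> u + n * \<epsilon>"
  shows "dist_M1 T x y \<le> max \<epsilon> (real (card {u\<in>V. n * (T - \<epsilon>) < \<sigma> u \<and> \<sigma> u \<le> n * T}) / n)"
proof -
  have "dist_M1 T x y \<le> max \<epsilon> (y T - x T)"
  proof (rule dist_M1_le_time_shift)
    show "monotone_path T x" by (rule monotone_path_count[OF V n T x])
    show "monotone_path T y" by (rule monotone_path_count[OF V n T y])
    have "{u\<in>V. \<tau> u \<le> n * 0} = {}" "{u\<in>V. \<sigma> u \<le> n * 0} = {}"
      using st by fastforce+
    then show "x 0 = y 0" by (simp only: x[OF order_refl T] y[OF order_refl T])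
    show "x t \<le> y t" if t: "0 \<le> t" "t \<le> T" for t
    proof -
      have "card {u\<in>V. \<tau> u \<le> n * t} \<le> card {u\<in>V. \<sigma> u \<le> n * t}"
        using V st by (intro card_mono) (auto intro: order_trans)
      then show ?thesis using t n by (simp add: x y divide_right_mono)
    qed
    show "y s \<le> x t" if t: "0 \<le> s" "s + \<epsilon> \<le> t" "t \<le> T" for s t
    proof -
      have "n * s + n * \<epsilon> \<le> n * t" using mult_left_mono[OF t(2), of n] n by (simp add: distrib_left)
      then have "card {u\<in>V. \<sigma> u \<le> n * s} \<le> card {u\<in>V. \<tau> u \<le> n * t}"
        using V st by (intro card_mono) force+
      then show ?thesis using t n eps by (simp add: x y divide_right_mono)
    qed
  qed fact
  moreover have "y T - x T \<le> real (card {u\<in>V. n * (T - \<epsilon>) < \<sigma> u \<and> \<sigma> u \<le> n * T}) / n"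
  proof -
    have *: "{u\<in>V. \<sigma> u \<le> n * T} \<subseteq> {u\<in>V. \<tau> u \<le> n * T} \<union> {u\<in>V. n * (T - \<epsilon>) < \<sigma> u \<and> \<sigma> u \<le> n * T}"
      using st by (fastforce simp: algebra_simps)
    have "card {u\<in>V. \<sigma> u \<le> n * T} 
        \<le> card ({u\<in>V. \<tau> u \<le> n * T} \<union> {u\<in>V. n * (T - \<epsilon>) < \<sigma> u \<and> \<sigma> u \<le> n * T})"
      by (rule card_mono[OF _ *]) (use V in auto)
    also have "\<dots> \<le> card {u\<in>V. \<tau> u \<le> n * T} + card {u\<in>V. n * (T - \<epsilon>) < \<sigma> u \<and> \<sigma> u \<le> n * T}"
      by (rule card_Un_le)
    finally have "real (card {u\<in>V. \<sigma> u \<le> n * T}) - real (card {u\<in>V. \<tau> u \<le> n * T})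
        \<le> real (card {u\<in>V. n * (T - \<epsilon>) < \<sigma> u \<and> \<sigma> u \<le> n * T})" by linarith
    from divide_right_mono[OF this, of n] show ?thesis
      using n by (simp only: x[OF T order_refl] y[OF T order_refl] diff_divide_distrib)
  qed
  ultimately show ?thesis by linarith
qed

section \<open>Integration over the horizon\<close>

lemma nn_integral_exp_minus: "(\<integral>\<^sup>+t. ennreal (exp (- t)) * indicator {a..} t \<partial>lborel) = ennreal (exp (- a))"
proof -
  have "((\<lambda>t. - exp (- t)) \<longlongrightarrow> - 0) (at_top :: real filter)"
    by (intro tendsto_minus) (rule filterlim_compose[OF exp_at_bot filterlim_uminus_at_bot_at_top])
  then have "(\<integral>\<^sup>+t. ennreal (exp (- t)) * indicator {a..} t \<partial>lborel) = ennreal (0 - (- exp (- a)))"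
    by (intro nn_integral_FTC_atLeast) (auto intro!: derivative_eq_intros)
  then show ?thesis by simp
qed

text \<open>Horizons in B contribute at most their measure, and those beyond K contribute exp (- K)
  in total. The integrand is dominated pointwise by measurable functions, so its own measurability
  is never at issue.\<close>

lemma dist_P_infinity_le:
  fixes \<xi> \<zeta> :: "real \<Rightarrow> real^'d"
  assumes B: "B \<in> sets lborel" "emeasure lborel B \<le> ennreal b" "0 \<le> b"
    and m: "0 \<le> m"
    and le: "\<And>t j. 0 \<le> t \<Longrightarrow> t \<le> K \<Longrightarrow> t \<notin> B \<Longrightarrow>
      dist_M1 t (\<lambda>s. vec_nth (\<xi> s) j) (\<lambda>s. vec_nth (\<zeta> s) j) \<le> m"
  shows "dist_P_infinity \<xi> \<zeta> \<le> m + b + exp (- K)"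
proof -
  have "(\<integral>\<^sup>+t\<in>{0..}. ennreal (exp (- t) * min (dist_P t \<xi> \<zeta>) 1) \<partial>lborel)
    \<le> (\<integral>\<^sup>+t. ennreal m * (ennreal (exp (- t)) * indicator {0..} t) + indicator B t 
          + ennreal (exp (- t)) * indicator {K..} t \<partial>lborel)"
  proof (rule nn_integral_mono)
    fix t :: real
    have one: "ennreal (exp (- t) * min (dist_P t \<xi> \<zeta>) 1) \<le> ennreal (exp (- t))"
      by (intro ennreal_leI) (simp add: mult_le_cancel_left1)
    consider "t < 0" | "K \<le> t" | "t \<in> B" "0 \<le> t" | "0 \<le> t" "t < K" "t \<notin> B" by linarith
    then show "ennreal (exp (- t) * min (dist_P t \<xi> \<zeta>) 1) * indicator {0..} t
      \<le> ennreal m * (ennreal (exp (- t)) * indicator {0..} t) + indicator B t 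
          + ennreal (exp (- t)) * indicator {K..} t"
    proof cases
      case 2
      then show ?thesis using one by (auto simp: indicator_def intro: add_increasing)
    next
      case 3
      have "ennreal (exp (- t)) \<le> 1" using 3 by (simp add: ennreal_le_1)
      with one have "ennreal (exp (- t) * min (dist_P t \<xi> \<zeta>) 1) \<le> 1" by (rule order_trans)
      then show ?thesis using 3 by (auto simp: indicator_def intro: add_increasing add_increasing2)
    next
      case 4
      have "dist_P t \<xi> \<zeta> \<le> m"
        unfolding dist_P_def using le 4 by (subst Max_le_iff) auto
      then have "ennreal (exp (- t) * min (dist_P t \<xi> \<zeta>) 1) \<le> ennreal (m * exp (- t))"
        by (intro ennreal_leI) (simp add: mult.commute)
      also have "\<dots> = ennreal m * ennreal (exp (- t))"
        using m by (simp add: ennreal_mult)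
      finally show ?thesis using 4 by (simp add: add_increasing2)
    qed simp
  qed
  also have "\<dots> = ennreal m * ennreal (exp (- 0)) + emeasure lborel B + ennreal (exp (- K))"
    using B by (simp add: nn_integral_add nn_integral_cmult nn_integral_exp_minus del: exp_zero minus_zero)
  also have "\<dots> \<le> ennreal m * ennreal (exp (- 0)) + ennreal b + ennreal (exp (- K))"
    by (intro add_mono order_refl B)
  also have "\<dots> = ennreal (m + b + exp (- K))"
    using m B by (simp flip: ennreal_plus)
  finally show ?thesis
    unfolding dist_P_infinity_def using m B by (intro enn2real_leI) auto
qed

section \<open>Sample paths on the good event\<close>

text \<open>The first \<open>Q * b j\<close> immigrants of type j form Q consecutive blocks. The
  lower bound on block durations lets a window of length \<epsilon> * n meet at most two blocks, the
  upper bound confines the damage of a large block to a short interval of horizons, and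
  \<open>K \<le> Q * \<epsilon>\<close> makes the blocks outlast the horizon K.\<close>

locale good_sample =
  fixes gap :: "'d::finite \<Rightarrow> nat \<Rightarrow> 'a \<Rightarrow> real"
    and nchild :: "'d label \<Rightarrow> 'd \<Rightarrow> 'a \<Rightarrow> nat"
    and delay :: "'d label \<Rightarrow> 'd \<Rightarrow> nat \<Rightarrow> 'a \<Rightarrow> real"
    and \<omega> :: 'a and n :: nat and \<epsilon> \<eta> K :: real and Q r :: nat and b :: "'d \<Rightarrow> nat"
  assumes n: "0 < n" and eps: "0 < \<epsilon>" and eta: "0 \<le> \<eta>"
    and gap_pos: "0 < gap j k \<omega>"
    and delay_nonneg: "0 \<le> delay u i m \<omega>"
    and finite_cluster: "finite {p. is_born nchild \<omega> (j, k, p)}"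
    and block_lower: "q < Q \<Longrightarrow> \<epsilon> * n \<le> (\<Sum>k=q * b j..<q * b j + b j. gap j k \<omega>)"
    and block_upper: "q < Q \<Longrightarrow> (\<Sum>k=q * b j..<q * b j + b j. gap j k \<omega>) \<le> 17 * \<epsilon> * n"
    and Q: "K \<le> Q * \<epsilon>"
    and not_late: "k < Q * b j \<Longrightarrow> is_born nchild \<omega> (j, k, p) \<Longrightarrow>
      birth_time gap delay \<omega> (j, k, p) \<le> arrival_time gap j k \<omega> + \<epsilon> * n"
    and few_large: "card {q. q < Q \<and> \<eta> * n <
      (\<Sum>k=q * b j..<q * b j + b j. real (card {p. is_born nchild \<omega> (j, k, p)}))} \<le> r"
begin

abbreviation "arr j k \<equiv> arrival_time gap j k \<omega>"
abbreviation "csize j k \<equiv> real (card {p. is_born nchild \<omega> (j, k, p)})"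
abbreviation "block j q \<equiv> {q * b j..<q * b j + b j}"

lemma arr_diff: "k \<le> k' \<Longrightarrow> arr j k' = arr j k + (\<Sum>l\<in>{k<..k'}. gap j l \<omega>)"
proof -
  assume "k \<le> k'"
  then have "{..k'} = {..k} \<union> {k<..k'}" by auto
  then show ?thesis by (simp add: arrival_time_def sum.union_disjoint ivl_disj_int)
qed

lemma arr_mono: "k \<le> k' \<Longrightarrow> arr j k \<le> arr j k'"
  using arr_diff[of k k' j] sum_nonneg[of "{k<..k'}" "\<lambda>l. gap j l \<omega>"] gap_pos by (simp add: less_imp_le)

lemma arr_pos: "0 < arr j k"
  unfolding arrival_time_def using gap_pos by (intro sum_pos) auto

lemma arr_le_birth: "arr j k \<le> birth_time gap delay \<omega> (j, k, p)"
proof (induction p)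
  case (Cons a p)
  then show ?case using delay_nonneg[of "(j, k, p)" "fst a" "snd a"] by (cases a) auto
qed auto

lemma arr_gt: "Q * b j \<le> k \<Longrightarrow> K * n < arr j k"
proof -
  assume k: "Q * b j \<le> k"
  have "K * n \<le> Q * \<epsilon> * n" using Q n by simp
  also have "\<dots> = (\<Sum>q<Q. \<epsilon> * n)" by simp
  also have "\<dots> \<le> (\<Sum>q<Q. \<Sum>k\<in>block j q. gap j k \<omega>)"
    by (intro sum_mono block_lower) auto
  also have "\<dots> = (\<Sum>k<Q * b j. gap j k \<omega>)"
    by (rule sum.nat_group)
  also have "\<dots> < (\<Sum>k\<le>k. gap j k \<omega>)"
    using k gap_pos by (intro sum_strict_mono2[of _ _ k]) (auto intro: less_imp_le)
  finally show ?thesis by (simp add: arrival_time_def)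
qed

text \<open>Members of a block arrive at most 17 \<epsilon> n after its first one, and the window
  reaches \<epsilon> n further; hence the 18 in \<open>good\<close>, which keeps large blocks out of
  the window. At most two blocks meet the window, and both are small.\<close>

lemma window_sum:
  fixes t :: real
  assumes t: "t \<le> K"
    and good: "\<And>q. q < Q \<Longrightarrow> \<eta> * n < (\<Sum>k\<in>block j q. csize j k) \<Longrightarrow>
      n * t < arr j (q * b j) \<or> arr j (q * b j) + 18 * \<epsilon> * n \<le> n * t"
  shows "(\<Sum>k\<in>{k. n * (t - \<epsilon>) < arr j k \<and> arr j k \<le> n * t}. csize j k) \<le> 2 * \<eta> * n"
proof -
  define W where "W = {k. n * (t - \<epsilon>) < arr j k \<and> arr j k \<le> n * t}"
  have WQ: "k < Q * b j" if "k \<in> W" for k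
  proof (rule ccontr)
    assume "\<not> k < Q * b j"
    then have "K * n < n * t" using arr_gt[of j k] that by (auto simp: W_def)
    then show False using t n by (simp add: mult.commute)
  qed
  then have finW: "finite W" by (intro finite_subset[of W "{..<Q * b j}"]) auto
  show ?thesis
  proof (cases "W = {}")
    case True
    then show ?thesis using eta unfolding W_def[symmetric] by simp
  next
    case False
    define D where "D = (\<lambda>k. k div b j) ` W"
    have D: "finite D" "D \<noteq> {}" using finW False by (auto simp: D_def)
    define q1 where "q1 = Min D"
    have block_div: "k \<in> block j (k div b j)" if "k \<in> W" for k
    proof -
      \<comment> \<open>Makes the division by \<open>b j\<close> genuine: for \<open>b j = 0\<close>
        no index lies below \<open>Q * b j\<close>.\<close>
      have "0 < b j" using WQ[OF that] by (cases "b j") auto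
      then show ?thesis using dividend_less_div_times[of "b j" k] by (simp add: add.commute)
    qed
    obtain k1 where k1: "k1 \<in> W" "q1 = k1 div b j"
      using Min_in[OF D] by (auto simp: q1_def D_def)
    have D_sub: "D \<subseteq> {q1, q1 + 1}"
    proof
      fix q assume q: "q \<in> D"
      then obtain k where k: "k \<in> W" "q = k div b j" by (auto simp: D_def)
      have "q1 \<le> q" using Min_le[OF D(1) q] by (simp add: q1_def)
      moreover have "\<not> q1 + 2 \<le> q"
      proof
        \<comment> \<open>The whole block q1 + 1 would lie between two members of the window; it
          lasts at least \<epsilon> * n, but two members are less than \<epsilon> * n apart.\<close>
        assume q2: "q1 + 2 \<le> q"
        have "q < Q" using WQ[OF k(1)] k(2) by (simp add: less_mult_imp_div_less)
        have k1u: "k1 < (q1 + 1) * b j" using block_div[OF k1(1)] k1(2) by simp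
        have "(q1 + 2) * b j \<le> q * b j" using q2 by (rule mult_right_mono) simp
        also have "q * b j \<le> k" using k(2) by (simp add: div_times_less_eq_dividend)
        finally have kl: "(q1 + 2) * b j \<le> k" .
        have sub: "block j (q1 + 1) \<subseteq> {k1<..k}" using k1u kl by (auto simp: algebra_simps)
        have "\<epsilon> * n \<le> (\<Sum>l\<in>block j (q1 + 1). gap j l \<omega>)"
          using q2 \<open>q < Q\<close> by (intro block_lower) simp
        also have "\<dots> \<le> (\<Sum>l\<in>{k1<..k}. gap j l \<omega>)"
          using sub gap_pos by (intro sum_mono2) (auto intro: less_imp_le)
        also have "\<dots> = arr j k - arr j k1"
          using arr_diff[of k1 k j] k1u kl by (simp add: algebra_simps)
        also have "\<dots> < n * t - n * (t - \<epsilon>)"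
          using k(1) k1(1) by (auto simp: W_def)
        finally show False by (simp add: algebra_simps)
      qed
      ultimately show "q \<in> {q1, q1 + 1}" by auto
    qed
    have light: "(\<Sum>k\<in>block j q. csize j k) \<le> \<eta> * n" if "q \<in> D" for q
    proof (rule ccontr)
      assume large: "\<not> ?thesis"
      from that obtain k where k: "k \<in> W" "q = k div b j" by (auto simp: D_def)
      have qQ: "q < Q" using WQ[OF k(1)] k(2) by (simp add: less_mult_imp_div_less)
      have kb: "k \<in> block j q" using block_div[OF k(1)] k(2) by simp
      have "arr j (q * b j) \<le> arr j k" using kb by (intro arr_mono) auto
      moreover have "arr j k \<le> arr j (q * b j) + 17 * \<epsilon> * n"
      proof -
        have "arr j k = arr j (q * b j) + (\<Sum>l\<in>{q * b j<..k}. gap j l \<omega>)"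
          using kb by (intro arr_diff) auto
        also have "(\<Sum>l\<in>{q * b j<..k}. gap j l \<omega>) \<le> (\<Sum>l\<in>block j q. gap j l \<omega>)"
          using kb gap_pos by (intro sum_mono2) (auto intro: less_imp_le)
        finally show ?thesis using block_upper[OF qQ, of j] by linarith
      qed
      moreover have "n * t < arr j k + n * \<epsilon>" "arr j k \<le> n * t"
        using k(1) by (auto simp: W_def algebra_simps)
      ultimately show False
        using good[OF qQ] large by (auto simp: algebra_simps)
    qed
    have "(\<Sum>k\<in>W. csize j k) = (\<Sum>q\<in>D. \<Sum>k\<in>{k\<in>W. k div b j = q}. csize j k)"
      unfolding D_def by (rule sum.image_gen[OF finW])
    also have "\<dots> \<le> (\<Sum>q\<in>D. \<Sum>k\<in>block j q. csize j k)"
      using block_div by (intro sum_mono sum_mono2) auto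
    also have "\<dots> \<le> (\<Sum>q\<in>D. \<eta> * n)" by (intro sum_mono light)
    also have "\<dots> = card D * (\<eta> * n)" by simp
    also have "\<dots> \<le> 2 * (\<eta> * n)"
      using card_mono[OF _ D_sub] eta by (intro mult_right_mono) auto
    finally show ?thesis by (simp add: W_def mult.assoc)
  qed
qed

text \<open>A finite set that contains everyone counted by either process up to time K n, so that
  both become counts over the same set.\<close>

definition "individuals = (SIGMA j:UNIV. SIGMA k:{..<Q * b j}. {p. is_born nchild \<omega> (j, k, p)})"

lemma finite_individuals: "finite individuals"
  unfolding individuals_def using finite_cluster by (intro finite_SigmaI) auto

lemma index_less: 
  fixes t :: real
  assumes "arr j k \<le> n * t" "t \<le> K"
  shows "k < Q * b j"
proof (rule ccontr)
  assume "\<not> k < Q * b j"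
  then have "K * n < n * t" using arr_gt[of j k] assms by auto
  then show False using assms n by (simp add: mult.commute)
qed

lemma hawkes_count:
  fixes t :: real
  assumes t: "t \<le> K"
  shows "vec_nth (rescaled n (hawkes gap nchild delay \<omega>) t) i =
    real (card {u\<in>{u\<in>individuals. label_type u = i}. birth_time gap delay \<omega> u \<le> n * t}) / n"
proof -
  have "{u. is_born nchild \<omega> u \<and> label_type u = i \<and> birth_time gap delay \<omega> u \<le> n * t}
    = {u\<in>{u\<in>individuals. label_type u = i}. birth_time gap delay \<omega> u \<le> n * t}"
    using index_less[OF order_trans[OF arr_le_birth] t] by (auto simp: individuals_def)
  then show ?thesis by (simp add: rescaled_def hawkes_def)
qed

lemma coupled_count:
  fixes t :: real
  assumes t: "t \<le> K"
  shows "vec_nth (rescaled n (coupled_process gap nchild \<omega>) t) i =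
    real (card {u\<in>{u\<in>individuals. label_type u = i}. arr (fst u) (fst (snd u)) \<le> n * t}) / n"
proof -
  have *: "{u\<in>{u\<in>individuals. label_type u = i}. arr (fst u) (fst (snd u)) \<le> n * t}
    = (SIGMA j:UNIV. SIGMA k:{k. arr j k \<le> n * t}. {p. is_born nchild \<omega> (j, k, p) \<and> label_type (j, k, p) = i})"
    using index_less[OF _ t] by (auto simp: individuals_def)
  have fin: "finite {k. arr j k \<le> n * t}" for j
  proof (rule finite_subset)
    show "{k. arr j k \<le> n * t} \<subseteq> {..<Q * b j}"
      using index_less[OF _ t] by auto
  qed auto
  have fin': "finite {p. is_born nchild \<omega> (j, k, p) \<and> label_type (j, k, p) = i}" for j k
    by (rule finite_subset[OF _ finite_cluster[of j k]]) auto
  show ?thesis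
    unfolding * using fin fin'
    by (simp add: rescaled_def coupled_process_def cluster_size_def card_SigmaI)
qed

text \<open>The exceptional horizons consist, for each type, of at most r intervals of length 18 *
  \<epsilon>, one after the start of each large block. At the other horizons the individuals counted
  in one coordinate may stem from immigrants of any type, so 2 * \<eta> is paid once per
  type.\<close>

lemma dist_le:
  "dist_P_infinity (rescaled n (hawkes gap nchild delay \<omega>)) (rescaled n (coupled_process gap nchild \<omega>))
    \<le> max \<epsilon> (real CARD('d) * (2 * \<eta>)) + CARD('d) * r * 18 * \<epsilon> + exp (- K)"
proof -
  define L where "L j = {q. q < Q \<and> \<eta> * n < (\<Sum>k\<in>block j q. csize j k)}" for j
  have L: "finite (L j)" "card (L j) \<le> r" for j
    using few_large[of j] by (auto simp: L_def)
  define I where "I j q = {arr j (q * b j) / n .. arr j (q * b j) / n + 18 * \<epsilon>}" for j q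
  define B where "B = (\<Union>j. \<Union>q\<in>L j. I j q)"
  have I: "I j q \<in> sets lborel" "emeasure lborel (I j q) = ennreal (18 * \<epsilon>)" for j q
    using eps by (auto simp: I_def)
  have "emeasure lborel B \<le> (\<Sum>j\<in>UNIV. \<Sum>q\<in>L j. emeasure lborel (I j q))"
    unfolding B_def
    using I L by (intro order_trans[OF emeasure_subadditive_finite] sum_mono emeasure_subadditive_finite) auto
  also have "\<dots> = (\<Sum>j\<in>UNIV. ennreal (real (card (L j)) * (18 * \<epsilon>)))"
    using I eps by (simp add: ennreal_mult ennreal_of_nat_eq_real_of_nat)
  also have "\<dots> \<le> (\<Sum>j\<in>(UNIV::'d set). ennreal (real r * (18 * \<epsilon>)))"
    using L eps by (intro sum_mono ennreal_leI mult_right_mono) auto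
  also have "\<dots> = ennreal (CARD('d) * r * 18 * \<epsilon>)"
    using eps by (simp add: ennreal_of_nat_eq_real_of_nat mult.assoc flip: ennreal_mult)
  finally have B: "emeasure lborel B \<le> ennreal (CARD('d) * r * 18 * \<epsilon>)" .
  show ?thesis
  proof (rule dist_P_infinity_le)
    show "B \<in> sets lborel" unfolding B_def using I L by (intro sets.finite_UN) auto
    show "emeasure lborel B \<le> ennreal (CARD('d) * r * 18 * \<epsilon>)" by fact
    fix t i assume t: "0 \<le> t" "t \<le> K" "t \<notin> B"
    define V where "V = {u\<in>individuals. label_type u = i}"
    have V: "finite V" using finite_individuals by (simp add: V_def)
    let ?\<sigma> = "\<lambda>u::'d label. arr (fst u) (fst (snd u))"
    have fin: "finite {k. n * (t - \<epsilon>) < arr j k \<and> arr j k \<le> n * t}" for j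
    proof (rule finite_subset)
      show "{k. n * (t - \<epsilon>) < arr j k \<and> arr j k \<le> n * t} \<subseteq> {..<Q * b j}"
        using index_less[OF _ t(2)] by auto
    qed auto
    have "dist_M1 t (\<lambda>s. vec_nth (rescaled n (hawkes gap nchild delay \<omega>) s) i)
        (\<lambda>s. vec_nth (rescaled n (coupled_process gap nchild \<omega>) s) i)
      \<le> max \<epsilon> (real (card {u\<in>V. n * (t - \<epsilon>) < ?\<sigma> u \<and> ?\<sigma> u \<le> n * t}) / n)"
    proof (rule dist_M1_count_le[OF V])
      show "0 < ?\<sigma> u \<and> ?\<sigma> u \<le> birth_time gap delay \<omega> u \<and> birth_time gap delay \<omega> u \<le> ?\<sigma> u + n * \<epsilon>"
        if "u \<in> V" for u
        using that not_late[of "fst (snd u)" "fst u" "snd (snd u)"]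
        by (cases u) (auto simp: V_def individuals_def arr_pos arr_le_birth mult.commute)
    qed (use n t eps in \<open>auto simp: hawkes_count coupled_count V_def\<close>)
    also have "\<dots> \<le> max \<epsilon> (real CARD('d) * (2 * \<eta>))"
    proof (intro max.mono order_refl)
      have "{u\<in>V. n * (t - \<epsilon>) < ?\<sigma> u \<and> ?\<sigma> u \<le> n * t} \<subseteq>
        (SIGMA j:UNIV. SIGMA k:{k. n * (t - \<epsilon>) < arr j k \<and> arr j k \<le> n * t}. {p. is_born nchild \<omega> (j, k, p)})"
        by (auto simp: V_def individuals_def)
      then have "real (card {u\<in>V. n * (t - \<epsilon>) < ?\<sigma> u \<and> ?\<sigma> u \<le> n * t}) \<le> real (card 
        (SIGMA j:UNIV. SIGMA k:{k. n * (t - \<epsilon>) < arr j k \<and> arr j k \<le> n * t}. {p. is_born nchild \<omega> (j, k, p)}))"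
        using fin finite_cluster by (intro of_nat_mono card_mono finite_SigmaI) auto
      also have "\<dots> = (\<Sum>j\<in>UNIV. \<Sum>k\<in>{k. n * (t - \<epsilon>) < arr j k \<and> arr j k \<le> n * t}. csize j k)"
        using fin finite_cluster by (simp add: card_SigmaI finite_SigmaI)
      also have "\<dots> \<le> (\<Sum>j\<in>(UNIV::'d set). 2 * \<eta> * n)"
      proof (intro sum_mono window_sum t(2))
        fix j q assume "q < Q" "\<eta> * n < (\<Sum>k\<in>block j q. csize j k)"
        then have "t \<notin> I j q" using t(3) by (auto simp: B_def L_def)
        then show "n * t < arr j (q * b j) \<or> arr j (q * b j) + 18 * \<epsilon> * n \<le> n * t"
          using n by (auto simp: I_def field_simps)
      qed
      finally show "real (card {u\<in>V. n * (t - \<epsilon>) < ?\<sigma> u \<and> ?\<sigma> u \<le> n * t}) / n \<le> real CARD('d) * (2 * \<eta>)"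
        using n by (simp add: field_simps)
    qed
    finally show "dist_M1 t (\<lambda>s. vec_nth (rescaled n (hawkes gap nchild delay \<omega>) s) i)
        (\<lambda>s. vec_nth (rescaled n (coupled_process gap nchild \<omega>) s) i) \<le> max \<epsilon> (real CARD('d) * (2 * \<eta>))" .
  qed (use eps eta in auto)
qed

end

section \<open>Independence and one-step expectations\<close>

context hawkes_clusters
begin

abbreviation "noise \<equiv> noise_events M gap mark nchild delay"

definition noise_sigma :: "'d noise_index set \<Rightarrow> 'a measure" where
  "noise_sigma I = sigma (space M) (\<Union>x\<in>I. noise x)"

lemma noise_subset_events: "noise x \<subseteq> events"
  using independent by (auto simp: indep_sets_def)

lemma space_noise_sigma [simp]: "space (noise_sigma I) = space M"
  using noise_subset_events sets.sets_into_space unfolding noise_sigma_def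
  by (subst space_measure_of) blast+

lemma sets_noise_sigma: "sets (noise_sigma I) = sigma_sets (space M) (\<Union>x\<in>I. noise x)"
  using noise_subset_events sets.sets_into_space unfolding noise_sigma_def
  by (subst sets_measure_of) blast+

lemma sets_noise_sigma_mono: "I \<subseteq> J \<Longrightarrow> sets (noise_sigma I) \<subseteq> sets (noise_sigma J)"
  unfolding sets_noise_sigma by (intro sigma_sets_mono') auto

lemma sets_noise_sigma_subset: "sets (noise_sigma I) \<subseteq> events"
  unfolding sets_noise_sigma using noise_subset_events by (intro sets.sigma_sets_subset) blast

lemma measurable_noise_sigma_imp: "X \<in> measurable (noise_sigma I) N \<Longrightarrow> X \<in> measurable M N"
  using sets_noise_sigma_subset[of I] by (auto simp: measurable_def)

lemma measurable_noise_sigma_mono: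
  "X \<in> measurable (noise_sigma I) N \<Longrightarrow> I \<subseteq> J \<Longrightarrow> X \<in> measurable (noise_sigma J) N"
  using sets_noise_sigma_mono[of I J] by (auto simp: measurable_def)

lemma in_noise_sigma: "B \<in> noise x \<Longrightarrow> x \<in> I \<Longrightarrow> B \<in> sets (noise_sigma I)"
  unfolding sets_noise_sigma by blast

lemma gap_measurable_noise: "Gap j k \<in> I \<Longrightarrow> gap j k \<in> borel_measurable (noise_sigma I)"
proof (rule measurableI)
  fix A :: "real set" assume A: "Gap j k \<in> I" "A \<in> sets borel"
  have "gap j k -` A \<inter> space M \<in> noise (Gap j k)"
    using A by (auto simp: in_vimage_algebra)
  then show "gap j k -` A \<inter> space (noise_sigma I) \<in> sets (noise_sigma I)"
    unfolding space_noise_sigma by (rule in_noise_sigma[OF _ A(1)])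
qed auto

lemma delay_measurable_noise: "Delay u i m \<in> I \<Longrightarrow> delay u i m \<in> borel_measurable (noise_sigma I)"
proof (rule measurableI)
  fix A :: "real set" assume A: "Delay u i m \<in> I" "A \<in> sets borel"
  have "delay u i m -` A \<inter> space M \<in> noise (Delay u i m)"
    using A by (auto simp: in_vimage_algebra)
  then show "delay u i m -` A \<inter> space (noise_sigma I) \<in> sets (noise_sigma I)"
    unfolding space_noise_sigma by (rule in_noise_sigma[OF _ A(1)])
qed auto

lemma nchild_measurable_noise: "Offspring u i \<in> I \<Longrightarrow> nchild u i \<in> measurable (noise_sigma I) (count_space UNIV)"
proof (rule measurableI)
  fix A :: "nat set" assume A: "Offspring u i \<in> I"
  have "(\<lambda>\<omega>. (mark u i \<omega>, nchild u i \<omega>)) -` (UNIV \<times> A) \<inter> space M \<in> noise (Offspring u i)"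
    by (auto intro!: in_vimage_algebra)
  also have "(\<lambda>\<omega>. (mark u i \<omega>, nchild u i \<omega>)) -` (UNIV \<times> A) \<inter> space M = nchild u i -` A \<inter> space M"
    by auto
  finally show "nchild u i -` A \<inter> space (noise_sigma I) \<in> sets (noise_sigma I)"
    unfolding space_noise_sigma by (rule in_noise_sigma[OF _ A])
qed auto

lemma Int_stable_noise: "Int_stable (noise x)"
  by (cases x) (auto simp: Int_stable_def)

text \<open>The source of all factorisations of expectations below: independent, intersection-stable
  families are grouped along disjoint index sets.\<close>

lemma nn_integral_prod_noise:
  fixes X :: "'i \<Rightarrow> 'a \<Rightarrow> ennreal"
  assumes A: "finite A" and disj: "disjoint_family_on I A"
    and X: "\<And>a. a \<in> A \<Longrightarrow> X a \<in> borel_measurable (noise_sigma (I a))"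
  shows "(\<integral>\<^sup>+\<omega>. (\<Prod>a\<in>A. X a \<omega>) \<partial>M) = (\<Prod>a\<in>A. \<integral>\<^sup>+\<omega>. X a \<omega> \<partial>M)"
proof (rule indep_vars_nn_integral[OF A])
  have "indep_sets (\<lambda>a. sigma_sets (space M) (\<Union>x\<in>I a. noise x)) A"
    by (rule indep_sets_collect_sigma[OF indep_sets_mono_index[OF _ independent] Int_stable_noise disj]) auto
  then have "indep_sets (\<lambda>a. {X a -` B \<inter> space M | B. B \<in> sets borel}) A"
    by (rule indep_sets_mono_sets) (use measurable_sets[OF X] in \<open>auto simp: sets_noise_sigma\<close>)
  then show "indep_vars (\<lambda>_. borel) X A"
    using X by (auto simp: indep_vars_def2 intro: measurable_noise_sigma_imp)
qed auto

lemma nn_integral_mult_noise: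
  assumes "X \<in> borel_measurable (noise_sigma I)" "Y \<in> borel_measurable (noise_sigma J)" "I \<inter> J = {}"
  shows "(\<integral>\<^sup>+\<omega>. X \<omega> * Y \<omega> \<partial>M) = (\<integral>\<^sup>+\<omega>. X \<omega> \<partial>M) * (\<integral>\<^sup>+\<omega>. Y \<omega> \<partial>M)"
proof -
  have "(\<integral>\<^sup>+\<omega>. (\<Prod>a\<in>{True, False}. (if a then X else Y) \<omega>) \<partial>M)
    = (\<Prod>a\<in>{True, False}. \<integral>\<^sup>+\<omega>. (if a then X else Y) \<omega> \<partial>M)"
    by (rule nn_integral_prod_noise[where I = "\<lambda>a. if a then I else J"])
      (use assms in \<open>auto simp: disjoint_family_on_def\<close>)
  then show ?thesis by simp
qed

text \<open>The strict inequality of lengths matters: it keeps the offspring numbers and delays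
  attached to (j, k, p) itself out of the index set, so that they are independent of the birth of
  this individual.\<close>

lemma is_born_measurable_noise:
  "{Offspring (j, k, q) i | q i. length q < length p} \<subseteq> I \<Longrightarrow>
    (\<lambda>\<omega>. is_born nchild \<omega> (j, k, p)) \<in> measurable (noise_sigma I) (count_space UNIV)"
proof (induction p)
  case (Cons a p)
  obtain i m where [simp]: "a = (i, m)" by (cases a)
  have [measurable]: "(\<lambda>\<omega>. is_born nchild \<omega> (j, k, p)) \<in> measurable (noise_sigma I) (count_space UNIV)"
    by (rule Cons.IH, rule order_trans[OF _ Cons.prems]) auto
  have [measurable]: "nchild (j, k, p) i \<in> measurable (noise_sigma I) (count_space UNIV)"
    by (rule nchild_measurable_noise) (use Cons.prems in auto)
  show ?case by simp
qed simp

text \<open>A multiplicative functional of the ancestral line. For w = 1 it counts individuals, and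
  for a truncated exponential w it gives exponential moments of the time since the arrival of the
  immigrant.\<close>

fun path_weight :: "(real \<Rightarrow> ennreal) \<Rightarrow> 'a \<Rightarrow> 'd label \<Rightarrow> ennreal" where
  "path_weight w \<omega> (j, k, []) = 1"
| "path_weight w \<omega> (j, k, (i, m) # p) = path_weight w \<omega> (j, k, p) * w (delay (j, k, p) i m \<omega>)"

lemma path_weight_measurable_noise:
  assumes w [measurable]: "w \<in> borel_measurable borel"
  shows "{Delay (j, k, q) i m | q i m. length q < length p} \<subseteq> I \<Longrightarrow>
    (\<lambda>\<omega>. path_weight w \<omega> (j, k, p)) \<in> borel_measurable (noise_sigma I)"
proof (induction p)
  case (Cons a p)
  obtain i m where [simp]: "a = (i, m)" by (cases a)
  have [measurable]: "(\<lambda>\<omega>. path_weight w \<omega> (j, k, p)) \<in> borel_measurable (noise_sigma I)"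
    by (rule Cons.IH, rule order_trans[OF _ Cons.prems]) auto
  have [measurable]: "delay (j, k, p) i m \<in> borel_measurable (noise_sigma I)"
    by (rule delay_measurable_noise) (use Cons.prems in auto)
  show ?case by simp
qed simp

lemma is_born_measurable [measurable]: "(\<lambda>\<omega>. is_born nchild \<omega> u) \<in> measurable M (count_space UNIV)"
  using measurable_noise_sigma_imp[OF is_born_measurable_noise[OF order_refl]] by (cases u) auto

lemma path_weight_measurable:
  "w \<in> borel_measurable borel \<Longrightarrow> (\<lambda>\<omega>. path_weight w \<omega> u) \<in> borel_measurable M"
  using measurable_noise_sigma_imp[OF path_weight_measurable_noise[OF _ order_refl]] by (cases u) auto

declare nchild_measurable [measurable]

lemma delay_measurable [measurable]: "delay u i m \<in> borel_measurable M"
  using distributed_measurable[OF delay_law[of u i m]] by simp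

lemma gap_measurable [measurable]: "gap j k \<in> borel_measurable M"
  using distributed_measurable[OF gap_law[of j k]] by simp

section \<open>Laws of the delays and of the interarrival times\<close>

definition delay_mean :: "'d \<Rightarrow> 'd \<Rightarrow> (real \<Rightarrow> ennreal) \<Rightarrow> ennreal" where
  "delay_mean i l w = (\<integral>\<^sup>+t. ennreal (indicator {0..} t * f i l t / mass (f i l)) * w t \<partial>lborel)"

lemma nn_integral_delay:
  "w \<in> borel_measurable borel \<Longrightarrow> (\<integral>\<^sup>+\<omega>. w (delay u i m \<omega>) \<partial>M) = delay_mean i (label_type u) w"
  using distributed_nn_integral[OF delay_law[of u i m], of w] by (simp add: delay_mean_def)

lemma AE_delay_nonneg: "AE \<omega> in M. 0 \<le> delay u i m \<omega>"
proof -
  have "(\<integral>\<^sup>+\<omega>. indicator {..<0} (delay u i m \<omega>) \<partial>M) = 0"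
    by (subst nn_integral_delay) (auto simp: delay_mean_def indicator_def intro!: nn_integral_zero' AE_I2)
  then have "AE \<omega> in M. indicator {..<0::real} (delay u i m \<omega>) = (0::ennreal)"
    by (subst (asm) nn_integral_0_iff_AE) auto
  then show ?thesis by eventually_elim (auto split: split_indicator_asm)
qed

lemma nn_integral_gap:
  "w \<in> borel_measurable borel \<Longrightarrow>
    (\<integral>\<^sup>+\<omega>. w (gap j k \<omega>) \<partial>M) = (\<integral>\<^sup>+x. ennreal (exponential_density (c j) x) * w x \<partial>lborel)"
  using distributed_nn_integral[OF gap_law[of j k], of w] by simp

lemma AE_gap_pos: "AE \<omega> in M. 0 < gap j k \<omega>"
proof -
  have "(\<integral>\<^sup>+\<omega>. indicator {..0} (gap j k \<omega>) \<partial>M)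
    = (\<integral>\<^sup>+x. ennreal (exponential_density (c j) x) * indicator {..0} x \<partial>lborel)"
    by (rule nn_integral_gap) auto
  \<comment> \<open>The exponential density does not vanish at 0 itself, so a single point of
    measure 0 remains.\<close>
  also have "\<dots> = (\<integral>\<^sup>+x. ennreal (exponential_density (c j) 0) * indicator {0::real} x \<partial>lborel)"
  proof (rule nn_integral_cong)
    fix x :: real
    show "ennreal (exponential_density (c j) x) * indicator {..0} x
      = ennreal (exponential_density (c j) 0) * indicator {0} x"
      by (cases x "0 :: real" rule: linorder_cases) (auto simp: exponential_density_def)
  qed
  also have "\<dots> = 0"
    by (subst nn_integral_cmult_indicator) auto
  finally have "AE \<omega> in M. indicator {..0::real} (gap j k \<omega>) = (0::ennreal)"
    by (subst (asm) nn_integral_0_iff_AE) auto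
  then show ?thesis by eventually_elim (auto split: split_indicator_asm)
qed

text \<open>Exponential tilting: the integrand is 1 / (1 - \<theta>) times the exponential density
  of rate c j * (1 - \<theta>).\<close>

lemma nn_integral_exp_gap:
  assumes "\<theta> < 1"
  shows "(\<integral>\<^sup>+\<omega>. ennreal (exp (\<theta> * c j * gap j k \<omega>)) \<partial>M) = ennreal (1 / (1 - \<theta>))"
proof -
  let ?l = "c j * (1 - \<theta>)"
  have l: "0 < ?l" using assms c_pos by simp
  have "(\<integral>\<^sup>+\<omega>. ennreal (exp (\<theta> * c j * gap j k \<omega>)) \<partial>M)
    = (\<integral>\<^sup>+x. ennreal (exponential_density (c j) x) * ennreal (exp (\<theta> * c j * x)) \<partial>lborel)"
    by (rule nn_integral_gap) simp
  also have "\<dots> = (\<integral>\<^sup>+x. ennreal (1 / (1 - \<theta>)) * ennreal (exponential_density ?l x) \<partial>lborel)"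
    using assms c_pos[of j] l
    by (intro nn_integral_cong, subst (1 2) ennreal_mult[symmetric])
      (auto simp: exponential_density_def exponential_density_nonneg field_simps simp flip: exp_add)
  also have "\<dots> = ennreal (1 / (1 - \<theta>)) * emeasure (density lborel (exponential_density ?l)) UNIV"
    by (subst nn_integral_cmult) (auto simp: emeasure_density)
  also have "\<dots> = ennreal (1 / (1 - \<theta>))"
    using prob_space.emeasure_space_1[OF prob_space_exponential_density[OF l]] by simp
  finally show ?thesis .
qed

end

section \<open>Powers of a subcritical kernel\<close>

text \<open>An eigenvector of s * A for k is an eigenvector of A for k / s.\<close>

lemma spectral_radius_smult_less:
  assumes A: "A \<in> carrier_mat n n" and n: "0 < n" and s: "0 < s"
    and sr: "s * spectral_radius A < 1"
  shows "spectral_radius (complex_of_real s \<cdot>\<^sub>m A) < 1"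
proof -
  let ?B = "complex_of_real s \<cdot>\<^sub>m A"
  have B: "?B \<in> carrier_mat n n" using A by simp
  obtain k where k: "eigenvalue ?B k" "spectral_radius ?B = norm k"
    using spectral_radius_mem_max(1)[OF B n] by (auto simp: spectrum_def)
  then obtain v where v: "v \<in> carrier_vec n" "v \<noteq> 0\<^sub>v n" "?B *\<^sub>v v = k \<cdot>\<^sub>v v"
    using A by (auto simp: eigenvalue_def eigenvector_def)
  have "A *\<^sub>v v = (k / s) \<cdot>\<^sub>v v"
  proof (rule eq_vecI)
    fix i assume i: "i < dim_vec ((k / s) \<cdot>\<^sub>v v)"
    have "(?B *\<^sub>v v) $ i = (k \<cdot>\<^sub>v v) $ i" using v(3) by simp
    then have "s * (A *\<^sub>v v) $ i = k * v $ i" using i v(1) A by simp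
    then show "(A *\<^sub>v v) $ i = ((k / s) \<cdot>\<^sub>v v) $ i" using i s v(1) by (simp add: field_simps)
  qed (use v A in auto)
  then have "k / s \<in> spectrum A"
    using v A by (auto simp: spectrum_def eigenvalue_def eigenvector_def)
  then have "norm (k / s) \<le> spectral_radius A"
    using spectral_radius_mem_max(2)[OF A n] by auto
  then have "norm k \<le> s * spectral_radius A"
    using s by (simp add: norm_divide field_simps)
  then show ?thesis using sr k by simp
qed

text \<open>The entries of the matrix power, indexed by types: a sum over all lines of descent of g
  steps from an ancestor of type j to a descendant of type i.\<close>

primrec kernel_power :: "('d::finite \<Rightarrow> 'd \<Rightarrow> real) \<Rightarrow> nat \<Rightarrow> 'd \<Rightarrow> 'd \<Rightarrow> real" where
  "kernel_power m 0 i j = of_bool (i = j)"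
| "kernel_power m (Suc g) i j = (\<Sum>l\<in>UNIV. m i l * kernel_power m g l j)"

lemma kernel_power_nonneg: "(\<And>i j. 0 \<le> m i j) \<Longrightarrow> 0 \<le> kernel_power m g i j"
  by (induction g arbitrary: i) (auto intro!: sum_nonneg)

text \<open>The powers of a matrix with spectral radius below 1 are bounded, by its Jordan normal
  form. If R is the spectral radius of A, then s = 2 / (1 + R) satisfies s > 1 and s * R < 1, so
  this applies to s * A and yields geometric decay of the powers of A.\<close>

lemma kernel_power_geometric_bound:
  fixes m :: "'d::finite \<Rightarrow> 'd \<Rightarrow> real"
  defines "A \<equiv> Matrix.mat CARD('d) CARD('d)
    (\<lambda>(a, b). complex_of_real (m (from_nat_into UNIV a) (from_nat_into UNIV b)))"
  assumes sr: "spectral_radius A < 1"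
  obtains s C where "1 < s" "\<And>g i j. s ^ g * \<bar>kernel_power m g i j\<bar> \<le> C"
proof -
  let ?n = "CARD('d)"
  let ?e = "from_nat_into (UNIV :: 'd set)"
  have A: "A \<in> carrier_mat ?n ?n" by (simp add: A_def)
  have bij: "bij_betw ?e {..<?n} UNIV"
    by (rule bij_betw_from_nat_into_finite) simp
  define R where "R = spectral_radius A"
  have "R \<ge> 0"
    using spectral_radius_mem_max(1)[OF A] by (auto simp: R_def)
  define s where "s = 2 / (1 + R)"
  have s: "1 < s" using \<open>R \<ge> 0\<close> sr by (simp add: s_def R_def)
  have "s * R < 1" using \<open>R \<ge> 0\<close> sr by (simp add: s_def R_def field_simps)
  define B where "B = complex_of_real s \<cdot>\<^sub>m A"
  have B: "B \<in> carrier_mat ?n ?n" using A by (simp add: B_def)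
  have "spectral_radius B < 1"
    unfolding B_def using A s \<open>s * R < 1\<close> by (intro spectral_radius_smult_less) (auto simp: R_def)
  from spectral_radius_jnf_norm_bound_less_1_upper_triangular[OF B this]
  obtain C where C: "\<And>g. norm_bound (B ^\<^sub>m g) C" by blast
  have Bp: "B ^\<^sub>m g \<in> carrier_mat ?n ?n" for g using B by simp
  \<comment> \<open>Matrix powers take the new factor on the right, \<open>kernel_power\<close>
    takes it on the left.\<close>
  have comm: "B * B ^\<^sub>m g = B ^\<^sub>m g * B" for g
  proof (induction g)
    case 0
    then show ?case using B by simp
  next
    case (Suc g)
    have "B * B ^\<^sub>m Suc g = (B * B ^\<^sub>m g) * B"
      using assoc_mult_mat[OF B Bp[of g] B] by simp
    then show ?case using Suc by simp
  qed
  have entry: "(B ^\<^sub>m g) $$ (a, b) = complex_of_real (s ^ g * kernel_power m g (?e a) (?e b))"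
    if "a < ?n" "b < ?n" for g a b
    using that
  proof (induction g arbitrary: a)
    case 0
    have "?e a = ?e b \<longleftrightarrow> a = b"
      using bij 0 by (auto simp: bij_betw_def inj_on_eq_iff)
    then show ?case using 0 B by simp
  next
    case (Suc g)
    have "(B ^\<^sub>m Suc g) $$ (a, b) = (B * B ^\<^sub>m g) $$ (a, b)"
      by (simp add: comm)
    also have "\<dots> = (\<Sum>c<?n. B $$ (a, c) * (B ^\<^sub>m g) $$ (c, b))"
      using Suc.prems B Bp[of g] by (simp add: scalar_prod_def atLeast0LessThan)
    also have "\<dots> = (\<Sum>c<?n. complex_of_real (s * m (?e a) (?e c) * (s ^ g * kernel_power m g (?e c) (?e b))))"
      using Suc by (intro sum.cong) (auto simp: B_def A_def)
    also have "\<dots> = (\<Sum>l\<in>UNIV. complex_of_real (s * m (?e a) l * (s ^ g * kernel_power m g l (?e b))))"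
      by (rule sum.reindex_bij_betw[OF bij])
    finally show ?case
      by (simp add: sum_distrib_left mult_ac)
  qed
  show ?thesis
  proof (rule that[OF s])
    fix g and i j :: 'd
    obtain a b where ab: "a < ?n" "b < ?n" "i = ?e a" "j = ?e b"
    proof -
      have "i \<in> ?e ` {..<?n}" "j \<in> ?e ` {..<?n}"
        using bij_betw_imp_surj_on[OF bij] by simp_all
      then show thesis using that by blast
    qed
    have "norm ((B ^\<^sub>m g) $$ (a, b)) \<le> C"
      using C[of g] ab B by (simp add: norm_bound_def)
    then show "s ^ g * \<bar>kernel_power m g i j\<bar> \<le> C"
      using s ab by (simp add: entry norm_mult norm_power)
  qed
qed

section \<open>Moments of the offspring and of the generations\<close>

lemma poisson_prob_nonneg: "0 \<le> r \<Longrightarrow> 0 \<le> poisson_prob r n"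
  by (simp add: poisson_prob_def)

lemma poisson_prob_sums: "poisson_prob r sums 1"
proof -
  have "(\<lambda>n. r ^ n / fact n * exp (- r)) sums (exp r * exp (- r))"
    using exp_converges[of r] by (intro sums_mult2) (simp add: scaleR_conv_of_real field_simps)
  then show ?thesis by (simp add: poisson_prob_def[abs_def] flip: exp_add)
qed

lemma poisson_mean_sums: "(\<lambda>n. real n * poisson_prob r n) sums r"
proof -
  have "real (Suc n) * poisson_prob r (Suc n) = r * poisson_prob r n" for n
    by (simp add: poisson_prob_def field_simps del: of_nat_Suc)
  then have "(\<lambda>n. real (Suc n) * poisson_prob r (Suc n)) sums (r * 1)"
    using sums_mult[OF poisson_prob_sums, of r r] by presburger
  then show ?thesis
    using sums_Suc[of "\<lambda>n. real n * poisson_prob r n" r] by simp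
qed

lemma nn_integral_count_poisson_mean:
  assumes "0 \<le> r"
  shows "(\<integral>\<^sup>+n. of_nat n * ennreal (poisson_prob r n) \<partial>count_space UNIV) = ennreal r"
proof -
  have "(\<integral>\<^sup>+n. of_nat n * ennreal (poisson_prob r n) \<partial>count_space UNIV)
    = (\<Sum>n. ennreal (real n * poisson_prob r n))"
    using assms by (simp add: nn_integral_count_space_nat ennreal_mult poisson_prob_nonneg ennreal_of_nat_eq_real_of_nat)
  also have "\<dots> = ennreal r"
    using assms poisson_mean_sums[of r]
    by (subst suminf_ennreal2) (auto simp: poisson_prob_nonneg sums_iff)
  finally show ?thesis .
qed

text \<open>Paths whose youngest entry has type i are reindexed by (q, m) \<mapsto> (i, m) # q; this
  splits off the youngest generation in the recursion for \<open>generation_weight\<close>.\<close>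

lemma nn_integral_count_space_Cons:
  "(\<integral>\<^sup>+p. (case p of [] \<Rightarrow> 0 | (i', m) # q \<Rightarrow> if i' = i then F m q else 0) \<partial>count_space UNIV)
    = (\<integral>\<^sup>+q. \<integral>\<^sup>+m. F m q \<partial>count_space UNIV \<partial>count_space (UNIV :: ('d \<times> nat) list set))"
  (is "(\<integral>\<^sup>+p. ?G p \<partial>count_space UNIV) = _")
proof -
  define h where "h = (\<lambda>(q :: ('d \<times> nat) list, m). (i, m) # q)"
  have "(\<integral>\<^sup>+p. ?G p \<partial>count_space UNIV) = (\<integral>\<^sup>+p. ?G p \<partial>count_space (range h))"
    by (intro nn_integral_count_space_eq)
      (auto simp: h_def image_iff split: list.splits if_splits)
  also have "\<dots> = (\<integral>\<^sup>+x. ?G (h x) \<partial>count_space UNIV)"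
    by (rule nn_integral_bij_count_space[symmetric])
      (auto simp: bij_betw_def inj_on_def h_def)
  also have "\<dots> = (\<integral>\<^sup>+x. F (snd x) (fst x) \<partial>count_space UNIV)"
    by (intro nn_integral_cong) (auto simp: h_def split: prod.splits)
  also have "\<dots> = (\<integral>\<^sup>+q. \<integral>\<^sup>+m. F m q \<partial>count_space UNIV \<partial>count_space UNIV)"
    by (subst nn_integral_fst_count_space[symmetric]) simp
  finally show ?thesis .
qed

context hawkes_clusters
begin

lemma AE_mark_rate_nonneg: "AE x in \<beta> i l. 0 \<le> x * mass (f i l)"
  using mark_law_nonneg[of i l] by eventually_elim (simp add: f_mass_pos less_imp_le)

lemma poisson_prob_measurable [measurable]:
  "(\<lambda>b. ennreal (poisson_prob (b * r) n)) \<in> borel_measurable (\<beta> i l)"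
  using mark_law_sets[of i l] by (subst measurable_cong_sets[of _ borel _ borel]) (auto simp: poisson_prob_def)

lemma emeasure_nchild_eq:
  "emeasure M {\<omega>\<in>space M. nchild u i \<omega> = n}
    = (\<integral>\<^sup>+b. ennreal (poisson_prob (b * mass (f i (label_type u))) n) \<partial>\<beta> i (label_type u))"
  using offspring_law[of UNIV u i n] by simp

lemma nn_integral_nchild:
  "(\<integral>\<^sup>+\<omega>. g (nchild u i \<omega>) \<partial>M)
    = (\<integral>\<^sup>+b. \<integral>\<^sup>+n. g n * ennreal (poisson_prob (b * mass (f i (label_type u))) n) \<partial>count_space UNIV \<partial>\<beta> i (label_type u))"
proof -
  let ?l = "label_type u"
  have "(\<integral>\<^sup>+\<omega>. g (nchild u i \<omega>) \<partial>M)
    = (\<integral>\<^sup>+\<omega>. \<integral>\<^sup>+n. g n * indicator {\<omega>\<in>space M. nchild u i \<omega> = n} \<omega> \<partial>count_space UNIV \<partial>M)"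
  proof (intro nn_integral_cong)
    fix \<omega> assume \<omega>: "\<omega> \<in> space M"
    have "(\<integral>\<^sup>+n. g n * indicator {\<omega>\<in>space M. nchild u i \<omega> = n} \<omega> \<partial>count_space UNIV)
      = (\<integral>\<^sup>+n. g n * indicator {nchild u i \<omega>} n \<partial>count_space UNIV)"
      using \<omega> by (intro nn_integral_cong) (auto split: split_indicator)
    then show "g (nchild u i \<omega>) = (\<integral>\<^sup>+n. g n * indicator {\<omega>\<in>space M. nchild u i \<omega> = n} \<omega> \<partial>count_space UNIV)"
      by (simp add: one_ennreal_def[symmetric])
  qed
  also have "\<dots> = (\<integral>\<^sup>+n. g n * emeasure M {\<omega>\<in>space M. nchild u i \<omega> = n} \<partial>count_space UNIV)"
    by (subst nn_integral_count_space_nn_integral) (auto simp: nn_integral_cmult)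
  also have "\<dots> = (\<integral>\<^sup>+n. \<integral>\<^sup>+b. g n * ennreal (poisson_prob (b * mass (f i ?l)) n) \<partial>\<beta> i ?l \<partial>count_space UNIV)"
    by (simp add: emeasure_nchild_eq nn_integral_cmult)
  also have "\<dots> = (\<integral>\<^sup>+b. \<integral>\<^sup>+n. g n * ennreal (poisson_prob (b * mass (f i ?l)) n) \<partial>count_space UNIV \<partial>\<beta> i ?l)"
    by (rule nn_integral_count_space_nn_integral[symmetric]) auto
  finally show ?thesis .
qed

definition offspring_mean :: "'d \<Rightarrow> 'd \<Rightarrow> ennreal" where
  "offspring_mean i l = (\<integral>\<^sup>+b. ennreal (b * mass (f i l)) \<partial>\<beta> i l)"

lemma nn_integral_nchild_mean: "(\<integral>\<^sup>+\<omega>. of_nat (nchild u i \<omega>) \<partial>M) = offspring_mean i (label_type u)"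
  unfolding nn_integral_nchild offspring_mean_def
proof (rule nn_integral_cong_AE)
  show "AE b in \<beta> i (label_type u). (\<integral>\<^sup>+n. of_nat n * ennreal (poisson_prob (b * mass (f i (label_type u))) n) \<partial>count_space UNIV)
      = ennreal (b * mass (f i (label_type u)))"
    using AE_mark_rate_nonneg[of i "label_type u"] by eventually_elim (rule nn_integral_count_poisson_mean)
qed

text \<open>Child number m exists exactly if m < \<open>nchild\<close>, so summing over m counts the
  children.\<close>

lemma sum_emeasure_nchild_gt:
  "(\<integral>\<^sup>+m. emeasure M {\<omega>\<in>space M. m < nchild u i \<omega>} \<partial>count_space UNIV) = offspring_mean i (label_type u)"
proof -
  have "offspring_mean i (label_type u) = (\<integral>\<^sup>+\<omega>. \<integral>\<^sup>+m. indicator {\<omega>\<in>space M. m < nchild u i \<omega>} \<omega> \<partial>count_space UNIV \<partial>M)"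
    unfolding nn_integral_nchild_mean[symmetric]
  proof (intro nn_integral_cong)
    fix \<omega> assume \<omega>: "\<omega> \<in> space M"
    have "(\<integral>\<^sup>+m. indicator {\<omega>\<in>space M. m < nchild u i \<omega>} \<omega> \<partial>count_space UNIV)
      = (\<integral>\<^sup>+m. indicator {..<nchild u i \<omega>} m \<partial>count_space UNIV)"
      using \<omega> by (intro nn_integral_cong) (auto split: split_indicator)
    then show "of_nat (nchild u i \<omega>) = (\<integral>\<^sup>+m. indicator {\<omega>\<in>space M. m < nchild u i \<omega>} \<omega> \<partial>count_space UNIV)"
      by simp
  qed
  also have "\<dots> = (\<integral>\<^sup>+m. emeasure M {\<omega>\<in>space M. m < nchild u i \<omega>} \<partial>count_space UNIV)"
    by (subst nn_integral_count_space_nn_integral) auto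
  finally show ?thesis by simp
qed

section \<open>First-moment recursion over the generations\<close>

definition expected_weight :: "(real \<Rightarrow> ennreal) \<Rightarrow> 'd \<Rightarrow> nat \<Rightarrow> ('d \<times> nat) list \<Rightarrow> ennreal" where
  "expected_weight w j k p =
    (\<integral>\<^sup>+\<omega>. (if is_born nchild \<omega> (j, k, p) then path_weight w \<omega> (j, k, p) else 0) \<partial>M)"

text \<open>Three independent factors: birth and weight of the parent depend on strictly shorter
  labels, existence of child m on the offspring number of the parent, the last factor on the delay
  of this child. The separate w' serves the count of long delays, where the ancestors carry weight
  1.\<close>

lemma nn_integral_born_child:
  assumes w: "w \<in> borel_measurable borel" and w' [measurable]: "w' \<in> borel_measurable borel"
  shows "(\<integral>\<^sup>+\<omega>. (if is_born nchild \<omega> (j, k, (i, m) # p)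
      then path_weight w \<omega> (j, k, p) * w' (delay (j, k, p) i m \<omega>) else 0) \<partial>M)
    = expected_weight w j k p * emeasure M {\<omega>\<in>space M. m < nchild (j, k, p) i \<omega>}
      * delay_mean i (label_type (j, k, p)) w'"
proof -
  define I where "I = {Offspring (j, k, q) i | q i. length q < length p} \<union> {Delay (j, k, q) i m | q i m. length q < length p}"
  let ?u = "(j, k, p)"
  have [measurable]: "(\<lambda>\<omega>. is_born nchild \<omega> ?u) \<in> measurable (noise_sigma I) (count_space UNIV)"
    by (rule is_born_measurable_noise) (auto simp: I_def)
  have [measurable]: "(\<lambda>\<omega>. path_weight w \<omega> ?u) \<in> borel_measurable (noise_sigma I)"
    by (rule path_weight_measurable_noise[OF w]) (auto simp: I_def)
  have o [measurable]: "nchild ?u i \<in> measurable (noise_sigma {Offspring ?u i}) (count_space UNIV)"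
    by (rule nchild_measurable_noise) simp
  have d [measurable]: "delay ?u i m \<in> borel_measurable (noise_sigma {Delay ?u i m})"
    by (rule delay_measurable_noise) simp
  define X where "X \<omega> = (if is_born nchild \<omega> ?u then path_weight w \<omega> ?u else 0)" for \<omega>
  define Y where "Y \<omega> = (if m < nchild ?u i \<omega> then 1 else 0 :: ennreal)" for \<omega>
  define Z where "Z \<omega> = w' (delay ?u i m \<omega>)" for \<omega>
  have X: "X \<in> borel_measurable (noise_sigma I)" unfolding X_def by measurable
  have Y: "Y \<in> borel_measurable (noise_sigma {Offspring ?u i})" unfolding Y_def by measurable
  have Z: "Z \<in> borel_measurable (noise_sigma {Delay ?u i m})" unfolding Z_def by measurable
  have YZ: "(\<lambda>\<omega>. Y \<omega> * Z \<omega>) \<in> borel_measurable (noise_sigma {Offspring ?u i, Delay ?u i m})"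
    by (intro borel_measurable_times_ennreal measurable_noise_sigma_mono[OF Y] measurable_noise_sigma_mono[OF Z]) auto
  have "(\<integral>\<^sup>+\<omega>. (if is_born nchild \<omega> (j, k, (i, m) # p)
      then path_weight w \<omega> ?u * w' (delay ?u i m \<omega>) else 0) \<partial>M) = (\<integral>\<^sup>+\<omega>. X \<omega> * (Y \<omega> * Z \<omega>) \<partial>M)"
    by (intro nn_integral_cong) (auto simp: X_def Y_def Z_def)
  also have "\<dots> = (\<integral>\<^sup>+\<omega>. X \<omega> \<partial>M) * (\<integral>\<^sup>+\<omega>. Y \<omega> * Z \<omega> \<partial>M)"
    by (rule nn_integral_mult_noise[OF X YZ]) (auto simp: I_def)
  also have "(\<integral>\<^sup>+\<omega>. Y \<omega> * Z \<omega> \<partial>M) = (\<integral>\<^sup>+\<omega>. Y \<omega> \<partial>M) * (\<integral>\<^sup>+\<omega>. Z \<omega> \<partial>M)"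
    by (rule nn_integral_mult_noise[OF Y Z]) auto
  also have "(\<integral>\<^sup>+\<omega>. Z \<omega> \<partial>M) = delay_mean i (label_type ?u) w'"
    unfolding Z_def by (rule nn_integral_delay) fact
  also have "(\<integral>\<^sup>+\<omega>. Y \<omega> \<partial>M) = (\<integral>\<^sup>+\<omega>. indicator {\<omega>\<in>space M. m < nchild ?u i \<omega>} \<omega> \<partial>M)"
    by (intro nn_integral_cong) (auto simp: Y_def)
  finally show ?thesis
    by (simp add: expected_weight_def X_def[abs_def] mult.assoc)
qed

lemma sum_expected_children:
  assumes "w \<in> borel_measurable borel" "w' \<in> borel_measurable borel"
  shows "(\<integral>\<^sup>+m. \<integral>\<^sup>+\<omega>. (if is_born nchild \<omega> (j, k, (i, m) # p)
      then path_weight w \<omega> (j, k, p) * w' (delay (j, k, p) i m \<omega>) else 0) \<partial>M \<partial>count_space UNIV)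
    = offspring_mean i (label_type (j, k, p)) * delay_mean i (label_type (j, k, p)) w' * expected_weight w j k p"
  unfolding nn_integral_born_child[OF assms]
  by (simp add: nn_integral_cmult nn_integral_multc sum_emeasure_nchild_gt mult_ac)

definition generation_weight :: "(real \<Rightarrow> ennreal) \<Rightarrow> 'd \<Rightarrow> nat \<Rightarrow> nat \<Rightarrow> 'd \<Rightarrow> ennreal" where
  "generation_weight w j k g i =
    (\<integral>\<^sup>+p. (if length p = g \<and> label_type (j, k, p) = i then expected_weight w j k p else 0) \<partial>count_space UNIV)"

lemma generation_weight_0: "generation_weight w j k 0 i = of_bool (j = i)"
proof -
  have "generation_weight w j k 0 i = (\<integral>\<^sup>+p. of_bool (j = i) * indicator {[] :: ('d \<times> nat) list} p \<partial>count_space UNIV)"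
    unfolding generation_weight_def
    by (intro nn_integral_cong) (auto simp: expected_weight_def emeasure_space_1)
  then show ?thesis by (simp add: one_ennreal_def[symmetric])
qed

text \<open>Given the parents, the children of type i only see the type l of their parent, so the
  sum over all labels collapses to a matrix recursion over types.\<close>

lemma generation_weight_Suc:
  assumes w: "w \<in> borel_measurable borel"
  shows "generation_weight w j k (Suc g) i
    = (\<Sum>l\<in>UNIV. offspring_mean i l * delay_mean i l w * generation_weight w j k g l)"
proof -
  have "generation_weight w j k (Suc g) i = (\<integral>\<^sup>+p. (case p of [] \<Rightarrow> 0 | (i', m) # q \<Rightarrow>
      if i' = i then (if length q = g then expected_weight w j k ((i, m) # q) else 0) else 0) \<partial>count_space UNIV)"
    unfolding generation_weight_def
    by (intro nn_integral_cong) (auto split: list.splits)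
  also have "\<dots> = (\<integral>\<^sup>+q. \<integral>\<^sup>+m. (if length q = g then expected_weight w j k ((i, m) # q) else 0)
      \<partial>count_space UNIV \<partial>count_space UNIV)"
    by (rule nn_integral_count_space_Cons)
  also have "\<dots> = (\<integral>\<^sup>+q. (\<Sum>l\<in>UNIV. offspring_mean i l * delay_mean i l w *
      (if length q = g \<and> label_type (j, k, q) = l then expected_weight w j k q else 0)) \<partial>count_space UNIV)"
  proof (rule nn_integral_cong)
    fix q :: "('d \<times> nat) list"
    let ?l = "label_type (j, k, q)"
    have "(\<integral>\<^sup>+m. expected_weight w j k ((i, m) # q) \<partial>count_space UNIV)
      = offspring_mean i ?l * delay_mean i ?l w * expected_weight w j k q"
      using sum_expected_children[OF w w, of j k i q] by (simp only: expected_weight_def[of w j k "_ # _"] path_weight.simps)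
    moreover have "(\<Sum>l\<in>UNIV. offspring_mean i l * delay_mean i l w *
      (if length q = g \<and> ?l = l then expected_weight w j k q else 0))
      = (\<Sum>l\<in>UNIV. if l = ?l then offspring_mean i l * delay_mean i l w *
      (if length q = g then expected_weight w j k q else 0) else 0)"
      by (intro sum.cong) auto
    ultimately show "(\<integral>\<^sup>+m. (if length q = g then expected_weight w j k ((i, m) # q) else 0) \<partial>count_space UNIV)
      = (\<Sum>l\<in>UNIV. offspring_mean i l * delay_mean i l w *
      (if length q = g \<and> ?l = l then expected_weight w j k q else 0))"
      by simp
  qed
  also have "\<dots> = (\<Sum>l\<in>UNIV. offspring_mean i l * delay_mean i l w * generation_weight w j k g l)"
    by (subst nn_integral_sum) (auto simp: nn_integral_cmult generation_weight_def)
  finally show ?thesis .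
qed

lemma total_expected_weight:
  "(\<integral>\<^sup>+p. expected_weight w j k p \<partial>count_space UNIV) = (\<Sum>g. \<Sum>i\<in>UNIV. generation_weight w j k g i)"
proof -
  have "(\<integral>\<^sup>+p. expected_weight w j k p \<partial>count_space UNIV)
    = (\<integral>\<^sup>+p. \<integral>\<^sup>+g. (\<Sum>i\<in>UNIV. if length p = g \<and> label_type (j, k, p) = i then expected_weight w j k p else 0)
        \<partial>count_space UNIV \<partial>count_space UNIV)"
  proof (rule nn_integral_cong)
    fix p
    have "(\<integral>\<^sup>+g. (\<Sum>i\<in>UNIV. if length p = g \<and> label_type (j, k, p) = i then expected_weight w j k p else 0) \<partial>count_space UNIV)
      = (\<integral>\<^sup>+g. expected_weight w j k p * indicator {length p} g \<partial>count_space UNIV)"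
      by (intro nn_integral_cong) (auto split: split_indicator)
    then show "expected_weight w j k p = (\<integral>\<^sup>+g. (\<Sum>i\<in>UNIV. if length p = g \<and> label_type (j, k, p) = i
        then expected_weight w j k p else 0) \<partial>count_space UNIV)"
      by (simp add: one_ennreal_def[symmetric])
  qed
  also have "\<dots> = (\<integral>\<^sup>+g. \<integral>\<^sup>+p. (\<Sum>i\<in>UNIV. if length p = g \<and> label_type (j, k, p) = i then expected_weight w j k p else 0)
        \<partial>count_space UNIV \<partial>count_space UNIV)"
    by (rule nn_integral_count_space_nn_integral) auto
  also have "\<dots> = (\<integral>\<^sup>+g. (\<Sum>i\<in>UNIV. generation_weight w j k g i) \<partial>count_space UNIV)"
    by (subst nn_integral_sum) (auto simp: generation_weight_def)
  finally show ?thesis by (simp add: nn_integral_count_space_nat)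
qed

end

section \<open>Late individuals, large blocks and block durations\<close>

lemma borel_measurable_nn_integral_count_space:
  fixes F :: "'i::countable \<Rightarrow> 'a \<Rightarrow> ennreal"
  assumes "\<And>i. F i \<in> borel_measurable N"
  shows "(\<lambda>\<omega>. \<integral>\<^sup>+i. F i \<omega> \<partial>count_space UNIV) \<in> borel_measurable N"
proof -
  interpret sigma_finite_measure "count_space (UNIV :: 'i set)"
    by (rule sigma_finite_measure_count_space)
  have "(\<lambda>(\<omega>, i). F i \<omega>) \<in> borel_measurable (N \<Otimes>\<^sub>M count_space UNIV)"
    using measurable_compose_countable'[where f = "\<lambda>i x. F i (fst x)" and g = snd and I = UNIV
        and M = "N \<Otimes>\<^sub>M count_space UNIV" and N = borel] assms
    by (simp add: split_beta')
  then show ?thesis by (rule borel_measurable_nn_integral)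
qed

lemma suminf_le_geometric:
  fixes x :: "nat \<Rightarrow> ennreal"
  assumes "\<And>g. x g \<le> ennreal (B * \<rho> ^ g)" "0 \<le> B" "0 \<le> \<rho>" "\<rho> < 1"
  shows "(\<Sum>g. x g) \<le> ennreal (B / (1 - \<rho>))"
proof -
  have "(\<Sum>g. x g) \<le> (\<Sum>g. ennreal (B * \<rho> ^ g))"
    by (intro suminf_le assms) auto
  also have "\<dots> = ennreal (\<Sum>g. B * \<rho> ^ g)"
    using assms by (intro suminf_ennreal2) auto
  also have "(\<Sum>g. B * \<rho> ^ g) = B * (1 / (1 - \<rho>))"
    using assms by (subst suminf_mult) (auto simp: suminf_geometric)
  finally show ?thesis by simp
qed

context hawkes_clusters
begin

section \<open>Weighted sums over a cluster\<close>

definition path_total :: "(real \<Rightarrow> ennreal) \<Rightarrow> 'd \<Rightarrow> nat \<Rightarrow> 'a \<Rightarrow> ennreal" where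
  "path_total w j k \<omega> =
    (\<integral>\<^sup>+p. (if is_born nchild \<omega> (j, k, p) then path_weight w \<omega> (j, k, p) else 0) \<partial>count_space UNIV)"

lemma path_total_measurable:
  "w \<in> borel_measurable borel \<Longrightarrow> path_total w j k \<in> borel_measurable M"
proof -
  assume "w \<in> borel_measurable borel"
  then have [measurable]: "(\<lambda>\<omega>. path_weight w \<omega> u) \<in> borel_measurable M" for u
    by (rule path_weight_measurable)
  show ?thesis
    unfolding path_total_def[abs_def] by (rule borel_measurable_nn_integral_count_space) measurable
qed

lemma nn_integral_path_total:
  assumes "w \<in> borel_measurable borel"
  shows "(\<integral>\<^sup>+\<omega>. path_total w j k \<omega> \<partial>M) = (\<integral>\<^sup>+p. expected_weight w j k p \<partial>count_space UNIV)"
proof -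
  have [measurable]: "(\<lambda>\<omega>. path_weight w \<omega> u) \<in> borel_measurable M" for u
    using assms by (rule path_weight_measurable)
  show ?thesis
    unfolding path_total_def expected_weight_def
    by (rule nn_integral_count_space_nn_integral) auto
qed

text \<open>Counts the descendants in the cluster whose own delay exceeds a, so that a value below 1
  means that there are none. The outer sum runs over the parents, so that
  \<open>sum_expected_children\<close> evaluates the inner one.\<close>

definition long_delay_total :: "real \<Rightarrow> 'd \<Rightarrow> nat \<Rightarrow> 'a \<Rightarrow> ennreal" where
  "long_delay_total a j k \<omega> = (\<integral>\<^sup>+p. (\<Sum>i\<in>UNIV. \<integral>\<^sup>+m. (if is_born nchild \<omega> (j, k, (i, m) # p)
      then indicator {a<..} (delay (j, k, p) i m \<omega>) else 0) \<partial>count_space UNIV) \<partial>count_space UNIV)"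

lemma long_delay_total_measurable [measurable]: "long_delay_total a j k \<in> borel_measurable M"
  unfolding long_delay_total_def[abs_def]
  by (intro borel_measurable_nn_integral_count_space borel_measurable_sum) measurable

lemma path_weight_1 [simp]: "path_weight (\<lambda>_. 1) \<omega> (j, k, p) = 1"
  by (induction p) auto

lemma nn_integral_long_delay_total:
  "(\<integral>\<^sup>+\<omega>. long_delay_total a j k \<omega> \<partial>M) = (\<integral>\<^sup>+p. (\<Sum>i\<in>UNIV. offspring_mean i (label_type (j, k, p)) *
      delay_mean i (label_type (j, k, p)) (indicator {a<..}) * expected_weight (\<lambda>_. 1) j k p) \<partial>count_space UNIV)"
proof -
  define F where "F p i m \<omega> = (if is_born nchild \<omega> (j, k, (i, m) # p)
      then indicator {a<..} (delay (j, k, p) i m \<omega>) else 0 :: ennreal)" for p i m \<omega>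
  have F [measurable]: "F p i m \<in> borel_measurable M" for p i m
    unfolding F_def[abs_def] by measurable
  have G [measurable]: "(\<lambda>\<omega>. \<integral>\<^sup>+m. F p i m \<omega> \<partial>count_space UNIV) \<in> borel_measurable M" for p i
    by (rule borel_measurable_nn_integral_count_space) measurable
  have "(\<integral>\<^sup>+\<omega>. long_delay_total a j k \<omega> \<partial>M)
    = (\<integral>\<^sup>+p. \<integral>\<^sup>+\<omega>. (\<Sum>i\<in>UNIV. \<integral>\<^sup>+m. F p i m \<omega> \<partial>count_space UNIV) \<partial>M \<partial>count_space UNIV)"
    unfolding long_delay_total_def F_def[symmetric]
    by (rule nn_integral_count_space_nn_integral) auto
  also have "\<dots> = (\<integral>\<^sup>+p. (\<Sum>i\<in>UNIV. \<integral>\<^sup>+m. \<integral>\<^sup>+\<omega>. F p i m \<omega> \<partial>M \<partial>count_space UNIV) \<partial>count_space UNIV)"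
  proof (intro nn_integral_cong)
    fix p
    have "(\<integral>\<^sup>+\<omega>. (\<Sum>i\<in>UNIV. \<integral>\<^sup>+m. F p i m \<omega> \<partial>count_space UNIV) \<partial>M)
      = (\<Sum>i\<in>UNIV. \<integral>\<^sup>+\<omega>. \<integral>\<^sup>+m. F p i m \<omega> \<partial>count_space UNIV \<partial>M)"
      by (rule nn_integral_sum) (rule G)
    also have "\<dots> = (\<Sum>i\<in>UNIV. \<integral>\<^sup>+m. \<integral>\<^sup>+\<omega>. F p i m \<omega> \<partial>M \<partial>count_space UNIV)"
      by (intro sum.cong refl nn_integral_count_space_nn_integral F) auto
    finally show "(\<integral>\<^sup>+\<omega>. (\<Sum>i\<in>UNIV. \<integral>\<^sup>+m. F p i m \<omega> \<partial>count_space UNIV) \<partial>M)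
      = (\<Sum>i\<in>UNIV. \<integral>\<^sup>+m. \<integral>\<^sup>+\<omega>. F p i m \<omega> \<partial>M \<partial>count_space UNIV)" .
  qed
  also have "\<dots> = (\<integral>\<^sup>+p. (\<Sum>i\<in>UNIV. offspring_mean i (label_type (j, k, p)) *
      delay_mean i (label_type (j, k, p)) (indicator {a<..}) * expected_weight (\<lambda>_. 1) j k p) \<partial>count_space UNIV)"
    using sum_expected_children[of "\<lambda>_. 1" "indicator {a<..}" j k]
    unfolding path_weight_1 mult_1_left F_def by simp
  finally show ?thesis .
qed

text \<open>Without long delays the truncation is never active, and the exponents along the
  ancestral line add up.\<close>

lemma no_long_delay_weight:
  assumes "is_born nchild \<omega> (j, k, p)" "long_delay_total a j k \<omega> < 1"
  shows "path_weight (\<lambda>x. ennreal (exp (\<theta> * x)) * indicator {..a} x) \<omega> (j, k, p)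
    = ennreal (exp (\<theta> * (birth_time gap delay \<omega> (j, k, p) - arrival_time gap j k \<omega>)))"
  using assms(1)
proof (induction p)
  case (Cons x p)
  obtain i m where x: "x = (i, m)" by (cases x)
  have "delay (j, k, p) i m \<omega> \<le> a"
  proof (rule ccontr)
    assume "\<not> ?thesis"
    then have "1 = (if is_born nchild \<omega> (j, k, (i, m) # p) then indicator {a<..} (delay (j, k, p) i m \<omega>) else 0 :: ennreal)"
      using Cons.prems x by simp
    also have "\<dots> \<le> (\<integral>\<^sup>+m. (if is_born nchild \<omega> (j, k, (i, m) # p)
      then indicator {a<..} (delay (j, k, p) i m \<omega>) else 0) \<partial>count_space UNIV)"
      by (rule nn_integral_ge_point) simp
    also have "\<dots> \<le> (\<Sum>i\<in>UNIV. \<integral>\<^sup>+m. (if is_born nchild \<omega> (j, k, (i, m) # p)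
      then indicator {a<..} (delay (j, k, p) i m \<omega>) else 0) \<partial>count_space UNIV)"
      by (rule member_le_sum) auto
    also have "\<dots> \<le> long_delay_total a j k \<omega>"
      unfolding long_delay_total_def by (rule nn_integral_ge_point) simp
    finally show False using assms(2) by simp
  qed
  then show ?case
    using Cons x by (simp add: distrib_left algebra_simps flip: ennreal_mult exp_add)
qed simp

text \<open>A pointwise inequality made for Markov: if no delay in the cluster is long, a single
  late member already contributes at least exp (\<theta> * e) to \<open>path_total\<close>;
  otherwise \<open>long_delay_total\<close> is at least 1.\<close>

lemma late_imp_total_ge_1:
  assumes born: "is_born nchild \<omega> (j, k, p)" and \<theta>: "0 \<le> \<theta>"
    and late: "arrival_time gap j k \<omega> + e < birth_time gap delay \<omega> (j, k, p)"
  shows "1 \<le> ennreal (exp (- \<theta> * e)) * path_total (\<lambda>x. ennreal (exp (\<theta> * x)) * indicator {..a} x) j k \<omega>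
    + long_delay_total a j k \<omega>"
proof (cases "long_delay_total a j k \<omega> < 1")
  case True
  let ?w = "\<lambda>x. ennreal (exp (\<theta> * x)) * indicator {..a} x"
  have "1 = ennreal (exp (- \<theta> * e)) * ennreal (exp (\<theta> * e))"
    by (simp flip: ennreal_mult exp_add)
  also have "ennreal (exp (\<theta> * e)) \<le> path_weight ?w \<omega> (j, k, p)"
    unfolding no_long_delay_weight[OF born True] using late \<theta>
    by (intro ennreal_leI) (auto intro!: mult_left_mono)
  also have "\<dots> \<le> path_total ?w j k \<omega>"
    unfolding path_total_def
    using nn_integral_ge_point[of p UNIV "\<lambda>p. if is_born nchild \<omega> (j, k, p) then path_weight ?w \<omega> (j, k, p) else 0"] born
    by simp
  finally show ?thesis by (simp add: mult_left_mono add_increasing2)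
qed (simp add: add_increasing not_less)

text \<open>An extended-valued count, since clusters are finite only almost surely and
  \<open>card\<close> would turn an infinite cluster into size 0.\<close>

definition cluster_count :: "'d \<Rightarrow> nat \<Rightarrow> 'a \<Rightarrow> ennreal" where
  "cluster_count j k \<omega> = (\<integral>\<^sup>+p. (if is_born nchild \<omega> (j, k, p) then 1 else 0) \<partial>count_space UNIV)"

lemma cluster_count_eq_path_total: "cluster_count j k = path_total (\<lambda>_. 1) j k"
  by (rule ext) (simp add: cluster_count_def path_total_def cong: if_cong)

lemma cluster_count_eq_emeasure:
  "cluster_count j k \<omega> = emeasure (count_space UNIV) {p. is_born nchild \<omega> (j, k, p)}"
proof -
  have "cluster_count j k \<omega> = (\<integral>\<^sup>+p. indicator {p. is_born nchild \<omega> (j, k, p)} p \<partial>count_space UNIV)"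
    unfolding cluster_count_def by (intro nn_integral_cong) (auto split: split_indicator)
  then show ?thesis by simp
qed

lemma cluster_count_measurable_noise:
  "{Offspring (j, k, q) i | q i. True} \<subseteq> I \<Longrightarrow> cluster_count j k \<in> borel_measurable (noise_sigma I)"
proof -
  assume I: "{Offspring (j, k, q) i | q i. True} \<subseteq> I"
  have [measurable]: "(\<lambda>\<omega>. is_born nchild \<omega> (j, k, p)) \<in> measurable (noise_sigma I) (count_space UNIV)" for p
    using I by (intro is_born_measurable_noise) auto
  show ?thesis
    unfolding cluster_count_def[abs_def] by (rule borel_measurable_nn_integral_count_space) measurable
qed

lemma cluster_count_measurable [measurable]: "cluster_count j k \<in> borel_measurable M"
  using measurable_noise_sigma_imp[OF cluster_count_measurable_noise[OF order_refl]] .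

text \<open>Markov's inequality for the product over the blocks of \<open>1 + 1 / p\<close> if the block is large and of 1
  otherwise; each factor has mean at most 2.\<close>

lemma prob_many_large_blocks:
  assumes C: "\<And>k. (\<integral>\<^sup>+\<omega>. cluster_count j k \<omega> \<partial>M) \<le> ennreal C" "0 \<le> C"
    and x: "0 < x" and p: "real b * C / x \<le> p" "0 < p" "p \<le> 1"
  shows "prob {\<omega>\<in>space M. r < card {q. q < Q \<and> ennreal x < (\<Sum>k=q * b..<q * b + b. cluster_count j k \<omega>)}} \<le> 2 ^ Q * p ^ r"
proof -
  define W where "W q \<omega> = (\<Sum>k=q * b..<q * b + b. cluster_count j k \<omega>)" for q \<omega>
  define Y where "Y q \<omega> = (if ennreal x < W q \<omega> then ennreal (1 + 1 / p) else 1)" for q \<omega>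
  define I where "I q = {Offspring (j, k, p) i | k p i. q * b \<le> k \<and> k < q * b + b}" for q
  have Wn: "W q \<in> borel_measurable (noise_sigma (I q))" for q
    unfolding W_def[abs_def]
    by (intro borel_measurable_sum cluster_count_measurable_noise) (auto simp: I_def)
  have W [measurable]: "W q \<in> borel_measurable M" for q
    using measurable_noise_sigma_imp[OF Wn] .
  have Yn: "Y q \<in> borel_measurable (noise_sigma (I q))" for q
    unfolding Y_def[abs_def] using Wn[of q] by measurable
  have Y [measurable]: "Y q \<in> borel_measurable M" for q
    using measurable_noise_sigma_imp[OF Yn] .
  have EY: "(\<integral>\<^sup>+\<omega>. Y q \<omega> \<partial>M) \<le> 2" for q
  proof -
    let ?A = "{\<omega>\<in>space M. 1 \<le> ennreal (1 / x) * W q \<omega>}"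
    have "emeasure M ?A \<le> ennreal (1 / x) * (\<integral>\<^sup>+\<omega>. W q \<omega> * indicator (space M) \<omega> \<partial>M)"
      by (rule nn_integral_Markov_inequality) auto
    also have "(\<integral>\<^sup>+\<omega>. W q \<omega> * indicator (space M) \<omega> \<partial>M) = (\<integral>\<^sup>+\<omega>. W q \<omega> \<partial>M)"
      by (intro nn_integral_cong) auto
    also have "\<dots> \<le> (\<Sum>k=q * b..<q * b + b. ennreal C)"
      unfolding W_def by (subst nn_integral_sum, simp, intro sum_mono C)
    also have "\<dots> = ennreal (real b * C)"
      using C by (simp add: ennreal_mult ennreal_of_nat_eq_real_of_nat)
    also have "ennreal (1 / x) * ennreal (real b * C) = ennreal (real b * C / x)"
      using x C by (simp flip: ennreal_mult)
    also have "\<dots> \<le> ennreal p" using p by (intro ennreal_leI)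
    finally have A: "emeasure M ?A \<le> ennreal p" by (simp add: mult_left_mono)
    have "(\<integral>\<^sup>+\<omega>. Y q \<omega> \<partial>M) \<le> (\<integral>\<^sup>+\<omega>. 1 + ennreal (1 / p) * indicator ?A \<omega> \<partial>M)"
    proof (rule nn_integral_mono)
      fix \<omega> assume \<omega>: "\<omega> \<in> space M"
      have "1 \<le> ennreal (1 / x) * W q \<omega>" if "ennreal x < W q \<omega>"
      proof -
        have "1 = ennreal (1 / x) * ennreal x" using x by (simp flip: ennreal_mult)
        also have "\<dots> \<le> ennreal (1 / x) * W q \<omega>" using that by (intro mult_left_mono) auto
        finally show ?thesis .
      qed
      then show "Y q \<omega> \<le> 1 + ennreal (1 / p) * indicator ?A \<omega>"
        using \<omega> p by (auto simp: Y_def ennreal_plus split: split_indicator)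
    qed
    also have "\<dots> = 1 + ennreal (1 / p) * emeasure M ?A"
      by (simp add: nn_integral_add nn_integral_cmult emeasure_space_1)
    also have "\<dots> \<le> 1 + ennreal (1 / p) * ennreal p"
      using A by (intro add_mono mult_left_mono) auto
    also have "\<dots> = 2" using p by (simp flip: ennreal_mult)
    finally show ?thesis .
  qed
  let ?E = "{\<omega>\<in>space M. r < card {q. q < Q \<and> ennreal x < W q \<omega>}}"
  have "emeasure M ?E \<le> emeasure M {\<omega>\<in>space M. 1 \<le> ennreal (p ^ r) * (\<Prod>q<Q. Y q \<omega>)}"
  proof (rule emeasure_mono)
    show "?E \<subseteq> {\<omega>\<in>space M. 1 \<le> ennreal (p ^ r) * (\<Prod>q<Q. Y q \<omega>)}"
    proof safe
      fix \<omega> assume r: "r < card {q. q < Q \<and> ennreal x < W q \<omega>}"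
      \<comment> \<open>More than r factors of the product exceed 1 / p, which compensates p ^ r;
        the other factors are 1.\<close>
      define N where "N = card {q. q < Q \<and> ennreal x < W q \<omega>}"
      have "1 = ennreal (p ^ r * (1 / p) ^ r)" using p by (simp add: power_one_over)
      also have "\<dots> \<le> ennreal (p ^ r * (1 / p) ^ N)"
        using p r by (intro ennreal_leI mult_left_mono power_increasing) (auto simp: N_def)
      also have "\<dots> = ennreal (p ^ r) * ennreal (1 / p) ^ N"
        using p by (simp add: ennreal_mult ennreal_power)
      also have "\<dots> \<le> ennreal (p ^ r) * ennreal (1 + 1 / p) ^ N"
        by (intro mult_left_mono power_mono_ennreal ennreal_leI) auto
      also have "ennreal (1 + 1 / p) ^ N = (\<Prod>q\<in>{q. q < Q \<and> ennreal x < W q \<omega>}. ennreal (1 + 1 / p))"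
        by (simp add: N_def)
      also have "\<dots> = (\<Prod>q<Q. Y q \<omega>)"
        by (intro prod.mono_neutral_cong_left) (auto simp: Y_def)
      finally show "1 \<le> ennreal (p ^ r) * (\<Prod>q<Q. Y q \<omega>)" .
    qed
  qed measurable
  also have "\<dots> \<le> ennreal (p ^ r) * (\<integral>\<^sup>+\<omega>. (\<Prod>q<Q. Y q \<omega>) * indicator (space M) \<omega> \<partial>M)"
    by (rule nn_integral_Markov_inequality) auto
  also have "(\<integral>\<^sup>+\<omega>. (\<Prod>q<Q. Y q \<omega>) * indicator (space M) \<omega> \<partial>M) = (\<integral>\<^sup>+\<omega>. (\<Prod>q<Q. Y q \<omega>) \<partial>M)"
    by (intro nn_integral_cong) auto
  also have "\<dots> = (\<Prod>q<Q. \<integral>\<^sup>+\<omega>. Y q \<omega> \<partial>M)"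
  proof (rule nn_integral_prod_noise[where I = I])
    show "disjoint_family_on I {..<Q}"
    proof (unfold disjoint_family_on_def, intro ballI impI)
      fix q q' :: nat assume "q \<noteq> q'"
      have "q * b + b \<le> q' * b \<or> q' * b + b \<le> q * b"
      proof (cases "q < q'")
        case True
        then have "Suc q * b \<le> q' * b" by (intro mult_right_mono) auto
        then show ?thesis by simp
      next
        case False
        then have "Suc q' * b \<le> q * b" using \<open>q \<noteq> q'\<close> by (intro mult_right_mono) auto
        then show ?thesis by simp
      qed
      then show "I q \<inter> I q' = {}" by (auto simp: I_def)
    qed
  qed (use Yn in auto)
  also have "\<dots> \<le> (\<Prod>q<Q. 2)" by (intro prod_mono_ennreal EY)
  also have "ennreal (p ^ r) * (\<Prod>q<Q. 2) = ennreal (2 ^ Q * p ^ r)"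
    using p by (simp add: ennreal_mult ennreal_power[symmetric] mult.commute)
  finally have "emeasure M ?E \<le> ennreal (2 ^ Q * p ^ r)" by (simp add: mult_left_mono)
  then show ?thesis
    using p by (simp add: W_def emeasure_eq_measure ennreal_le_iff)
qed

section \<open>Chernoff bounds for block durations\<close>

lemma nn_integral_exp_sum_gap:
  assumes "finite B" "\<theta> < 1"
  shows "(\<integral>\<^sup>+\<omega>. ennreal (exp (\<theta> * c j * (\<Sum>k\<in>B. gap j k \<omega>))) \<partial>M) = ennreal ((1 / (1 - \<theta>)) ^ card B)"
proof -
  have "(\<integral>\<^sup>+\<omega>. ennreal (exp (\<theta> * c j * (\<Sum>k\<in>B. gap j k \<omega>))) \<partial>M)
    = (\<integral>\<^sup>+\<omega>. (\<Prod>k\<in>B. ennreal (exp (\<theta> * c j * gap j k \<omega>))) \<partial>M)"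
    using assms by (simp add: sum_distrib_left exp_sum prod_ennreal)
  also have "\<dots> = (\<Prod>k\<in>B. \<integral>\<^sup>+\<omega>. ennreal (exp (\<theta> * c j * gap j k \<omega>)) \<partial>M)"
  proof (rule nn_integral_prod_noise[where I = "\<lambda>k. {Gap j k}"])
    fix k
    have [measurable]: "gap j k \<in> borel_measurable (noise_sigma {Gap j k})"
      by (rule gap_measurable_noise) simp
    show "(\<lambda>\<omega>. ennreal (exp (\<theta> * c j * gap j k \<omega>))) \<in> borel_measurable (noise_sigma {Gap j k})"
      by measurable
  qed (use assms in \<open>auto simp: disjoint_family_on_def\<close>)
  also have "\<dots> = ennreal ((1 / (1 - \<theta>)) ^ card B)"
    using assms by (simp add: nn_integral_exp_gap ennreal_power)
  finally show ?thesis .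
qed

text \<open>The factor \<theta> is kept on both sides of the event, so that positive \<theta> gives
  upper tails and negative \<theta> lower tails.\<close>

lemma prob_sum_gap_chernoff:
  assumes B: "finite B" and \<theta>: "\<theta> < 1"
  shows "prob {\<omega>\<in>space M. \<theta> * c j * y \<le> \<theta> * c j * (\<Sum>k\<in>B. gap j k \<omega>)}
    \<le> exp (- \<theta> * c j * y) * (1 / (1 - \<theta>)) ^ card B"
proof -
  let ?X = "\<lambda>\<omega>. ennreal (exp (\<theta> * c j * (\<Sum>k\<in>B. gap j k \<omega>)))"
  have "emeasure M {\<omega>\<in>space M. \<theta> * c j * y \<le> \<theta> * c j * (\<Sum>k\<in>B. gap j k \<omega>)}
    = emeasure M {\<omega>\<in>space M. 1 \<le> ennreal (exp (- \<theta> * c j * y)) * ?X \<omega>}"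
    by (intro arg_cong[where f = "emeasure M"] Collect_cong conj_cong refl)
      (simp flip: ennreal_mult exp_add ennreal_1)
  also have "\<dots> \<le> ennreal (exp (- \<theta> * c j * y)) * (\<integral>\<^sup>+\<omega>. ?X \<omega> * indicator (space M) \<omega> \<partial>M)"
    by (rule nn_integral_Markov_inequality) auto
  also have "(\<integral>\<^sup>+\<omega>. ?X \<omega> * indicator (space M) \<omega> \<partial>M) = (\<integral>\<^sup>+\<omega>. ?X \<omega> \<partial>M)"
    by (intro nn_integral_cong) auto
  also have "\<dots> = ennreal ((1 / (1 - \<theta>)) ^ card B)"
    by (rule nn_integral_exp_sum_gap[OF B \<theta>])
  also have "ennreal (exp (- \<theta> * c j * y)) * \<dots> = ennreal (exp (- \<theta> * c j * y) * (1 / (1 - \<theta>)) ^ card B)"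
    using \<theta> by (simp add: ennreal_mult)
  finally show ?thesis
    using \<theta> by (simp add: emeasure_eq_measure ennreal_le_iff)
qed

text \<open>The mean duration of a block of about \<open>4 * c j * y\<close> immigrants is \<open>4 * y\<close>. The Chernoff bounds use the
  exponents \<open>- c j\<close> and \<open>c j / 2\<close>, whose moment generating functions are 1/2 and 2.\<close>

lemma prob_block_duration:
  assumes B: "finite B" and y: "c j * y \<le> real (card B) / 4" "4 * real (card B) \<le> 17 * c j * y"
  shows "prob {\<omega>\<in>space M. \<not> (y \<le> (\<Sum>k\<in>B. gap j k \<omega>) \<and> (\<Sum>k\<in>B. gap j k \<omega>) \<le> 17 * y)} \<le> 2 * (2 / 3) ^ card B"
proof -
  let ?S = "\<lambda>\<omega>. \<Sum>k\<in>B. gap j k \<omega>" and ?b = "card B"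
  note cj = c_pos[of j]
  have "prob {\<omega>\<in>space M. (-1) * c j * y \<le> (-1) * c j * ?S \<omega>} \<le> exp (- (-1) * c j * y) * (1 / (1 - (-1))) ^ ?b"
    by (rule prob_sum_gap_chernoff[OF B]) simp
  also have "\<dots> \<le> exp (real ?b / 4) * (1 / 2) ^ ?b" using y by simp
  also have "\<dots> = (exp (1 / 4) / 2) ^ ?b" by (simp add: power_divide flip: exp_of_nat_mult)
  also have "\<dots> \<le> (2 / 3) ^ ?b"
  proof (rule power_mono)
    have "exp (1 / 4 :: real) \<le> 1 + 1 / 4 + (1 / 4)\<^sup>2" by (rule exp_bound) auto
    then show "exp (1 / 4) / 2 \<le> (2 / 3 :: real)" by (simp add: power2_eq_square)
  qed simp
  finally have 1: "prob {\<omega>\<in>space M. (-1) * c j * y \<le> (-1) * c j * ?S \<omega>} \<le> (2 / 3) ^ ?b" .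
  have "prob {\<omega>\<in>space M. (1 / 2) * c j * (17 * y) \<le> (1 / 2) * c j * ?S \<omega>}
    \<le> exp (- (1 / 2) * c j * (17 * y)) * (1 / (1 - (1 / 2))) ^ ?b"
    by (rule prob_sum_gap_chernoff[OF B]) simp
  \<comment> \<open>By 17 * c j * y \<ge> 4 * card B, the exponent - (17 / 2) * c j * y is at most
    -2 per member of the block.\<close>
  also have "\<dots> \<le> exp (real ?b * (-2)) * 2 ^ ?b" using y by simp
  also have "\<dots> = (exp (-2) * 2) ^ ?b" by (simp add: power_mult_distrib flip: exp_of_nat_mult)
  also have "\<dots> \<le> (2 / 3) ^ ?b"
  proof (rule power_mono)
    have "3 \<le> exp (2 :: real)" using exp_ge_add_one_self[of 2] by simp
    then show "exp (-2) * 2 \<le> (2 / 3 :: real)" by (simp add: exp_minus field_simps)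
  qed simp
  finally have 2: "prob {\<omega>\<in>space M. (1 / 2) * c j * (17 * y) \<le> (1 / 2) * c j * ?S \<omega>} \<le> (2 / 3) ^ ?b" .
  have "prob {\<omega>\<in>space M. \<not> (y \<le> ?S \<omega> \<and> ?S \<omega> \<le> 17 * y)}
    \<le> prob ({\<omega>\<in>space M. (-1) * c j * y \<le> (-1) * c j * ?S \<omega>} \<union> {\<omega>\<in>space M. (1 / 2) * c j * (17 * y) \<le> (1 / 2) * c j * ?S \<omega>})"
    using cj by (intro finite_measure_mono) auto
  also have "\<dots> \<le> prob {\<omega>\<in>space M. (-1) * c j * y \<le> (-1) * c j * ?S \<omega>}
      + prob {\<omega>\<in>space M. (1 / 2) * c j * (17 * y) \<le> (1 / 2) * c j * ?S \<omega>}"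
    by (intro measure_Un_le) measurable
  finally show ?thesis using 1 2 by linarith
qed

end

section \<open>A nonasymptotic bound\<close>

text \<open>Integrability is stated separately: the integral in the matrix is 0 for a non-integrable
  mark, so \<open>subcritical\<close> alone would not control its mean.\<close>

locale subcritical_hawkes = hawkes_clusters M c f \<beta> gap mark nchild delay
  for M :: "'a measure"
    and c :: "'d::finite \<Rightarrow> real"
    and f :: "'d \<Rightarrow> 'd \<Rightarrow> real \<Rightarrow> real"
    and \<beta> :: "'d \<Rightarrow> 'd \<Rightarrow> real measure"
    and gap :: "'d \<Rightarrow> nat \<Rightarrow> 'a \<Rightarrow> real"
    and mark :: "'d label \<Rightarrow> 'd \<Rightarrow> 'a \<Rightarrow> real"
    and nchild :: "'d label \<Rightarrow> 'd \<Rightarrow> 'a \<Rightarrow> nat"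
    and delay :: "'d label \<Rightarrow> 'd \<Rightarrow> nat \<Rightarrow> 'a \<Rightarrow> real" +
  assumes mark_integrable: "integrable (\<beta> i l) (\<lambda>x. x)"
    and subcritical: "spectral_radius (mean_offspring_matrix f \<beta>) < 1"
begin

definition "mean_kernel i l = (\<integral>x. x \<partial>\<beta> i l) * mass (f i l)"

lemma mean_kernel_nonneg: "0 \<le> mean_kernel i l"
  unfolding mean_kernel_def
  by (intro mult_nonneg_nonneg integral_nonneg_AE mark_law_nonneg less_imp_le f_mass_pos)

lemma offspring_mean_eq: "offspring_mean i l = ennreal (mean_kernel i l)"
  unfolding offspring_mean_def
  by (subst nn_integral_eq_integral) (auto simp: mean_kernel_def mark_integrable AE_mark_rate_nonneg)

lemma generation_weight_le:
  assumes w: "w \<in> borel_measurable borel" and le: "\<And>i l. delay_mean i l w \<le> ennreal a" and a: "0 \<le> a"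
  shows "generation_weight w j k g i \<le> ennreal (a ^ g * kernel_power mean_kernel g i j)"
proof (induction g arbitrary: i)
  case 0
  then show ?case by (simp add: generation_weight_0)
next
  case (Suc g)
  have nonneg: "0 \<le> kernel_power mean_kernel g l j" for l
    by (rule kernel_power_nonneg[OF mean_kernel_nonneg])
  have "generation_weight w j k (Suc g) i
    \<le> (\<Sum>l\<in>UNIV. ennreal (mean_kernel i l) * ennreal a * ennreal (a ^ g * kernel_power mean_kernel g l j))"
    unfolding generation_weight_Suc[OF w] offspring_mean_eq
    by (intro sum_mono mult_mono le Suc order_refl) auto
  also have "\<dots> = ennreal (\<Sum>l\<in>UNIV. mean_kernel i l * a * (a ^ g * kernel_power mean_kernel g l j))"
    using a nonneg mean_kernel_nonneg
    by (simp add: ennreal_mult flip: sum_ennreal)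
  finally show ?case by (simp add: sum_distrib_left mult_ac)
qed

text \<open>The kernel powers decay like (1 / s) ^ g with s > 1. A one-step weight of mean at most a
  multiplies generation g by at most a ^ g, so any a strictly between 1 and s leaves a geometric
  series.\<close>

lemma total_expected_weight_bound:
  obtains a C where "1 < a" "0 < C"
    "\<And>w j k. w \<in> borel_measurable borel \<Longrightarrow> (\<And>i l. delay_mean i l w \<le> ennreal a) \<Longrightarrow>
      (\<integral>\<^sup>+p. expected_weight w j k p \<partial>count_space UNIV) \<le> ennreal C"
proof -
  have sr: "spectral_radius (Matrix.mat CARD('d) CARD('d)
    (\<lambda>(a, b). complex_of_real (mean_kernel (from_nat_into UNIV a) (from_nat_into UNIV b)))) < 1"
    using subcritical by (simp add: mean_offspring_matrix_def mean_kernel_def Let_def)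
  obtain s C where s: "1 < s" and C: "\<And>g i j. s ^ g * \<bar>kernel_power mean_kernel g i j\<bar> \<le> C"
    using kernel_power_geometric_bound[OF sr] by blast
  define a where "a = (1 + s) / 2"
  have a: "1 < a" "a < s" using s by (auto simp: a_def)
  \<comment> \<open>For g = 0 and equal types the kernel is 1, hence even 1 \<le> C.\<close>
  have "0 \<le> C" using C[of 0 undefined undefined] by (simp split: if_splits)
  have kp: "a ^ g * kernel_power mean_kernel g i j \<le> C * (a / s) ^ g" for g i j
  proof -
    have "a ^ g * kernel_power mean_kernel g i j = (a / s) ^ g * (s ^ g * kernel_power mean_kernel g i j)"
      using s by (simp add: power_divide)
    also have "\<dots> \<le> (a / s) ^ g * C"
      using C[of g i j] a s by (intro mult_left_mono order_trans[OF _ C[of g i j]] mult_left_mono) auto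
    finally show ?thesis by (simp add: mult.commute)
  qed
  define C' where "C' = CARD('d) * C / (1 - a / s)"
  have "0 \<le> C'" using \<open>0 \<le> C\<close> a s by (simp add: C'_def)
  show ?thesis
  proof (rule that[OF a(1)])
    fix w j k assume w: "w \<in> borel_measurable borel" "\<And>i l. delay_mean i l w \<le> ennreal a"
    have "(\<integral>\<^sup>+p. expected_weight w j k p \<partial>count_space UNIV) \<le> ennreal C'"
      unfolding total_expected_weight C'_def
    proof (rule suminf_le_geometric)
      fix g
      have "(\<Sum>i\<in>UNIV. generation_weight w j k g i) \<le> (\<Sum>i\<in>(UNIV :: 'd set). ennreal (C * (a / s) ^ g))"
        using a by (intro sum_mono order_trans[OF generation_weight_le[OF w] ennreal_leI[OF kp]]) auto
      also have "\<dots> = ennreal (real CARD('d) * C * (a / s) ^ g)"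
        using \<open>0 \<le> C\<close> a s by (simp add: ennreal_of_nat_eq_real_of_nat mult.assoc flip: ennreal_mult)
      finally show "(\<Sum>i\<in>UNIV. generation_weight w j k g i) \<le> ennreal (real CARD('d) * C * (a / s) ^ g)" .
    qed (use \<open>0 \<le> C\<close> a s in auto)
    also have "\<dots> \<le> ennreal (C' + 1)" by (intro ennreal_leI) simp
    finally show "(\<integral>\<^sup>+p. expected_weight w j k p \<partial>count_space UNIV) \<le> ennreal (C' + 1)" .
  qed (use \<open>0 \<le> C'\<close> in simp)
qed

lemma delay_mean_1: "delay_mean i l (\<lambda>_. 1) = 1"
  using nn_integral_delay[of "\<lambda>_. 1" "(l, 0, [])" i 0] by (simp add: emeasure_space_1)

end

text \<open>The constant \<open>a\<close> is the slack left by subcriticality: path weights with one-step mean up to \<open>a > 1\<close>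
  are still summable over a cluster.\<close>

locale bounded_hawkes = subcritical_hawkes M c f \<beta> gap mark nchild delay
  for M :: "'a measure" and c :: "'d::finite \<Rightarrow> real" and f \<beta> gap mark nchild delay +
  fixes a C D :: real
  assumes a: "1 < a" and C_pos: "0 < C" and D_pos: "0 < D"
    and total_le: "w \<in> borel_measurable borel \<Longrightarrow> (\<And>i l. delay_mean i l w \<le> ennreal a) \<Longrightarrow>
      (\<integral>\<^sup>+p. expected_weight w j k p \<partial>count_space UNIV) \<le> ennreal C"
    and mean_le: "CARD('d) * mean_kernel i l * C \<le> D"
begin

lemma expected_weight_1_le: "(\<integral>\<^sup>+p. expected_weight (\<lambda>_. 1) j k p \<partial>count_space UNIV) \<le> ennreal C"
  using a by (intro total_le) (auto simp: delay_mean_1)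

lemma expected_cluster_count_le: "(\<integral>\<^sup>+\<omega>. cluster_count j k \<omega> \<partial>M) \<le> ennreal C"
  unfolding cluster_count_eq_path_total
  by (subst nn_integral_path_total) (auto intro: expected_weight_1_le)

lemma AE_finite_cluster: "AE \<omega> in M. finite {p. is_born nchild \<omega> (j, k, p)}"
proof -
  have "(\<integral>\<^sup>+\<omega>. cluster_count j k \<omega> \<partial>M) \<noteq> \<infinity>"
    using expected_cluster_count_le[of j k] by (auto simp: top_unique)
  then have "AE \<omega> in M. cluster_count j k \<omega> \<noteq> \<infinity>"
    by (intro nn_integral_noteq_infinite) auto
  then show ?thesis
    by eventually_elim (auto simp: cluster_count_eq_emeasure emeasure_count_space split: if_splits)
qed

text \<open>D bounds CARD('d) * B * C: the expected cluster size is at most C, and each member has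
  on average at most B children of each of the CARD('d) types, each with a long delay with
  probability at most \<tau>.\<close>

lemma expected_long_delay_total_le:
  assumes \<tau>: "\<And>i l. delay_mean i l (indicator {t<..}) \<le> ennreal \<tau>" "0 \<le> \<tau>"
  shows "(\<integral>\<^sup>+\<omega>. long_delay_total t j k \<omega> \<partial>M) \<le> ennreal (D * \<tau>)"
proof -
  define B where "B = D / (real CARD('d) * C)"
  have B: "mean_kernel i l \<le> B" "0 \<le> B" for i l
    using mean_le[of i l] C_pos D_pos by (auto simp: field_simps B_def)
  have "(\<integral>\<^sup>+\<omega>. long_delay_total t j k \<omega> \<partial>M)
    \<le> (\<integral>\<^sup>+p. (\<Sum>i\<in>(UNIV::'d set). ennreal B * ennreal \<tau> * expected_weight (\<lambda>_. 1) j k p) \<partial>count_space UNIV)"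
    unfolding nn_integral_long_delay_total offspring_mean_eq
    by (intro nn_integral_mono sum_mono mult_mono \<tau> ennreal_leI B) auto
  also have "\<dots> = of_nat CARD('d) * (ennreal B * ennreal \<tau>) * (\<integral>\<^sup>+p. expected_weight (\<lambda>_. 1) j k p \<partial>count_space UNIV)"
    by (simp add: nn_integral_cmult mult.assoc)
  also have "\<dots> \<le> of_nat CARD('d) * (ennreal B * ennreal \<tau>) * ennreal C"
    by (intro mult_left_mono expected_weight_1_le) auto
  also have "\<dots> = ennreal (real CARD('d) * (B * \<tau>) * C)"
    using B \<tau> C_pos by (simp add: ennreal_of_nat_eq_real_of_nat flip: ennreal_mult)
  also have  "real CARD('d) * (B * \<tau>) * C = D * \<tau>"
    using C_pos by (simp add: field_simps B_def)
  finally show ?thesis .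
qed

text \<open>The right-hand side of \<open>late_imp_total_ge_1\<close>, a measurable substitute for
  the event that some member of the cluster is late.\<close>

definition late_total :: "real \<Rightarrow> real \<Rightarrow> real \<Rightarrow> 'd \<Rightarrow> nat \<Rightarrow> 'a \<Rightarrow> ennreal" where
  "late_total \<theta> t e j k \<omega> =
    ennreal (exp (- \<theta> * e)) * path_total (\<lambda>x. ennreal (exp (\<theta> * x)) * indicator {..t} x) j k \<omega> + long_delay_total t j k \<omega>"

lemma late_total_measurable [measurable]: "late_total \<theta> t e j k \<in> borel_measurable M"
proof -
  have [measurable]: "path_total (\<lambda>x. ennreal (exp (\<theta> * x)) * indicator {..t} x) j k \<in> borel_measurable M"
    by (rule path_total_measurable) measurable
  show ?thesis unfolding late_total_def[abs_def] by measurable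
qed

lemma prob_late:
  assumes exp: "\<And>i l. delay_mean i l (\<lambda>x. ennreal (exp (\<theta> * x)) * indicator {..t} x) \<le> ennreal a"
    and \<tau>: "\<And>i l. delay_mean i l (indicator {t<..}) \<le> ennreal \<tau>" "0 \<le> \<tau>"
  shows "prob {\<omega>\<in>space M. 1 \<le> late_total \<theta> t e j k \<omega>} \<le> C * exp (- \<theta> * e) + D * \<tau>"
proof -
  have [measurable]: "path_total (\<lambda>x. ennreal (exp (\<theta> * x)) * indicator {..t} x) j k \<in> borel_measurable M"
    by (rule path_total_measurable) measurable
  have "emeasure M {\<omega>\<in>space M. 1 \<le> 1 * late_total \<theta> t e j k \<omega>}
    \<le> 1 * (\<integral>\<^sup>+\<omega>. late_total \<theta> t e j k \<omega> * indicator (space M) \<omega> \<partial>M)"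
    by (rule nn_integral_Markov_inequality) auto
  also have "\<dots> = (\<integral>\<^sup>+\<omega>. late_total \<theta> t e j k \<omega> \<partial>M)"
    unfolding mult_1_left by (intro nn_integral_cong) auto
  also have "\<dots> = ennreal (exp (- \<theta> * e)) * (\<integral>\<^sup>+\<omega>. path_total (\<lambda>x. ennreal (exp (\<theta> * x)) * indicator {..t} x) j k \<omega> \<partial>M)
    + (\<integral>\<^sup>+\<omega>. long_delay_total t j k \<omega> \<partial>M)"
    unfolding late_total_def by (simp add: nn_integral_add nn_integral_cmult)
  also have "\<dots> \<le> ennreal (exp (- \<theta> * e)) * ennreal C + ennreal (D * \<tau>)"
    by (intro add_mono mult_left_mono expected_long_delay_total_le \<tau>)
      (auto simp: nn_integral_path_total intro!: total_le exp)
  also have "\<dots> = ennreal (C * exp (- \<theta> * e) + D * \<tau>)"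
    using C_pos D_pos \<tau> by (simp add: ennreal_plus mult.commute flip: ennreal_mult)
  finally have "ennreal (prob {\<omega>\<in>space M. 1 \<le> late_total \<theta> t e j k \<omega>}) \<le> ennreal (C * exp (- \<theta> * e) + D * \<tau>)"
    by (simp only: mult_1_left emeasure_eq_measure)
  then show ?thesis
    by (rule ennreal_le_iff[THEN iffD1, rotated]) (use C_pos D_pos \<tau> in simp)
qed

lemma outer_prob_le:
  assumes "A \<in> events" "E \<subseteq> A" shows "outer_prob M E \<le> prob A"
  unfolding outer_prob_def using assms by (intro cInf_lower) (auto intro!: bdd_belowI[of _ 0])

text \<open>The three summands belong to three kinds of failure: \<open>A1\<close>, a block of
  atypical duration; \<open>A2\<close>, a cluster with a late member; \<open>A3\<close>, too many
  large blocks. Off these measurable events and a null set the sample is good, so together they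
  cover the event about the distance.\<close>

lemma outer_prob_dist_le:
  fixes n Q r :: nat and b :: "'d \<Rightarrow> nat" and \<epsilon> \<eta> \<theta> K t \<tau> p \<Delta> :: real
  assumes n: "0 < n" and eps: "0 < \<epsilon>" and eta: "0 < \<eta>" and \<theta>: "0 \<le> \<theta>"
    and b1: "\<And>j. c j * (\<epsilon> * n) \<le> real (b j) / 4" and b2: "\<And>j. 4 * real (b j) \<le> 17 * c j * (\<epsilon> * n)"
    and Q: "K \<le> Q * \<epsilon>"
    and exp: "\<And>i l. delay_mean i l (\<lambda>x. ennreal (exp (\<theta> * x)) * indicator {..t} x) \<le> ennreal a"
    and \<tau>: "\<And>i l. delay_mean i l (indicator {t<..}) \<le> ennreal \<tau>" "0 \<le> \<tau>"
    and p: "\<And>j. real (b j) * C / (\<eta> * n) \<le> p" "0 < p" "p \<le> 1"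
    and \<Delta>: "max \<epsilon> (real CARD('d) * (2 * \<eta>)) + CARD('d) * r * 18 * \<epsilon> + exp (- K) \<le> \<Delta>"
  shows "outer_prob M {\<omega> \<in> space M. dist_P_infinity (rescaled n (hawkes gap nchild delay \<omega>))
        (rescaled n (coupled_process gap nchild \<omega>)) > \<Delta>}
    \<le> (\<Sum>j\<in>UNIV. Q * (2 * (2 / 3) ^ b j) + Q * b j * (C * exp (- \<theta> * (\<epsilon> * n)) + D * \<tau>) + 2 ^ Q * p ^ r)"
proof -
  let ?S = "\<lambda>j q \<omega>. \<Sum>k=q * b j..<q * b j + b j. gap j k \<omega>"
  define A1 where "A1 j = (\<Union>q<Q. {\<omega>\<in>space M. \<not> (\<epsilon> * n \<le> ?S j q \<omega> \<and> ?S j q \<omega> \<le> 17 * (\<epsilon> * n))})" for j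
  define A2 where "A2 j = (\<Union>k<Q * b j. {\<omega>\<in>space M. 1 \<le> late_total \<theta> t (\<epsilon> * n) j k \<omega>})" for j
  define A3 where "A3 j = {\<omega>\<in>space M. r < card {q. q < Q \<and> ennreal (\<eta> * n) < (\<Sum>k=q * b j..<q * b j + b j. cluster_count j k \<omega>)}}" for j
  have "AE \<omega> in M. (\<forall>j k. 0 < gap j k \<omega>) \<and> (\<forall>u i m. 0 \<le> delay u i m \<omega>) \<and> (\<forall>j k. finite {p. is_born nchild \<omega> (j, k, p)})"
    using AE_gap_pos AE_delay_nonneg AE_finite_cluster by (simp add: AE_all_countable)
  then obtain N where N: "{\<omega>\<in>space M. \<not> ((\<forall>j k. 0 < gap j k \<omega>) \<and> (\<forall>u i m. 0 \<le> delay u i m \<omega>)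
      \<and> (\<forall>j k. finite {p. is_born nchild \<omega> (j, k, p)}))} \<subseteq> N" "emeasure M N = 0" "N \<in> events"
    by (rule AE_E)
  have A1m [measurable]: "A1 j \<in> events" for j unfolding A1_def by measurable
  have A2m [measurable]: "A2 j \<in> events" for j unfolding A2_def by measurable
  have A3m [measurable]: "A3 j \<in> events" for j unfolding A3_def by measurable
  have P1: "prob (A1 j) \<le> Q * (2 * (2 / 3) ^ b j)" for j
  proof -
    have "prob (A1 j) \<le> (\<Sum>q<Q. prob {\<omega>\<in>space M. \<not> (\<epsilon> * n \<le> ?S j q \<omega> \<and> ?S j q \<omega> \<le> 17 * (\<epsilon> * n))})"
      unfolding A1_def by (intro finite_measure_subadditive_finite) auto
    also have "\<dots> \<le> (\<Sum>q<Q. 2 * (2 / 3) ^ b j)"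
    proof (rule sum_mono)
      fix q
      show "prob {\<omega>\<in>space M. \<not> (\<epsilon> * n \<le> ?S j q \<omega> \<and> ?S j q \<omega> \<le> 17 * (\<epsilon> * n))} \<le> 2 * (2 / 3) ^ b j"
        using prob_block_duration[of "{q * b j..<q * b j + b j}" j "\<epsilon> * n"] b1 b2 by simp
    qed
    finally show ?thesis by simp
  qed
  have P2: "prob (A2 j) \<le> Q * b j * (C * exp (- \<theta> * (\<epsilon> * n)) + D * \<tau>)" for j
  proof -
    have "prob (A2 j) \<le> (\<Sum>k<Q * b j. prob {\<omega>\<in>space M. 1 \<le> late_total \<theta> t (\<epsilon> * n) j k \<omega>})"
      unfolding A2_def by (intro finite_measure_subadditive_finite) auto
    also have "\<dots> \<le> (\<Sum>k<Q * b j. C * exp (- \<theta> * (\<epsilon> * n)) + D * \<tau>)"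
      by (intro sum_mono prob_late exp \<tau>)
    finally show ?thesis by simp
  qed
  have P3: "prob (A3 j) \<le> 2 ^ Q * p ^ r" for j
    unfolding A3_def
    by (rule prob_many_large_blocks[where C = C]) (use expected_cluster_count_le C_pos eta n p in auto)
  define A where "A = N \<union> (\<Union>j. A1 j \<union> A2 j \<union> A3 j)"
  have Am: "A \<in> events" unfolding A_def using N by measurable
  have "{\<omega> \<in> space M. dist_P_infinity (rescaled n (hawkes gap nchild delay \<omega>))
        (rescaled n (coupled_process gap nchild \<omega>)) > \<Delta>} \<subseteq> A"
  proof (rule subsetI, rule ccontr)
    fix \<omega> assume \<omega>: "\<omega> \<in> {\<omega> \<in> space M. dist_P_infinity (rescaled n (hawkes gap nchild delay \<omega>))
        (rescaled n (coupled_process gap nchild \<omega>)) > \<Delta>}" "\<omega> \<notin> A"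
    have sp: "\<omega> \<in> space M" using \<omega> by simp
    have nN: "\<omega> \<notin> N" and n1: "\<omega> \<notin> A1 j" and n2: "\<omega> \<notin> A2 j" and n3: "\<omega> \<notin> A3 j" for j
      using \<omega> by (auto simp: A_def)
    have ae: "\<And>j k. 0 < gap j k \<omega>" "\<And>u i m. 0 \<le> delay u i m \<omega>" "\<And>j k. finite {p. is_born nchild \<omega> (j, k, p)}"
      using N(1) nN sp by blast+
    have cc: "cluster_count j k \<omega> = ennreal (real (card {p. is_born nchild \<omega> (j, k, p)}))" for j k
      using ae(3)[of j k] by (simp add: cluster_count_eq_emeasure ennreal_of_nat_eq_real_of_nat)
    have "good_sample gap nchild delay \<omega> n \<epsilon> \<eta> K Q r b"
    proof
      fix j q assume "q < Q"
      then have "\<epsilon> * n \<le> ?S j q \<omega> \<and> ?S j q \<omega> \<le> 17 * (\<epsilon> * n)"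
        using n1[of j] sp by (auto simp: A1_def)
      then show "\<epsilon> * n \<le> ?S j q \<omega>" "?S j q \<omega> \<le> 17 * \<epsilon> * n" by auto
    next
      fix j k p assume kp: "k < Q * b j" "is_born nchild \<omega> (j, k, p)"
      have "\<not> 1 \<le> late_total \<theta> t (\<epsilon> * n) j k \<omega>"
        using n2[of j] kp sp by (auto simp: A2_def)
      then show "birth_time gap delay \<omega> (j, k, p) \<le> arrival_time gap j k \<omega> + \<epsilon> * n"
        using late_imp_total_ge_1[OF kp(2) \<theta>, of "\<epsilon> * n" t] unfolding late_total_def by force
    next
      fix j
      have "(ennreal (\<eta> * n) < (\<Sum>k=q * b j..<q * b j + b j. cluster_count j k \<omega>))
        = (\<eta> * n < (\<Sum>k=q * b j..<q * b j + b j. real (card {p. is_born nchild \<omega> (j, k, p)})))" for q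
        unfolding cc using eta by (subst sum_ennreal) (simp_all only: of_nat_0_le_iff ennreal_less_iff mult_nonneg_nonneg less_imp_le)
      then show "card {q. q < Q \<and> \<eta> * n < (\<Sum>k=q * b j..<q * b j + b j. real (card {p. is_born nchild \<omega> (j, k, p)}))} \<le> r"
        using n3[of j] sp by (simp only: A3_def mem_Collect_eq not_less simp_thms)
    qed (use n eps eta Q ae in auto)
    from good_sample.dist_le[OF this] \<Delta> \<omega>(1) show False by simp
  qed
  then have "outer_prob M {\<omega> \<in> space M. dist_P_infinity (rescaled n (hawkes gap nchild delay \<omega>))
        (rescaled n (coupled_process gap nchild \<omega>)) > \<Delta>} \<le> prob A"
    by (rule outer_prob_le[OF Am])
  also have "\<dots> \<le> prob N + prob (\<Union>j. A1 j \<union> A2 j \<union> A3 j)"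
    unfolding A_def using N(3) by (intro measure_Un_le sets.finite_UN sets.Un A1m A2m A3m) auto
  also have "prob N = 0" using N(2) by (simp add: measure_def)
  also have "prob (\<Union>j. A1 j \<union> A2 j \<union> A3 j) \<le> (\<Sum>j\<in>UNIV. prob (A1 j \<union> A2 j \<union> A3 j))"
    by (intro finite_measure_subadditive_finite) auto
  also have "\<dots> \<le> (\<Sum>j\<in>UNIV. prob (A1 j) + prob (A2 j) + prob (A3 j))"
    by (intro sum_mono order_trans[OF measure_Un_le] add_mono measure_Un_le order_refl) measurable
  also have "\<dots> \<le> (\<Sum>j\<in>UNIV. Q * (2 * (2 / 3) ^ b j) + Q * b j * (C * exp (- \<theta> * (\<epsilon> * n)) + D * \<tau>) + 2 ^ Q * p ^ r)"
    by (intro sum_mono add_mono P1 P2 P3)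
  finally show ?thesis by simp
qed

end

section \<open>Polynomial bounds for the rate\<close>

text \<open>The limit at t = 2 gives \<phi> (2 * x) \<ge> q * \<phi> x for large x, with q half that
  limit. Iterating along Y, 2 Y, 4 Y, ... costs a factor q per doubling, that is, a power of x;
  monotonicity covers the points in between.\<close>

lemma regularly_varying_lower_bound:
  assumes rv: "regularly_varying (- \<rho>) \<phi>" and anti: "\<And>x y. x \<le> y \<Longrightarrow> \<phi> y \<le> \<phi> x"
    and nonneg: "\<And>x. 0 \<le> \<phi> x"
  shows "\<exists>c>0. \<exists>\<kappa>. \<forall>\<^sub>F x in at_top. c * x powr (- \<kappa>) \<le> \<phi> x"
proof -
  have "((\<lambda>x. \<phi> (2 * x) / \<phi> x) \<longlongrightarrow> 2 powr (- \<rho>)) at_top"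
    using rv by (simp add: regularly_varying_def)
  moreover define q where "q = (2::real) powr (- \<rho>) / 2"
  ultimately have "\<forall>\<^sub>F x in at_top. q < \<phi> (2 * x) / \<phi> x"
    by (intro order_tendstoD) (auto simp: q_def)
  then obtain X where X: "\<And>x. X \<le> x \<Longrightarrow> q < \<phi> (2 * x) / \<phi> x"
    by (auto simp: eventually_at_top_linorder)
  define Y where "Y = max X 1"
  have q: "0 < q" by (simp add: q_def)
  \<comment> \<open>If \<phi> x were 0, the quotient would be 0, the value of a division by 0, and
    not above q.\<close>
  have pos: "0 < \<phi> x" if "Y \<le> x" for x
    using X[of x] that nonneg[of x] q by (cases "\<phi> x = 0") (auto simp: Y_def less_le)
  have step: "q * \<phi> x \<le> \<phi> (2 * x)" if "Y \<le> x" for x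
    using X[of x] that pos[OF that] by (auto simp: Y_def field_simps)
  have iter: "q ^ m * \<phi> Y \<le> \<phi> (2 ^ m * Y)" for m
  proof (induction m)
    case (Suc m)
    have "q ^ Suc m * \<phi> Y \<le> q * \<phi> (2 ^ m * Y)"
      using Suc q by (simp add: mult.assoc)
    also have "\<dots> \<le> \<phi> (2 * (2 ^ m * Y))"
      by (rule step) (auto simp: Y_def intro: order_trans[OF _ mult_right_mono[of 1]])
    finally show ?case by (simp add: mult.assoc)
  qed simp
  \<comment> \<open>Capping q at 1 makes its powers decrease in the exponent, so that m may be
    replaced by its upper bound log 2 (x / Y) + 1.\<close>
  define q' where "q' = min q 1"
  have q': "0 < q'" "q' \<le> 1" "q' \<le> q" using q by (auto simp: q'_def)
  define \<kappa> where "\<kappa> = - log 2 q'"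
  have bound: "q' * Y powr \<kappa> * \<phi> Y * x powr (- \<kappa>) \<le> \<phi> x" if x: "Y \<le> x" for x
  proof -
    have Y: "1 \<le> Y" by (simp add: Y_def)
    define m where "m = nat \<lceil>log 2 (x / Y)\<rceil>"
    have lg: "0 \<le> log 2 (x / Y)" using x Y by (simp add: field_simps)
    then have m: "log 2 (x / Y) \<le> m" "m \<le> log 2 (x / Y) + 1"
      by (auto simp: m_def)
    have "x / Y = 2 powr (log 2 (x / Y))" using x Y by simp
    also have "\<dots> \<le> 2 powr m" using m by simp
    finally have "x \<le> 2 ^ m * Y" using Y by (simp add: field_simps powr_realpow)
    then have "\<phi> (2 ^ m * Y) \<le> \<phi> x" by (rule anti)
    moreover have "q' powr (log 2 (x / Y) + 1) \<le> q' powr m"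
      using q' m by (intro powr_mono') auto
    moreover have "q' powr m = q' ^ m" using q' by (simp add: powr_realpow)
    moreover have "q' ^ m \<le> q ^ m" using q' by (intro power_mono) auto
    moreover have "q' powr (log 2 (x / Y) + 1) = q' * Y powr \<kappa> * x powr (- \<kappa>)"
    proof -
      have "q' powr (log 2 (x / Y)) = (x / Y) powr (log 2 q')"
        using q' x Y by (simp add: powr_def log_def)
      also have "\<dots> = Y powr \<kappa> * x powr (- \<kappa>)"
        using x Y by (simp add: \<kappa>_def powr_divide powr_minus field_simps)
      finally show ?thesis using q' by (simp add: powr_add)
    qed
    ultimately have le: "q' * Y powr \<kappa> * x powr (- \<kappa>) \<le> q ^ m" by linarith
    have "q' * Y powr \<kappa> * \<phi> Y * x powr (- \<kappa>) \<le> q ^ m * \<phi> Y"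
      using mult_right_mono[OF le, of "\<phi> Y"] pos[of Y] by (simp add: mult_ac)
    also have "\<dots> \<le> \<phi> x" using iter[of m] \<open>\<phi> (2 ^ m * Y) \<le> \<phi> x\<close> by linarith
    finally show ?thesis .
  qed
  have "0 < q' * Y powr \<kappa> * \<phi> Y" using q' pos[of Y] by (simp add: Y_def)
  then show ?thesis
    using bound by (intro exI[of _ "q' * Y powr \<kappa> * \<phi> Y"] conjI exI[of _ \<kappa>] eventually_at_top_linorderI[of Y]) auto
qed

text \<open>Chernoff with base 1/2: a Poisson variable N of rate r has P(N \<le> x) at most 2 powr x
  times the mean exp (- r / 2) of (1 / 2) ^ N. For r \<ge> 4 x this is at most (2 / e^2) powr x,
  hence at most 1/2.\<close>

lemma poisson_tail_ge_half:
  assumes x: "1 \<le> x" and r: "4 * x \<le> r"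
  shows "ennreal (1 / 2) \<le> (\<integral>\<^sup>+n. indicator {n. x < real n} n * ennreal (poisson_prob r n) \<partial>count_space UNIV)"
    (is "_ \<le> ?T")
proof -
  have r0: "0 \<le> r" using x r by simp
  have "(\<lambda>n. (r / 2) ^ n / fact n * exp (- r)) sums (exp (r / 2) * exp (- r))"
    using exp_converges[of "r / 2"] by (intro sums_mult2) (simp add: scaleR_conv_of_real field_simps)
  then have s: "(\<lambda>n. (1 / 2) ^ n * poisson_prob r n) sums exp (- r / 2)"
    by (simp add: poisson_prob_def power_divide flip: exp_add)
  have "1 = (\<integral>\<^sup>+n. ennreal (poisson_prob r n) \<partial>count_space UNIV)"
    using poisson_prob_sums[of r] poisson_prob_nonneg[OF r0]
    by (simp add: nn_integral_count_space_nat suminf_ennreal2 sums_iff)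
  also have "\<dots> \<le> (\<integral>\<^sup>+n. indicator {n. x < real n} n * ennreal (poisson_prob r n)
      + ennreal (2 powr x) * ennreal ((1 / 2) ^ n * poisson_prob r n) \<partial>count_space UNIV)"
  proof (rule nn_integral_mono)
    fix n
    show "ennreal (poisson_prob r n) \<le> indicator {n. x < real n} n * ennreal (poisson_prob r n)
      + ennreal (2 powr x) * ennreal ((1 / 2) ^ n * poisson_prob r n)"
    proof (cases "x < real n")
      case False
      then have "1 \<le> 2 powr x * (1 / 2) ^ n"
        by (simp add: power_one_over powr_realpow[symmetric] field_simps)
      then have "poisson_prob r n \<le> 2 powr x * ((1 / 2) ^ n * poisson_prob r n)"
        using mult_right_mono[of 1 "2 powr x * (1 / 2) ^ n" "poisson_prob r n"] poisson_prob_nonneg[OF r0, of n]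
        by (simp add: mult.assoc)
      then show ?thesis
        using False by (simp add: ennreal_leI flip: ennreal_mult')
    qed simp
  qed
  also have "\<dots> = ?T + ennreal (2 powr x) * ennreal (exp (- r / 2))"
    using s poisson_prob_nonneg[OF r0]
    by (subst nn_integral_add) (auto simp: nn_integral_cmult nn_integral_count_space_nat suminf_ennreal2 sums_iff)
  also have "ennreal (2 powr x) * ennreal (exp (- r / 2)) \<le> ennreal (1 / 2)"
  proof -
    have "2 powr x * exp (- r / 2) \<le> 2 powr x * exp (- (2 * x))"
      using r by simp
    also have "\<dots> = exp (x * (ln 2 - 2))"
      by (simp add: powr_def algebra_simps flip: exp_add)
    also have "\<dots> \<le> exp (1 * (ln 2 - 2))"
      using x ln_2_less_1 by (simp only: exp_le_cancel_iff) (intro mult_right_mono_neg, auto)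
    also have "\<dots> = 2 * exp (- 2)" by (simp add: exp_diff exp_minus field_simps)
    also have "\<dots> \<le> 1 / 2"
    proof -
      have "(2::real) \<le> exp 1" using exp_ge_add_one_self[of 1] by simp
      then have "2 * 2 \<le> exp 1 * exp (1::real)" by (intro mult_mono) auto
      then have "4 \<le> exp (2::real)" by (simp flip: exp_add)
      then show ?thesis by (simp add: exp_minus field_simps)
    qed
    finally have "ennreal (2 powr x * exp (- r / 2)) \<le> ennreal (1 / 2)" by (rule ennreal_leI)
    then show ?thesis by (subst (asm) ennreal_mult) auto
  qed
  finally have half: "1 \<le> ?T + ennreal (1 / 2)" by (simp add: add_left_mono)
  then show ?thesis
  proof (cases ?T)
    case (real t)
    have "ennreal 1 \<le> ennreal (t + 1 / 2)"
      using half real by (subst ennreal_plus) simp_all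
    then have "1 / 2 \<le> t" using real by (subst (asm) ennreal_le_iff) auto
    then show ?thesis using real by (simp only: ennreal_leI)
  qed simp
qed

context hawkes_clusters
begin

text \<open>Ties the rate, defined by an abstract law, to an offspring number of the model. The
  first form serves the upper bound by Markov, the second, conditional on the mark, the lower
  bound.\<close>

lemma rate_eq_prob:
  "rate f \<beta> \<alpha> i x = prob {\<omega>\<in>space M. x < real (nchild (l_star \<alpha> i, 0, []) i \<omega>)}"
  "ennreal (rate f \<beta> \<alpha> i x) = (\<integral>\<^sup>+b. \<integral>\<^sup>+n. indicator {n. x < real n} n *
      ennreal (poisson_prob (b * mass (f i (l_star \<alpha> i))) n) \<partial>count_space UNIV \<partial>\<beta> i (l_star \<alpha> i))"
proof -
  let ?l = "l_star \<alpha> i" and ?I = "indicator {n. x < real n} :: nat \<Rightarrow> ennreal"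
  have "emeasure M {\<omega>\<in>space M. x < real (nchild (?l, 0, []) i \<omega>)} = (\<integral>\<^sup>+\<omega>. ?I (nchild (?l, 0, []) i \<omega>) \<partial>M)"
  proof -
    have "(\<integral>\<^sup>+\<omega>. ?I (nchild (?l, 0, []) i \<omega>) \<partial>M)
      = (\<integral>\<^sup>+\<omega>. indicator {\<omega>\<in>space M. x < real (nchild (?l, 0, []) i \<omega>)} \<omega> \<partial>M)"
      by (intro nn_integral_cong) (auto split: split_indicator)
    then show ?thesis by simp
  qed
  also have "\<dots> = (\<integral>\<^sup>+b. \<integral>\<^sup>+n. ?I n * ennreal (poisson_prob (b * mass (f i ?l)) n) \<partial>count_space UNIV \<partial>\<beta> i ?l)"
    by (subst nn_integral_nchild) simp
  finally have 1: "emeasure M {\<omega>\<in>space M. x < real (nchild (?l, 0, []) i \<omega>)} = \<dots>" .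
  also have "\<dots> = (\<integral>\<^sup>+n. \<integral>\<^sup>+b. ?I n * ennreal (poisson_prob (b * mass (f i ?l)) n) \<partial>\<beta> i ?l \<partial>count_space UNIV)"
    by (rule nn_integral_count_space_nn_integral) auto
  also have "\<dots> = emeasure (mixed_poisson (\<beta> i ?l) (mass (f i ?l))) {n. x < real n}"
    by (simp add: mixed_poisson_def emeasure_density nn_integral_cmult mult.commute)
  finally show *: "rate f \<beta> \<alpha> i x = prob {\<omega>\<in>space M. x < real (nchild (?l, 0, []) i \<omega>)}"
    by (simp add: rate_def measure_def)
  show "ennreal (rate f \<beta> \<alpha> i x) = (\<integral>\<^sup>+b. \<integral>\<^sup>+n. ?I n * ennreal (poisson_prob (b * mass (f i ?l)) n) \<partial>count_space UNIV \<partial>\<beta> i ?l)"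
    unfolding * emeasure_eq_measure[symmetric] by (rule 1)
qed

text \<open>A mark above 4 x / \<mu> pushes the Poisson rate above 4 x, and then at least half of
  the mass lies above x.\<close>

lemma rate_ge_mark_tail:
  assumes x: "1 \<le> x"
  shows "measure (\<beta> i (l_star \<alpha> i)) {4 * x / mass (f i (l_star \<alpha> i))<..} / 2 \<le> rate f \<beta> \<alpha> i x"
proof -
  let ?l = "l_star \<alpha> i"
  let ?A = "{4 * x / mass (f i ?l)<..}"
  interpret \<beta>: prob_space "\<beta> i ?l" by (rule mark_law_prob)
  note mu = f_mass_pos[of i ?l]
  have A: "?A \<in> sets (\<beta> i ?l)" by (simp add: mark_law_sets)
  have "ennreal (measure (\<beta> i ?l) ?A / 2) = ennreal (1 / 2) * emeasure (\<beta> i ?l) ?A"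
    by (subst \<beta>.emeasure_eq_measure, subst ennreal_mult[symmetric]) simp_all
  also have "\<dots> = (\<integral>\<^sup>+b. ennreal (1 / 2) * indicator ?A b \<partial>\<beta> i ?l)"
    using A by (simp add: nn_integral_cmult_indicator)
  also have "\<dots> \<le> ennreal (rate f \<beta> \<alpha> i x)"
    unfolding rate_eq_prob(2)
  proof (rule nn_integral_mono)
    fix b
    show "ennreal (1 / 2) * indicator ?A b \<le> (\<integral>\<^sup>+n. indicator {n. x < real n} n *
      ennreal (poisson_prob (b * mass (f i ?l)) n) \<partial>count_space UNIV)"
    proof (cases "b \<in> ?A")
      case True
      then have "4 * x \<le> b * mass (f i ?l)" using mu by (simp add: field_simps)
      from poisson_tail_ge_half[OF x this] True show ?thesis
        by (simp only: indicator_simps mult_1_right)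
    qed simp
  qed
  finally show ?thesis by (simp add: rate_def)
qed

lemma rate_nonneg: "0 \<le> rate f \<beta> \<alpha> i x"
  by (simp add: rate_def)

lemma breve_rate_lower_bound:
  assumes rv: "\<And>j i. regularly_varying (- \<alpha> j i) (\<lambda>x. measure (\<beta> j i) {x<..})"
  obtains \<kappa> where "0 \<le> \<kappa>" "\<forall>\<^sub>F x in at_top. x powr (- \<kappa>) \<le> breve_rate f \<beta> \<alpha> k x"
proof -
  have "\<exists>\<kappa>\<ge>0. \<forall>\<^sub>F x in at_top. x powr (- \<kappa>) \<le> rate f \<beta> \<alpha> i x" for i
  proof -
    let ?l = "l_star \<alpha> i"
    interpret \<beta>: prob_space "\<beta> i ?l" by (rule mark_law_prob)
    let ?\<phi> = "\<lambda>x. measure (\<beta> i ?l) {x<..}"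
    define s where "s = 4 / mass (f i ?l)"
    have s: "0 < s" using f_mass_pos by (simp add: s_def)
    have "?\<phi> y \<le> ?\<phi> x" if "x \<le> y" for x y
      using that by (intro \<beta>.finite_measure_mono) (auto simp: mark_law_sets)
    then obtain e \<kappa> where e: "0 < e" and ev: "\<forall>\<^sub>F x in at_top. e * x powr (- \<kappa>) \<le> ?\<phi> x"
      using regularly_varying_lower_bound[OF rv[of i ?l]] by auto
    \<comment> \<open>The extra power of x absorbs the constant e * s powr (- \<kappa>) / 2.\<close>
    define \<kappa>' where "\<kappa>' = max 0 \<kappa> + 1"
    have "filterlim (\<lambda>x. s * x) at_top at_top"
      by (rule filterlim_tendsto_pos_mult_at_top[OF tendsto_const s filterlim_ident])
    from eventually_compose_filterlim[OF ev this]
    have "\<forall>\<^sub>F x in at_top. e * (s * x) powr (- \<kappa>) \<le> ?\<phi> (s * x)" .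
    moreover have "\<forall>\<^sub>F x in at_top. x powr (-1) \<le> e * s powr (- \<kappa>) / 2"
    proof -
      have "((\<lambda>x. x powr (-1)) \<longlongrightarrow> (0::real)) at_top"
        by (rule tendsto_neg_powr) (auto intro: filterlim_ident)
      from order_tendstoD(2)[OF this, of "e * s powr (- \<kappa>) / 2"] show ?thesis
        using e s by (auto elim: eventually_mono)
    qed
    ultimately have "\<forall>\<^sub>F x in at_top. x powr (- \<kappa>') \<le> rate f \<beta> \<alpha> i x"
      using eventually_ge_at_top[of 1]
    proof eventually_elim
      case (elim x)
      have "x powr (- \<kappa>') \<le> x powr (- \<kappa> + -1)"
        using elim by (intro powr_mono) (auto simp: \<kappa>'_def)
      also have "\<dots> = x powr (- \<kappa>) * x powr (-1)" by (rule powr_add)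
      also have "\<dots> \<le> x powr (- \<kappa>) * (e * s powr (- \<kappa>) / 2)"
        using elim by (intro mult_left_mono) auto
      also have "\<dots> = e * (s * x) powr (- \<kappa>) / 2"
        using elim s by (simp add: powr_mult)
      also have "\<dots> \<le> ?\<phi> (s * x) / 2" using elim by simp
      also have "\<dots> \<le> rate f \<beta> \<alpha> i x"
        using rate_ge_mark_tail[of x i \<alpha>] elim by (simp add: s_def)
      finally show ?case .
    qed
    then show ?thesis by (intro exI[of _ \<kappa>']) (auto simp: \<kappa>'_def)
  qed
  then obtain \<kappa> where \<kappa>: "\<And>i. 0 \<le> \<kappa> i" "\<And>i. \<forall>\<^sub>F x in at_top. x powr (- \<kappa> i) \<le> rate f \<beta> \<alpha> i x"
    by metis
  have "\<forall>\<^sub>F x in at_top. \<forall>i. x powr (- \<kappa> i) \<le> rate f \<beta> \<alpha> i x"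
    by (rule eventually_all_finite) (rule \<kappa>)
  then have "\<forall>\<^sub>F x in at_top. x powr (- (\<Sum>i\<in>UNIV. k i * \<kappa> i)) \<le> breve_rate f \<beta> \<alpha> k x"
    using eventually_ge_at_top[of 1]
  proof eventually_elim
    case (elim x)
    have "x powr (- (\<Sum>i\<in>UNIV. k i * \<kappa> i)) = (\<Prod>i\<in>UNIV. (x powr (- \<kappa> i)) ^ k i)"
      using elim by (simp add: powr_sum powr_powr powr_realpow[symmetric] mult.commute flip: sum_negf)
    also have "\<dots> \<le> breve_rate f \<beta> \<alpha> k x"
      unfolding breve_rate_def
    proof (intro prod_mono conjI power_mono)
      fix i
      have "x powr (- \<kappa> i) \<le> 1 * rate f \<beta> \<alpha> i x" using elim by simp
      also have "\<dots> \<le> x * rate f \<beta> \<alpha> i x" using elim rate_nonneg by (intro mult_right_mono) auto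
      finally show "x powr (- \<kappa> i) \<le> x * rate f \<beta> \<alpha> i x" .
    qed auto
    finally show ?case .
  qed
  then show ?thesis using \<kappa> by (intro that) (auto intro!: sum_nonneg)
qed

end

context subcritical_hawkes
begin

text \<open>By Markov each factor x * P(N > x) is at most the mean of N. Boundedness of the rate
  turns the tail hypothesis into a delay tail O(1 / x) at x / ln x.\<close>

lemma breve_rate_upper_bound:
  obtains \<Lambda> where "0 < \<Lambda>" "\<And>x. 0 < x \<Longrightarrow> breve_rate f \<beta> \<alpha> k x \<le> \<Lambda>"
proof -
  have *: "x * rate f \<beta> \<alpha> i x \<le> mean_kernel i (l_star \<alpha> i)" if x: "0 < x" for x i
  proof -
    let ?u = "(l_star \<alpha> i, 0::nat, [])"
    have "ennreal (rate f \<beta> \<alpha> i x) = emeasure M {\<omega>\<in>space M. x < real (nchild ?u i \<omega>)}"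
      by (simp add: rate_eq_prob(1) emeasure_eq_measure)
    also have "\<dots> \<le> emeasure M {\<omega>\<in>space M. 1 \<le> ennreal (1 / x) * of_nat (nchild ?u i \<omega>)}"
      using x by (intro emeasure_mono)
        (auto simp: ennreal_of_nat_eq_real_of_nat field_simps simp flip: ennreal_mult' ennreal_1)
    also have "\<dots> \<le> ennreal (1 / x) * (\<integral>\<^sup>+\<omega>. of_nat (nchild ?u i \<omega>) * indicator (space M) \<omega> \<partial>M)"
      by (rule nn_integral_Markov_inequality) auto
    also have "(\<integral>\<^sup>+\<omega>. of_nat (nchild ?u i \<omega>) * indicator (space M) \<omega> \<partial>M) = (\<integral>\<^sup>+\<omega>. of_nat (nchild ?u i \<omega>) \<partial>M)"
      by (intro nn_integral_cong) auto
    also have "\<dots> = ennreal (mean_kernel i (l_star \<alpha> i))"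
      by (simp add: nn_integral_nchild_mean offspring_mean_eq)
    also have "ennreal (1 / x) * ennreal (mean_kernel i (l_star \<alpha> i)) = ennreal (mean_kernel i (l_star \<alpha> i) / x)"
      using x mean_kernel_nonneg by (simp flip: ennreal_mult)
    finally show ?thesis
      using x mean_kernel_nonneg by (simp add: ennreal_le_iff field_simps)
  qed
  show ?thesis
  proof (rule that)
    show "0 < (\<Prod>i\<in>UNIV. mean_kernel i (l_star \<alpha> i) ^ k i) + 1"
      using mean_kernel_nonneg by (intro add_nonneg_pos prod_nonneg) auto
    fix x :: real assume x: "0 < x"
    have "breve_rate f \<beta> \<alpha> k x \<le> (\<Prod>i\<in>UNIV. mean_kernel i (l_star \<alpha> i) ^ k i)"
      unfolding breve_rate_def using x rate_nonneg
      by (intro prod_mono conjI power_mono *) auto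
    then show "breve_rate f \<beta> \<alpha> k x \<le> (\<Prod>i\<in>UNIV. mean_kernel i (l_star \<alpha> i) ^ k i) + 1" by simp
  qed
qed

end

section \<open>Asymptotics\<close>

lemma block_failure_limit:
  fixes A B \<kappa> :: real
  assumes "0 < A" "0 < B"
  shows "((\<lambda>x. (B * ln x + 1) * (2 * (2 / 3) powr (A * x / ln x)) * x powr \<kappa>) \<longlongrightarrow> 0) at_top"
proof -
  define A' where "A' = A * ln (3 / 2)"
  have "0 < A'" using assms by (simp add: A'_def)
  then have lim: "((\<lambda>x. (B * ln x + 1) * (2 * exp (- (A' * x / ln x))) * x powr \<kappa>) \<longlongrightarrow> 0) at_top"
    using assms(2) by real_asymp
  have "ln (2 / 3 :: real) = - ln (3 / 2)" by (simp add: ln_div)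
  then have "(2 / 3) powr (A * x / ln x) = exp (- (A' * x / ln x))" for x :: real
    by (simp add: powr_def A'_def)
  with lim show ?thesis by simp
qed

text \<open>The middle factor is about exp (- \<phi> * ln x * ln (ln x)), which beats every power of
  x; the other two factors are powers of x.\<close>

lemma large_blocks_limit:
  fixes A P \<phi> \<kappa> :: real
  assumes "0 < \<phi>" "0 < P"
  shows "((\<lambda>x. 2 powr (A * ln x + 1) * (P / ln x) powr (\<phi> * ln x - 1) * x powr \<kappa>) \<longlongrightarrow> 0) at_top"
  using assms by real_asymp

text \<open>The bound of \<open>delay_mean_exp_le\<close> for \<theta> = (ln x)^2 / (4 x), t = x /
  ln x and u = sqrt x. As the limit 1 lies below a, \<open>total_le\<close> applies for large
  x.\<close>

lemma exp_weight_limit: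
  fixes \<Lambda> :: real
  assumes "0 < \<Lambda>"
  shows "((\<lambda>x. exp ((ln x)\<^sup>2 / (4 * x) * sqrt x) + exp (ln x / 4) * (\<Lambda> / sqrt x)) \<longlongrightarrow> 1) at_top"
  using assms by real_asymp

context hawkes_clusters
begin

section \<open>Tails and truncated exponential moments of a delay\<close>

lemma tail_integral_nonneg: "0 \<le> t \<Longrightarrow> 0 \<le> (LBINT s:{t..}. f i l s)"
  unfolding set_lebesgue_integral_def using f_nonneg
  by (intro integral_nonneg_AE AE_I2) (auto split: split_indicator)

lemma delay_mean_indicator_le:
  assumes t: "0 \<le> t"
  shows "delay_mean i l (indicator {t<..}) \<le> ennreal ((LBINT s:{t..}. f i l s) / mass (f i l))"
proof -
  have "set_integrable lborel {t..} (f i l)"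
    by (rule set_integrable_subset[OF f_integrable]) (use t in auto)
  then have int: "integrable lborel (\<lambda>s. indicator {t..} s * f i l s / mass (f i l))"
    by (intro integrable_divide) (simp add: set_integrable_def)
  have "delay_mean i l (indicator {t<..}) \<le> (\<integral>\<^sup>+s. ennreal (indicator {t..} s * f i l s / mass (f i l)) \<partial>lborel)"
    unfolding delay_mean_def using t by (intro nn_integral_mono) (auto split: split_indicator)
  also have "\<dots> = ennreal (\<integral>s. indicator {t..} s * f i l s / mass (f i l) \<partial>lborel)"
    using t f_nonneg f_mass_pos[of i l]
    by (intro nn_integral_eq_integral[OF int] AE_I2) (auto split: split_indicator)
  also have "(\<integral>s. indicator {t..} s * f i l s / mass (f i l) \<partial>lborel) = (LBINT s:{t..}. f i l s) / mass (f i l)"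
    by (simp add: set_lebesgue_integral_def)
  finally show ?thesis .
qed

lemma delay_mean_eq_nn_integral:
  "w \<in> borel_measurable borel \<Longrightarrow> delay_mean i l w = (\<integral>\<^sup>+\<omega>. w (delay (l, 0, []) i 0 \<omega>) \<partial>M)"
  by (simp add: nn_integral_delay)

text \<open>Delays up to u have weight at most exp (\<theta> * u), and those between u and t at most
  exp (\<theta> * t).\<close>

lemma delay_mean_exp_le:
  assumes \<theta>: "0 \<le> \<theta>"
  shows "delay_mean i l (\<lambda>x. ennreal (exp (\<theta> * x)) * indicator {..t} x)
    \<le> ennreal (exp (\<theta> * u)) + ennreal (exp (\<theta> * t)) * delay_mean i l (indicator {u<..})"
proof -
  let ?X = "delay (l, 0, []) i 0"
  have "delay_mean i l (\<lambda>x. ennreal (exp (\<theta> * x)) * indicator {..t} x)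
    = (\<integral>\<^sup>+\<omega>. ennreal (exp (\<theta> * ?X \<omega>)) * indicator {..t} (?X \<omega>) \<partial>M)"
    by (rule delay_mean_eq_nn_integral) simp
  also have "\<dots> \<le> (\<integral>\<^sup>+\<omega>. ennreal (exp (\<theta> * u)) + ennreal (exp (\<theta> * t)) * indicator {u<..} (?X \<omega>) \<partial>M)"
  proof (rule nn_integral_mono)
    fix \<omega>
    have "ennreal (exp (\<theta> * ?X \<omega>)) \<le> ennreal (exp (\<theta> * v))" if "?X \<omega> \<le> v" for v
      using that \<theta> by (intro ennreal_leI) (simp add: mult_left_mono)
    from this[of u] this[of t] show "ennreal (exp (\<theta> * ?X \<omega>)) * indicator {..t} (?X \<omega>)
      \<le> ennreal (exp (\<theta> * u)) + ennreal (exp (\<theta> * t)) * indicator {u<..} (?X \<omega>)"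
      by (auto intro: add_increasing split: split_indicator)
  qed
  also have "\<dots> = ennreal (exp (\<theta> * u)) + ennreal (exp (\<theta> * t)) * delay_mean i l (indicator {u<..})"
    by (subst delay_mean_eq_nn_integral) (auto simp: nn_integral_add nn_integral_cmult emeasure_space_1)
  finally show ?thesis .
qed

lemma delay_mean_mono: "(\<And>x. w x \<le> w' x) \<Longrightarrow> delay_mean i l w \<le> delay_mean i l w'"
  unfolding delay_mean_def by (intro nn_integral_mono mult_left_mono) auto

end

context bounded_hawkes
begin

text \<open>\<psi> stands for the rate, which enters only through a polynomial lower bound,
  boundedness and the tail relation.\<close>

lemma outer_prob_dist_negligible:
  fixes \<psi> :: "real \<Rightarrow> real" and \<kappa> \<Lambda> \<Delta> :: real
  assumes kappa: "0 \<le> \<kappa>" and lower: "\<forall>\<^sub>F x in at_top. x powr (- \<kappa>) \<le> \<psi> x"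
    and upper: "0 < \<Lambda>" "\<And>x. 0 < x \<Longrightarrow> \<psi> x \<le> \<Lambda>"
    and tail: "\<And>p q. (\<lambda>x. LBINT t:{x / ln x..}. f p q t) \<in> o[at_top](\<lambda>x. \<psi> x / x)"
    and \<Delta>: "0 < \<Delta>"
  shows "(\<lambda>n. outer_prob M {\<omega> \<in> space M. dist_P_infinity (rescaled n (hawkes gap nchild delay \<omega>))
        (rescaled n (coupled_process gap nchild \<omega>)) > \<Delta>} / \<psi> (real n)) \<longlonglongrightarrow> 0"
proof -
  define d where "d = real CARD('d)"
  \<comment> \<open>Each of the three error terms in \<open>outer_prob_dist_le\<close> gets a
    quarter of \<Delta>: K and \<eta> are chosen for this, and \<phi> from d * 18 * (H / L) *
    (\<phi> * L) = \<Delta> / 4, where L = ln n.\<close>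
  define K where "K = max 1 (ln (4 / \<Delta>))"
  define \<eta> where "\<eta> = \<Delta> / (8 * d)"
  \<comment> \<open>Makes \<theta> * \<epsilon> * n equal to (2 + \<kappa>) * ln n: one power of n
    pays for the number of immigrants, \<kappa> powers for the division by \<psi>, and one is left
    over.\<close>
  define H where "H = 4 * (2 + \<kappa>)"
  define \<phi> where "\<phi> = \<Delta> / (72 * d * H)"
  \<comment> \<open>Rounding gives b j \<le> 5 * c j * H * n / L and Q \<le> 2 * K * L / H. Hence P
    / L bounds the probability that a block is large, and W j * n the number Q * b j of
    immigrants.\<close>
  define P where "P = (\<Sum>j\<in>UNIV. 5 * c j * H * C / \<eta>)"
  define \<tau> where "\<tau> x = (\<Sum>i\<in>UNIV. \<Sum>l\<in>UNIV. (LBINT s:{x / ln x..}. f i l s) / mass (f i l))" for x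
  define W where "W j = 10 * K * c j" for j
  have d: "1 \<le> d" by (simp add: d_def Suc_le_eq)
  have K: "0 < K" by (simp add: K_def)
  have eta: "0 < \<eta>" using \<Delta> d by (simp add: \<eta>_def)
  have H: "0 < H" using kappa by (simp add: H_def)
  have phi: "0 < \<phi>" using \<Delta> d H by (simp add: \<phi>_def)
  have P_ge: "5 * c j * H * C / \<eta> \<le> P" for j
    unfolding P_def using c_pos H C_pos eta
    by (intro member_le_sum[of j UNIV "\<lambda>j. 5 * c j * H * C / \<eta>"]) (auto intro!: divide_nonneg_pos mult_nonneg_nonneg less_imp_le)
  have P: "0 < P"
    by (rule less_le_trans[OF _ P_ge]) (use c_pos H C_pos eta in auto)
  have expK: "exp (- K) \<le> \<Delta> / 4"
  proof -
    have "exp (- K) \<le> exp (- ln (4 / \<Delta>))" by (simp add: K_def)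
    then show ?thesis using \<Delta> by (simp add: exp_minus)
  qed
  have \<tau>_o: "\<tau> \<in> o[at_top](\<lambda>x. \<psi> x / x)"
    unfolding \<tau>_def[abs_def] using tail f_mass_pos
    by (intro big_sum_in_smallo) (auto simp: less_imp_neq[symmetric] f_mass_pos)
  have \<tau>_nonneg: "0 \<le> \<tau> x" and \<tau>_ge: "delay_mean i l (indicator {x / ln x<..}) \<le> ennreal (\<tau> x)" if "1 < x" for x i l
  proof -
    have nn: "0 \<le> (LBINT s:{x / ln x..}. f i l s) / mass (f i l)" for i l
      using that f_mass_pos[of i l] by (intro divide_nonneg_pos tail_integral_nonneg) auto
    then show "0 \<le> \<tau> x" unfolding \<tau>_def by (intro sum_nonneg)
    have "(LBINT s:{x / ln x..}. f i l s) / mass (f i l) \<le> \<tau> x"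
      unfolding \<tau>_def using nn
      by (intro order_trans[OF member_le_sum[of l UNIV "\<lambda>l. (LBINT s:{x / ln x..}. f i l s) / mass (f i l)"]
          member_le_sum[of i UNIV "\<lambda>i. \<Sum>l\<in>UNIV. (LBINT s:{x / ln x..}. f i l s) / mass (f i l)"]] sum_nonneg) auto
    then show "delay_mean i l (indicator {x / ln x<..}) \<le> ennreal (\<tau> x)"
      using that by (intro order_trans[OF delay_mean_indicator_le ennreal_leI]) auto
  qed
  have \<psi>_pos: "\<forall>\<^sub>F x in at_top. 0 < \<psi> x"
    using lower eventually_gt_at_top[of 0] 
  proof eventually_elim
    case (elim x)
    then have "0 < x powr (- \<kappa>)" by simp
    with elim show ?case by linarith
  qed
  have "\<forall>\<^sub>F x in at_top. norm (\<tau> x) \<le> 1 * norm (\<psi> x / x)"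
    using \<tau>_o by (rule landau_o.smallD) simp
  then have \<tau>_le: "\<forall>\<^sub>F x in at_top. \<tau> x \<le> \<Lambda> / x"
    using \<psi>_pos eventually_gt_at_top[of 0]
  proof eventually_elim
    case (elim x)
    then have "\<tau> x \<le> \<psi> x / x" by simp
    also have "\<dots> \<le> \<Lambda> / x" using elim upper by (intro divide_right_mono) auto
    finally show ?case .
  qed
  \<comment> \<open>The bound of \<open>outer_prob_dist_le\<close> after division by \<psi>. The
    outer terms trade 1 / \<psi> for x powr \<kappa>; the tail term keeps \<psi>, since the
    hypothesis on the delays is relative to \<psi> x / x.\<close>
  define g where "g x = (\<Sum>j\<in>UNIV. (K / H * ln x + 1) * (2 * (2 / 3) powr (4 * c j * H * x / ln x)) * x powr \<kappa>
      + W j * (C * x powr (- 1) + D * (\<tau> x / (\<psi> x / x)))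
      + 2 powr (K / H * ln x + 1) * (P / ln x) powr (\<phi> * ln x - 1) * x powr \<kappa>)" for x
  have "(g \<longlongrightarrow> (\<Sum>j\<in>(UNIV::'d set). 0 + W j * (C * 0 + D * 0) + 0)) at_top"
    unfolding g_def
    using c_pos H K
    by (intro tendsto_intros block_failure_limit large_blocks_limit phi P tendsto_neg_powr filterlim_ident
        smalloD_tendsto[OF \<tau>_o]) auto
  then have g: "(g \<longlongrightarrow> 0) at_top" by simp
  have le_g: "\<forall>\<^sub>F n in sequentially. outer_prob M {\<omega> \<in> space M. dist_P_infinity (rescaled n (hawkes gap nchild delay \<omega>))
        (rescaled n (coupled_process gap nchild \<omega>)) > \<Delta>} / \<psi> (real n) \<le> g (real n)"
  proof -
    have sq: "filterlim (sqrt :: real \<Rightarrow> real) at_top at_top" by real_asymp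
    have "\<forall>\<^sub>F x in at_top. exp ((ln x)\<^sup>2 / (4 * x) * sqrt x) + exp (ln x / 4) * (\<Lambda> / sqrt x) < a"
      using order_tendstoD(2)[OF exp_weight_limit[OF upper(1)] a] .
    moreover have "\<forall>\<^sub>F x in at_top. \<tau> (sqrt x) \<le> \<Lambda> / sqrt x"
      by (rule eventually_compose_filterlim[OF \<tau>_le sq])
    moreover have "\<forall>\<^sub>F x::real in at_top. 1 < sqrt x \<and> 1 \<le> ln (sqrt x)"
      by (intro eventually_conj; real_asymp)
    moreover have "\<forall>\<^sub>F x in at_top. \<forall>j. 4 \<le> c j * H * x / ln x"
    proof (rule eventually_all_finite)
      fix j
      have cj: "0 < c j" by (rule c_pos)
      show "\<forall>\<^sub>F x in at_top. 4 \<le> c j * H * x / ln x"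
        using cj H by real_asymp
    qed
    moreover have "\<forall>\<^sub>F x in at_top. 1 \<le> K * ln x / H" using K H by real_asymp
    moreover have "\<forall>\<^sub>F x in at_top. P / ln x \<le> 1" using P by real_asymp
    moreover have "\<forall>\<^sub>F x in at_top. H / ln x \<le> \<Delta> / 4" using H \<Delta> by real_asymp
    moreover note lower \<psi>_pos eventually_gt_at_top[of 1]
    \<comment> \<open>Stated for real x, where the asymptotic facts live, and only then restricted
      to integers, for which \<open>nat \<lfloor>x\<rfloor>\<close> is n.\<close>
    ultimately have "\<forall>\<^sub>F x in at_top. (\<exists>n. x = real n) \<longrightarrow>
      outer_prob M {\<omega> \<in> space M. dist_P_infinity (rescaled (nat \<lfloor>x\<rfloor>) (hawkes gap nchild delay \<omega>))
        (rescaled (nat \<lfloor>x\<rfloor>) (coupled_process gap nchild \<omega>)) > \<Delta>} / \<psi> x \<le> g x"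
    proof eventually_elim
      case (elim x)
      show ?case
      proof (intro impI, elim exE)
        fix n assume x: "x = real n"
        define L where "L = ln x"
        define \<epsilon> where "\<epsilon> = H / L"
        define \<theta> where "\<theta> = L\<^sup>2 / (4 * x)"
        define v where "v j = c j * H * x / L" for j
        \<comment> \<open>Rounding 4 * v j up keeps b j \<le> (17 / 4) * v j, because v j \<ge> 4;
          this is the origin of the constant 17.\<close>
        define b where "b j = nat \<lceil>4 * v j\<rceil>" for j
        define Q where "Q = nat \<lceil>K * L / H\<rceil>"
        define r where "r = nat \<lfloor>\<phi> * L\<rfloor>"
        have x1: "1 < x" and L: "0 < L" using elim by (auto simp: L_def)
        have cj: "0 < c j" for j by (rule c_pos)
        have v: "4 \<le> v j" for j using elim(4) by (simp add: v_def L_def)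
        have b_ge: "4 * v j \<le> b j" for j by (simp add: b_def real_nat_ceiling_ge)
        have b_le: "b j \<le> 4 * v j + 1" for j
          using v[of j] by (simp add: b_def)
        have b_le': "b j \<le> 5 * v j" for j
          using b_le[of j] v[of j] by linarith
        have Q_ge: "K * L / H \<le> Q" by (simp add: Q_def real_nat_ceiling_ge)
        have Q_le: "Q \<le> K * L / H + 1" using K H L by (simp add: Q_def)
        have r_le: "r \<le> \<phi> * L" using phi L by (simp add: r_def)
        have r_ge: "\<phi> * L - 1 \<le> r" by (simp add: r_def) linarith
        have \<epsilon>: "0 < \<epsilon>" using H L by (simp add: \<epsilon>_def)
        have \<epsilon>x: "c j * (\<epsilon> * n) = v j" for j by (simp add: \<epsilon>_def v_def x)
        have Qb: "real Q * real (b j) \<le> W j * x" for j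
        proof -
          have "Q \<le> 2 * (K * L / H)" using Q_le elim(5) by (simp add: L_def)
          then have "real Q * real (b j) \<le> (2 * (K * L / H)) * (5 * v j)"
            using b_le'[of j] K H L by (intro mult_mono) auto
          also have "\<dots> = W j * x" using H L by (simp add: W_def v_def)
          finally show ?thesis .
        qed
        have "outer_prob M {\<omega> \<in> space M. dist_P_infinity (rescaled n (hawkes gap nchild delay \<omega>))
            (rescaled n (coupled_process gap nchild \<omega>)) > \<Delta>}
          \<le> (\<Sum>j\<in>UNIV. Q * (2 * (2 / 3) ^ b j) + Q * b j * (C * exp (- \<theta> * (\<epsilon> * n)) + D * \<tau> x) + 2 ^ Q * (P / L) ^ r)"
        proof (rule outer_prob_dist_le)
          show "0 < n" using x1 x by simp
          show "0 \<le> \<theta>" using x1 by (simp add: \<theta>_def)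
          show "c j * (\<epsilon> * n) \<le> real (b j) / 4" for j
            using b_ge[of j] by (simp add: \<epsilon>x)
          show "4 * real (b j) \<le> 17 * c j * (\<epsilon> * n)" for j
            using b_le[of j] v[of j] by (simp add: \<epsilon>x mult.assoc)
          show "K \<le> Q * \<epsilon>"
            using Q_ge H L by (simp add: \<epsilon>_def field_simps)
          show "delay_mean i l (\<lambda>y. ennreal (exp (\<theta> * y)) * indicator {..x / L} y) \<le> ennreal a" for i l
          proof -
            have "delay_mean i l (\<lambda>y. ennreal (exp (\<theta> * y)) * indicator {..x / L} y)
              \<le> ennreal (exp (\<theta> * sqrt x)) + ennreal (exp (\<theta> * (x / L))) * delay_mean i l (indicator {sqrt x<..})"
              by (rule delay_mean_exp_le) (use x1 in \<open>simp add: \<theta>_def\<close>)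
            \<comment> \<open>The tail is controlled only at points of the form y / ln y. Taking y =
              sqrt x gives such a point, and it is at most sqrt x.\<close>
            also have "delay_mean i l (indicator {sqrt x<..}) \<le> delay_mean i l (indicator {sqrt x / ln (sqrt x)<..})"
            proof (rule delay_mean_mono)
              fix y
              have "sqrt x / ln (sqrt x) \<le> sqrt x / 1"
                using elim(3) by (intro divide_left_mono) auto
              then show "indicator {sqrt x<..} y \<le> (indicator {sqrt x / ln (sqrt x)<..} y :: ennreal)"
                by (auto split: split_indicator)
            qed
            also have "\<dots> \<le> ennreal (\<Lambda> / sqrt x)"
              using elim(2,3) by (intro order_trans[OF \<tau>_ge ennreal_leI]) auto
            also have "ennreal (exp (\<theta> * sqrt x)) + ennreal (exp (\<theta> * (x / L))) * ennreal (\<Lambda> / sqrt x)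
              = ennreal (exp (\<theta> * sqrt x) + exp (\<theta> * (x / L)) * (\<Lambda> / sqrt x))"
              using upper(1) x1 by (subst ennreal_mult[symmetric], simp_all only: ennreal_plus[symmetric] exp_ge_zero) auto
            also have "\<dots> \<le> ennreal a"
            proof (rule ennreal_leI)
              have \<theta>_xL: "\<theta> * (x / L) = L / 4"
                using L x1 by (simp add: \<theta>_def power2_eq_square)
              show "exp (\<theta> * sqrt x) + exp (\<theta> * (x / L)) * (\<Lambda> / sqrt x) \<le> a"
                unfolding \<theta>_xL unfolding \<theta>_def L_def by (rule less_imp_le[OF elim(1)])
            qed
            finally show ?thesis by (simp add: add_left_mono mult_left_mono)
          qed
          show "delay_mean i l (indicator {x / L<..}) \<le> ennreal (\<tau> x)" for i l
            using \<tau>_ge[OF x1] by (simp add: L_def)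
          show "0 \<le> \<tau> x" by (rule \<tau>_nonneg[OF x1])
          show "real (b j) * C / (\<eta> * n) \<le> P / L" for j
          proof -
            have "real (b j) * C / (\<eta> * n) \<le> (5 * v j) * C / (\<eta> * x)"
              using b_le'[of j] C_pos eta x1 unfolding x by (intro divide_right_mono mult_right_mono) auto
            also have "\<dots> = (5 * c j * H * C / \<eta>) / L" using x1 by (simp add: v_def mult_ac)
            also have "\<dots> \<le> P / L" using P_ge[of j] L by (intro divide_right_mono) auto
            finally show ?thesis .
          qed
          show "0 < P / L" "P / L \<le> 1" using P L elim(6) by (auto simp: L_def)
          show "max \<epsilon> (real CARD('d) * (2 * \<eta>)) + CARD('d) * r * 18 * \<epsilon> + exp (- K) \<le> \<Delta>"
          proof -
            have "real CARD('d) * (2 * \<eta>) = \<Delta> / 4" using d by (simp add: \<eta>_def flip: d_def)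
            moreover have "\<epsilon> \<le> \<Delta> / 4" using elim(7) by (simp add: \<epsilon>_def L_def)
            moreover have "CARD('d) * r * 18 * \<epsilon> \<le> \<Delta> / 4"
            proof -
              have "CARD('d) * r * 18 * \<epsilon> = (d * 18 * \<epsilon>) * r" by (simp add: d_def)
              also have "\<dots> \<le> (d * 18 * \<epsilon>) * (\<phi> * L)"
                using r_le d \<epsilon> by (intro mult_left_mono) auto
              also have "\<dots> = \<Delta> / 4" using d H L by (simp add: \<epsilon>_def \<phi>_def)
              finally show ?thesis .
            qed
            ultimately show ?thesis using expK \<Delta> by linarith
          qed
        qed (use \<epsilon> eta in auto)
        also have "\<dots> / \<psi> x \<le> g x"
          unfolding g_def sum_divide_distrib
        proof (rule sum_mono)
          fix j
          have lx: "0 < \<psi> x" "x powr (- \<kappa>) \<le> \<psi> x" using elim by auto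
          \<comment> \<open>Division by \<psi> costs at most the factor x powr \<kappa>.\<close>
          have inv: "y / \<psi> x \<le> y * x powr \<kappa>" if "0 \<le> y" for y
          proof -
            have "y / \<psi> x \<le> y / x powr (- \<kappa>)" using lx that x1 by (intro divide_left_mono) auto
            then show ?thesis by (simp add: powr_minus field_simps)
          qed
          have t1: "Q * (2 * (2 / 3) ^ b j) / \<psi> x \<le> (K / H * ln x + 1) * (2 * (2 / 3) powr (4 * c j * H * x / ln x)) * x powr \<kappa>"
          proof -
            have "(2 / 3 :: real) ^ b j = (2 / 3) powr b j" by (simp add: powr_realpow)
            also have "\<dots> \<le> (2 / 3) powr (4 * c j * H * x / L)"
              using b_ge[of j] by (intro powr_mono') (auto simp: v_def)
            finally have "Q * (2 * (2 / 3) ^ b j) \<le> (K / H * L + 1) * (2 * (2 / 3) powr (4 * c j * H * x / L))"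
              using Q_le K H L by (intro mult_mono) auto
            then have "Q * (2 * (2 / 3) ^ b j) * x powr \<kappa>
              \<le> (K / H * L + 1) * (2 * (2 / 3) powr (4 * c j * H * x / L)) * x powr \<kappa>"
              by (rule mult_right_mono) simp
            moreover have "Q * (2 * (2 / 3) ^ b j) / \<psi> x \<le> Q * (2 * (2 / 3) ^ b j) * x powr \<kappa>"
              by (rule inv) simp
            ultimately show ?thesis unfolding L_def by (rule order_trans[rotated])
          qed
          have t2: "Q * b j * (C * exp (- \<theta> * (\<epsilon> * n)) + D * \<tau> x) / \<psi> x
            \<le> W j * (C * x powr (- 1) + D * (\<tau> x / (\<psi> x / x)))"
          proof -
            let ?E = "exp (- \<theta> * (\<epsilon> * n))"
            have "Q * b j * (C * ?E + D * \<tau> x) / \<psi> x \<le> (W j * x) * (C * ?E + D * \<tau> x) / \<psi> x"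
              using Qb[of j] C_pos D_pos \<tau>_nonneg[OF x1] lx
              by (intro divide_right_mono mult_right_mono) (auto intro!: add_nonneg_nonneg)
            also have "\<dots> = W j * (C * (x * ?E / \<psi> x) + D * (\<tau> x / (\<psi> x / x)))"
              using lx x1 by (simp add: field_simps)
            also have "\<dots> \<le> W j * (C * (x * ?E * x powr \<kappa>) + D * (\<tau> x / (\<psi> x / x)))"
              using inv[of "x * ?E"] C_pos x1 K cj[of j]
              by (intro mult_left_mono add_right_mono) (auto simp: W_def)
            also have "x * ?E * x powr \<kappa> = x powr (- 1)"
            proof -
              have "\<theta> * (\<epsilon> * n) = (2 + \<kappa>) * ln x"
                using L x1 by (simp add: \<theta>_def \<epsilon>_def H_def power2_eq_square L_def flip: x)
              then have "?E = exp (- ((2 + \<kappa>) * ln x))" by simp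
              also have "\<dots> = x powr (- (2 + \<kappa>))" using x1 by (simp add: powr_def algebra_simps)
              finally have "?E = x powr (- (2 + \<kappa>))" .
              then have "x * ?E * x powr \<kappa> = x powr 1 * x powr (- (2 + \<kappa>)) * x powr \<kappa>" using x1 by simp
              also have "\<dots> = x powr (- 1)" by (simp only: powr_add[symmetric]) simp
              finally show ?thesis .
            qed
            finally show ?thesis .
          qed
          have t3: "2 ^ Q * (P / L) ^ r / \<psi> x
            \<le> 2 powr (K / H * ln x + 1) * (P / ln x) powr (\<phi> * ln x - 1) * x powr \<kappa>"
          proof -
            have "(2::real) ^ Q = 2 powr Q" by (simp add: powr_realpow)
            also have "\<dots> \<le> 2 powr (K / H * L + 1)" using Q_le by (intro powr_mono) auto
            finally have q: "(2::real) ^ Q \<le> 2 powr (K / H * L + 1)" .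
            have "(P / L) ^ r = (P / L) powr r" using P L by (simp add: powr_realpow)
            also have "\<dots> \<le> (P / L) powr (\<phi> * L - 1)"
              using P L elim(6) r_ge by (intro powr_mono') (auto simp: L_def)
            finally have "2 ^ Q * (P / L) ^ r \<le> 2 powr (K / H * L + 1) * (P / L) powr (\<phi> * L - 1)"
              using q P L by (intro mult_mono) auto
            then have "2 ^ Q * (P / L) ^ r * x powr \<kappa>
              \<le> 2 powr (K / H * L + 1) * (P / L) powr (\<phi> * L - 1) * x powr \<kappa>"
              by (rule mult_right_mono) simp
            moreover have "2 ^ Q * (P / L) ^ r / \<psi> x \<le> 2 ^ Q * (P / L) ^ r * x powr \<kappa>"
              by (rule inv) (use P L in simp)
            ultimately show ?thesis unfolding L_def by (rule order_trans[rotated])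
          qed
          show "(Q * (2 * (2 / 3) ^ b j) + Q * b j * (C * exp (- \<theta> * (\<epsilon> * n)) + D * \<tau> x) + 2 ^ Q * (P / L) ^ r) / \<psi> x
            \<le> (K / H * ln x + 1) * (2 * (2 / 3) powr (4 * c j * H * x / ln x)) * x powr \<kappa>
      + W j * (C * x powr (- 1) + D * (\<tau> x / (\<psi> x / x)))
      + 2 powr (K / H * ln x + 1) * (P / ln x) powr (\<phi> * ln x - 1) * x powr \<kappa>"
            unfolding add_divide_distrib by (intro add_mono t1 t2 t3)
        qed
        finally show "outer_prob M {\<omega> \<in> space M. dist_P_infinity (rescaled (nat \<lfloor>x\<rfloor>) (hawkes gap nchild delay \<omega>))
          (rescaled (nat \<lfloor>x\<rfloor>) (coupled_process gap nchild \<omega>)) > \<Delta>} / \<psi> x \<le> g x"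
          using elim by (simp add: x divide_right_mono)
      qed
    qed
    from eventually_compose_filterlim[OF this filterlim_real_sequentially] show ?thesis
      by eventually_elim auto
  qed
  show ?thesis
  proof (rule tendsto_sandwich)
    show "\<forall>\<^sub>F n in sequentially. 0 \<le> outer_prob M {\<omega> \<in> space M. dist_P_infinity (rescaled n (hawkes gap nchild delay \<omega>))
        (rescaled n (coupled_process gap nchild \<omega>)) > \<Delta>} / \<psi> (real n)"
      using eventually_compose_filterlim[OF \<psi>_pos filterlim_real_sequentially]
    proof eventually_elim
      case (elim n)
      have "0 \<le> outer_prob M E" if "E \<subseteq> space M" for E
        unfolding outer_prob_def using that by (intro cInf_greatest) auto
      then show ?case using elim by (intro divide_nonneg_pos) auto
    qed
    show "(\<lambda>n. g (real n)) \<longlonglongrightarrow> 0"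
      by (rule filterlim_compose[OF g filterlim_real_sequentially])
  qed (use le_g in auto)
qed

end

theorem proposition3p5:
  fixes M :: "'a measure"
    and c :: "'d::finite \<Rightarrow> real"
    and f :: "'d \<Rightarrow> 'd \<Rightarrow> real \<Rightarrow> real"
    and \<beta> :: "'d \<Rightarrow> 'd \<Rightarrow> real measure"
    and gap :: "'d \<Rightarrow> nat \<Rightarrow> 'a \<Rightarrow> real"
    and mark :: "'d label \<Rightarrow> 'd \<Rightarrow> 'a \<Rightarrow> real"
    and nchild :: "'d label \<Rightarrow> 'd \<Rightarrow> 'a \<Rightarrow> nat"
    and delay :: "'d label \<Rightarrow> 'd \<Rightarrow> nat \<Rightarrow> 'a \<Rightarrow> real"
    and \<alpha> :: "'d \<Rightarrow> 'd \<Rightarrow> real"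
    and k :: "'d \<Rightarrow> nat"
    and \<Delta> :: real
  assumes model: "hawkes_clusters M c f \<beta> gap mark nchild delay"
    and A1_finite: "\<And>i j. integrable (\<beta> i j) (\<lambda>x. x)"
    and A1: "spectral_radius (mean_offspring_matrix f \<beta>) < 1"
    and A2_index: "\<And>j i. \<alpha> j i > 1"
    and A2: "\<And>j i. regularly_varying (- \<alpha> j i) (\<lambda>x. measure (\<beta> j i) {x<..})"
    and A3: "\<And>j i. (\<integral>\<^sup>+\<omega>. ennreal (vec_nth (cluster_size nchild i 0 \<omega>) j) \<partial>M) > 0"
    and A4: "inj (\<lambda>(j, i). \<alpha> j i)"
    and k: "k \<noteq> (\<lambda>_. 0)"
    and tail: "\<And>p q. (\<lambda>x. LBINT t:{x / ln x..}. f p q t) \<in> o[at_top](\<lambda>x. breve_rate f \<beta> \<alpha> k x / x)"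
    and Delta: "\<Delta> > 0"
  shows "(\<lambda>n. outer_prob M {\<omega> \<in> space M.
             dist_P_infinity (rescaled n (hawkes gap nchild delay \<omega>))
                             (rescaled n (coupled_process gap nchild \<omega>)) > \<Delta>}
           / breve_rate f \<beta> \<alpha> k (real n)) \<longlonglongrightarrow> 0"
proof -
  interpret hawkes_clusters M c f \<beta> gap mark nchild delay by (rule model)
  interpret subcritical_hawkes M c f \<beta> gap mark nchild delay
    by unfold_locales (rule A1_finite, rule A1)
  obtain a C where aC: "1 < a" "0 < C"
    "\<And>w j k. w \<in> borel_measurable borel \<Longrightarrow> (\<And>i l. delay_mean i l w \<le> ennreal a) \<Longrightarrow>
      (\<integral>\<^sup>+p. expected_weight w j k p \<partial>count_space UNIV) \<le> ennreal C"
    using total_expected_weight_bound by blast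
  \<comment> \<open>The sum dominates each of its nonnegative terms, and the 1 makes it
    positive.\<close>
  define D where "D = (\<Sum>i\<in>UNIV. \<Sum>l\<in>UNIV. real CARD('d) * mean_kernel i l * C) + 1"
  have nn: "0 \<le> real CARD('d) * mean_kernel i l * C" for i l
    using mean_kernel_nonneg aC by simp
  have D: "real CARD('d) * mean_kernel i l * C \<le> D" for i l
  proof -
    have "real CARD('d) * mean_kernel i l * C \<le> (\<Sum>l\<in>UNIV. real CARD('d) * mean_kernel i l * C)"
      by (rule member_le_sum) (use nn in auto)
    also have "\<dots> \<le> (\<Sum>i\<in>UNIV. \<Sum>l\<in>UNIV. real CARD('d) * mean_kernel i l * C)"
      by (rule member_le_sum) (use nn in \<open>auto intro!: sum_nonneg\<close>)
    finally show ?thesis by (simp add: D_def)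
  qed
  have "0 < D" unfolding D_def using nn by (intro add_nonneg_pos sum_nonneg) auto
  interpret bounded_hawkes M c f \<beta> gap mark nchild delay a C D
    by unfold_locales (use aC D \<open>0 < D\<close> in auto)
  obtain \<kappa> where kappa: "0 \<le> \<kappa>" "\<forall>\<^sub>F x in at_top. x powr (- \<kappa>) \<le> breve_rate f \<beta> \<alpha> k x"
    using breve_rate_lower_bound[where \<alpha> = \<alpha> and k = k] A2 by blast
  obtain \<Lambda> where "0 < \<Lambda>" "\<And>x. 0 < x \<Longrightarrow> breve_rate f \<beta> \<alpha> k x \<le> \<Lambda>"
    using breve_rate_upper_bound[where \<alpha> = \<alpha> and k = k] by blast
  from outer_prob_dist_negligible[OF kappa this tail Delta] show ?thesis .
qed

end
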